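(* Let $\Lambda$ be a ring, and let $N$ be a right $T$-nilpotent two-sided ideal of $\Lambda$. Then the functor $-\otimes_\Lambda\Lambda/N$ induces a monoid isomorphism $\varphi\colon V^*(\Lambda)\to V^*(\Lambda/N)$ (given by $[P]\mapsto[P/PN]$) which restricts to monoid isomorphisms $V(\Lambda)\to V(\Lambda/N)$ and $V(\Lambda)\sqcup B(\Lambda)\to V(\Lambda/N)\sqcup B(\Lambda/N)$.
   Context: Rings are associative with $1$; modules are right modules. An ideal $N$ is right $T$-nilpotent if for every sequence $a_1,a_2,\dots$ of elements of $N$ there is $n$ with $a_na_{n-1}\cdots a_1=0$. $V(\Lambda)$ (resp. $V^*(\Lambda)$) is the set of isomorphism classes $[P]$ of finitely generated (resp. countably generated) projective right $\Lambda$-modules, a commutative monoid under $[P]+[P']=[P\oplus P']$. The trace of a right $\Lambda$-module $M$ is the two-sided ideal $\mathrm{Tr}_\Lambda(M)=\sum_{f\in\mathrm{Hom}_\Lambda(M,\Lambda)}f(M)$. A countably generated projective right $\Lambda$-module $P$ is relatively big if there is a countably generated projective right $\Lambda$-module $P'$ with trace ideal $J$ such that $P\oplus P'^{(\omega)}\cong P$ and $P/PJ$ is finitely generated. $B(\Lambda)\subseteq V^*(\Lambda)$ is the set of isomorphism classes of relatively big projective modules that are not finitely generated; $V(\Lambda)\sqcup B(\Lambda)$ is a submonoid of $V^*(\Lambda)$. *)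

theory Defs
  imports
    "HOL-Algebra.QuotRing"
    "HOL-Algebra.Generated_Groups"
    "HOL-Algebra.Free_Abelian_Groups"
    "HOL-Library.Countable_Set"
begin

section \<open>Right modules\<close>

text \<open>As for the library's (left) modules over commutative rings, the record extends \<open>ring\<close> only
  in order to reuse the additive notation; the fields \<open>mult\<close> and \<open>one\<close> of a module carry no
  meaning.\<close>

record ('a, 'm) right_module = "'m ring" +
  rsmult :: "'m \<Rightarrow> 'a \<Rightarrow> 'm" (infixl \<open>\<triangleleft>\<index>\<close> 70)

locale right_module = R?: ring R + M?: abelian_group M
  for R :: "('a, 'r) ring_scheme" (structure) and M :: "('a, 'm) right_module" (structure) +
  assumes rsmult_closed:
      "\<lbrakk>x \<in> carrier M; a \<in> carrier R\<rbrakk> \<Longrightarrow> x \<triangleleft>\<^bsub>M\<^esub> a \<in> carrier M"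
    and rsmult_l_distr:
      "\<lbrakk>x \<in> carrier M; y \<in> carrier M; a \<in> carrier R\<rbrakk> \<Longrightarrow>
        (x \<oplus>\<^bsub>M\<^esub> y) \<triangleleft>\<^bsub>M\<^esub> a = (x \<triangleleft>\<^bsub>M\<^esub> a) \<oplus>\<^bsub>M\<^esub> (y \<triangleleft>\<^bsub>M\<^esub> a)"
    and rsmult_r_distr:
      "\<lbrakk>x \<in> carrier M; a \<in> carrier R; b \<in> carrier R\<rbrakk> \<Longrightarrow>
        x \<triangleleft>\<^bsub>M\<^esub> (a \<oplus>\<^bsub>R\<^esub> b) = (x \<triangleleft>\<^bsub>M\<^esub> a) \<oplus>\<^bsub>M\<^esub> (x \<triangleleft>\<^bsub>M\<^esub> b)"
    and rsmult_assoc: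
      "\<lbrakk>x \<in> carrier M; a \<in> carrier R; b \<in> carrier R\<rbrakk> \<Longrightarrow>
        x \<triangleleft>\<^bsub>M\<^esub> (a \<otimes>\<^bsub>R\<^esub> b) = (x \<triangleleft>\<^bsub>M\<^esub> a) \<triangleleft>\<^bsub>M\<^esub> b"
    and rsmult_one:
      "x \<in> carrier M \<Longrightarrow> x \<triangleleft>\<^bsub>M\<^esub> \<one>\<^bsub>R\<^esub> = x"

definition rmod_hom ::
  "('a, 'r) ring_scheme \<Rightarrow> ('a, 'm) right_module \<Rightarrow> ('a, 'k) right_module \<Rightarrow> ('m \<Rightarrow> 'k) set"
  where "rmod_hom R M L =
    {f. f \<in> carrier M \<rightarrow> carrier L \<and>
        (\<forall>x\<in>carrier M. \<forall>y\<in>carrier M. f (x \<oplus>\<^bsub>M\<^esub> y) = f x \<oplus>\<^bsub>L\<^esub> f y) \<and>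
        (\<forall>x\<in>carrier M. \<forall>a\<in>carrier R. f (x \<triangleleft>\<^bsub>M\<^esub> a) = f x \<triangleleft>\<^bsub>L\<^esub> a)}"

definition rmod_isomorphic ::
  "('a, 'r) ring_scheme \<Rightarrow> ('a, 'm) right_module \<Rightarrow> ('a, 'k) right_module \<Rightarrow> bool"
  where "rmod_isomorphic R M L \<longleftrightarrow>
    (\<exists>f \<in> rmod_hom R M L. bij_betw f (carrier M) (carrier L))"

definition regular_module :: "('a, 'r) ring_scheme \<Rightarrow> ('a, 'a) right_module"
  where "regular_module R =
    \<lparr>carrier = carrier R, monoid.mult = undefined, one = undefined, ring.zero = \<zero>\<^bsub>R\<^esub>,
     add = (\<lambda>x y. x \<oplus>\<^bsub>R\<^esub> y),
     rsmult = (\<lambda>x a. x \<otimes>\<^bsub>R\<^esub> a)\<rparr>"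

definition zero_module :: "('a, unit) right_module"
  where "zero_module =
    \<lparr>carrier = {()}, monoid.mult = undefined, one = undefined, ring.zero = (), add = (\<lambda>_ _. ()),
     rsmult = (\<lambda>_ _. ())\<rparr>"

definition rmod_sum ::
  "('a, 'm) right_module \<Rightarrow> ('a, 'k) right_module \<Rightarrow> ('a, 'm \<times> 'k) right_module"
  where "rmod_sum M L =
    \<lparr>carrier = carrier M \<times> carrier L, monoid.mult = undefined, one = undefined,
     ring.zero = (\<zero>\<^bsub>M\<^esub>, \<zero>\<^bsub>L\<^esub>),
     add = (\<lambda>(x, y) (x', y'). (x \<oplus>\<^bsub>M\<^esub> x', y \<oplus>\<^bsub>L\<^esub> y')),
     rsmult = (\<lambda>(x, y) a. (x \<triangleleft>\<^bsub>M\<^esub> a, y \<triangleleft>\<^bsub>L\<^esub> a))\<rparr>"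

text \<open>The direct sum \<open>M\<^sup>(\<^sup>I\<^sup>)\<close> of copies of \<open>M\<close> indexed by \<open>I\<close>.\<close>

definition rmod_power :: "'i set \<Rightarrow> ('a, 'm) right_module \<Rightarrow> ('a, 'i \<Rightarrow> 'm) right_module"
  where "rmod_power I M =
    \<lparr>carrier = {f \<in> I \<rightarrow>\<^sub>E carrier M. finite {i \<in> I. f i \<noteq> \<zero>\<^bsub>M\<^esub>}},
     monoid.mult = undefined, one = undefined, ring.zero = (\<lambda>i\<in>I. \<zero>\<^bsub>M\<^esub>),
     add = (\<lambda>f g. \<lambda>i\<in>I. f i \<oplus>\<^bsub>M\<^esub> g i),
     rsmult = (\<lambda>f a. \<lambda>i\<in>I. f i \<triangleleft>\<^bsub>M\<^esub> a)\<rparr>"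

text \<open>The additive subgroup generated by all products \<open>x a\<close> with \<open>x \<in> S\<close> and \<open>a \<in> A\<close>. If \<open>A\<close> is a
  two-sided ideal and \<open>S = M\<close>, this is the submodule \<open>MA\<close>; if \<open>A\<close> is the whole ring, it is the
  submodule generated by \<open>S\<close>.\<close>

definition rmod_prod :: "('a, 'm) right_module \<Rightarrow> 'm set \<Rightarrow> 'a set \<Rightarrow> 'm set"
  where "rmod_prod M S A = generate (add_monoid M) {x \<triangleleft>\<^bsub>M\<^esub> a | x a. x \<in> S \<and> a \<in> A}"

definition finitely_generated :: "('a, 'r) ring_scheme \<Rightarrow> ('a, 'm) right_module \<Rightarrow> bool"
  where "finitely_generated R M \<longleftrightarrow>
    (\<exists>S \<subseteq> carrier M. finite S \<and> rmod_prod M S (carrier R) = carrier M)"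

definition countably_generated :: "('a, 'r) ring_scheme \<Rightarrow> ('a, 'm) right_module \<Rightarrow> bool"
  where "countably_generated R M \<longleftrightarrow>
    (\<exists>S \<subseteq> carrier M. countable S \<and> rmod_prod M S (carrier R) = carrier M)"

text \<open>A projective module is a direct summand of a free module. Restricting the basis and the
  complement to the types \<open>'m\<close> and \<open>'m \<Rightarrow> 'a\<close> loses nothing: the free module on the underlying
  set of \<open>M\<close> maps onto \<open>M\<close>, and the kernel of this map is a complement if \<open>M\<close> is projective.\<close>

definition projective :: "('a, 'r) ring_scheme \<Rightarrow> ('a, 'm) right_module \<Rightarrow> bool"
  where "projective R M \<longleftrightarrow> right_module R M \<and>
    (\<exists>(I :: 'm set) (Q :: ('a, 'm \<Rightarrow> 'a) right_module).
       right_module R Q \<and> rmod_isomorphic R (rmod_sum M Q) (rmod_power I (regular_module R)))"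

definition rmod_quot :: "('a, 'm) right_module \<Rightarrow> 'm set \<Rightarrow> ('a, 'm set) right_module"
  where "rmod_quot M L =
    \<lparr>carrier = a_rcosets\<^bsub>M\<^esub> L, monoid.mult = undefined, one = undefined, ring.zero = L, add = set_add M,
     rsmult = (\<lambda>X a. \<Union>x\<in>X. L +>\<^bsub>M\<^esub> (x \<triangleleft>\<^bsub>M\<^esub> a))\<rparr>"

text \<open>\<open>M / MN\<close> as a module over the quotient ring \<open>R Quot N\<close>.\<close>

definition rmod_reduction :: "('a, 'm) right_module \<Rightarrow> 'a set \<Rightarrow> ('a set, 'm set) right_module"
  where "rmod_reduction M N =
    (let L = rmod_prod M (carrier M) N in
    \<lparr>carrier = a_rcosets\<^bsub>M\<^esub> L, monoid.mult = undefined, one = undefined, ring.zero = L, add = set_add M,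
     rsmult = (\<lambda>X A. \<Union>x\<in>X. \<Union>a\<in>A. L +>\<^bsub>M\<^esub> (x \<triangleleft>\<^bsub>M\<^esub> a))\<rparr>)"


section \<open>Extension of scalars\<close>

text \<open>For a ring homomorphism \<open>h\<close> from \<open>R\<close> to \<open>S\<close>, the module \<open>M \<otimes>\<^sub>R S\<close> is the free abelian group
  on \<open>M \<times> S\<close> modulo the subgroup generated by the following elements, with \<open>S\<close> acting through the
  second component.\<close>

definition tensor_relators ::
  "('a, 'r) ring_scheme \<Rightarrow> ('b, 's) ring_scheme \<Rightarrow> ('a \<Rightarrow> 'b) \<Rightarrow> ('a, 'm) right_module \<Rightarrow>
    ('m \<times> 'b \<Rightarrow>\<^sub>0 int) set"
  where "tensor_relators R S h M =
    {frag_of (x \<oplus>\<^bsub>M\<^esub> y, s) - frag_of (x, s) - frag_of (y, s) | x y s.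
       x \<in> carrier M \<and> y \<in> carrier M \<and> s \<in> carrier S} \<union>
    {frag_of (x, s \<oplus>\<^bsub>S\<^esub> t) - frag_of (x, s) - frag_of (x, t) | x s t.
       x \<in> carrier M \<and> s \<in> carrier S \<and> t \<in> carrier S} \<union>
    {frag_of (x \<triangleleft>\<^bsub>M\<^esub> a, s) - frag_of (x, h a \<otimes>\<^bsub>S\<^esub> s) | x a s.
       x \<in> carrier M \<and> a \<in> carrier R \<and> s \<in> carrier S}"

definition extend_scalars ::
  "('a, 'r) ring_scheme \<Rightarrow> ('b, 's) ring_scheme \<Rightarrow> ('a \<Rightarrow> 'b) \<Rightarrow> ('a, 'm) right_module \<Rightarrow>
    ('b, ('m \<times> 'b \<Rightarrow>\<^sub>0 int) set) right_module"
  where "extend_scalars R S h M =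
    (let F = free_Abelian_group (carrier M \<times> carrier S);
         K = generate F (tensor_relators R S h M) in
    \<lparr>carrier = rcosets\<^bsub>F\<^esub> K, monoid.mult = undefined, one = undefined, ring.zero = K, add = set_mult F,
     rsmult = (\<lambda>X t. \<Union>c\<in>X. K #>\<^bsub>F\<^esub> frag_extend (\<lambda>(x, s). frag_of (x, s \<otimes>\<^bsub>S\<^esub> t)) c)\<rparr>)"


section \<open>Trace ideals and relatively big projective modules\<close>

definition trace_ideal :: "('a, 'r) ring_scheme \<Rightarrow> ('a, 'm) right_module \<Rightarrow> 'a set"
  where "trace_ideal R M =
    generate (add_monoid R) (\<Union>f\<in>rmod_hom R M (regular_module R). f ` carrier M)"

text \<open>Every countably generated right module over a ring with elements in \<open>'a\<close> is a quotient of the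
  free module on countably many generators, so it is isomorphic to a module with elements in
  \<open>nat \<Rightarrow> 'a\<close>. This type is therefore large enough for the quantifier over \<open>P'\<close>, and for the
  isomorphism classes below.\<close>

definition relatively_big :: "('a, 'r) ring_scheme \<Rightarrow> ('a, 'm) right_module \<Rightarrow> bool"
  where "relatively_big R P \<longleftrightarrow> projective R P \<and> countably_generated R P \<and>
    (\<exists>P' :: ('a, nat \<Rightarrow> 'a) right_module.
       projective R P' \<and> countably_generated R P' \<and>
       rmod_isomorphic R (rmod_sum P (rmod_power (UNIV :: nat set) P')) P \<and>
       finitely_generated R (rmod_quot P (rmod_prod P (carrier P) (trace_ideal R P'))))"


section \<open>Monoids of isomorphism classes\<close>

type_synonym 'a rmod_class = "('a, nat \<Rightarrow> 'a) right_module set"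

definition iso_class :: "('a, 'r) ring_scheme \<Rightarrow> ('a, 'm) right_module \<Rightarrow> 'a rmod_class"
  where "iso_class R M = {P. right_module R P \<and> rmod_isomorphic R P M}"

definition fg_projective_classes :: "('a, 'r) ring_scheme \<Rightarrow> 'a rmod_class set"
  where "fg_projective_classes R =
    {iso_class R P | P :: ('a, nat \<Rightarrow> 'a) right_module. projective R P \<and> finitely_generated R P}"

definition big_projective_classes :: "('a, 'r) ring_scheme \<Rightarrow> 'a rmod_class set"
  where "big_projective_classes R =
    {iso_class R P | P :: ('a, nat \<Rightarrow> 'a) right_module.
       relatively_big R P \<and> \<not> finitely_generated R P}"

definition Vstar_monoid :: "('a, 'r) ring_scheme \<Rightarrow> 'a rmod_class monoid"
  where "Vstar_monoid R =
    \<lparr>carrier = {iso_class R P | P :: ('a, nat \<Rightarrow> 'a) right_module.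
                  projective R P \<and> countably_generated R P},
     monoid.mult = (\<lambda>X Y. \<Union>P\<in>X. \<Union>Q\<in>Y. iso_class R (rmod_sum P Q)),
     one = iso_class R zero_module\<rparr>"

definition V_monoid :: "('a, 'r) ring_scheme \<Rightarrow> 'a rmod_class monoid"
  where "V_monoid R = (Vstar_monoid R)\<lparr>carrier := fg_projective_classes R\<rparr>"

definition VB_monoid :: "('a, 'r) ring_scheme \<Rightarrow> 'a rmod_class monoid"
  where "VB_monoid R =
    (Vstar_monoid R)\<lparr>carrier := fg_projective_classes R \<union> big_projective_classes R\<rparr>"

text \<open>The library's \<open>iso\<close> does not ask for preservation of the neutral element.\<close>

definition monoid_iso :: "('a, 'c) monoid_scheme \<Rightarrow> ('b, 'd) monoid_scheme \<Rightarrow> ('a \<Rightarrow> 'b) set"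
  where "monoid_iso G H = {f \<in> iso G H. f \<one>\<^bsub>G\<^esub> = \<one>\<^bsub>H\<^esub>}"


section \<open>Right T-nilpotent ideals\<close>

text \<open>\<open>left_product R a n\<close> is \<open>a\<^sub>n \<cdots> a\<^sub>1 a\<^sub>0\<close>: each new factor is multiplied on the left.\<close>

primrec left_product :: "('a, 'r) ring_scheme \<Rightarrow> (nat \<Rightarrow> 'a) \<Rightarrow> nat \<Rightarrow> 'a"
  where
    "left_product R a 0 = a 0"
  | "left_product R a (Suc n) = a (Suc n) \<otimes>\<^bsub>R\<^esub> left_product R a n"

definition right_T_nilpotent :: "('a, 'r) ring_scheme \<Rightarrow> 'a set \<Rightarrow> bool"
  where "right_T_nilpotent R N \<longleftrightarrow>
    (\<forall>a. (\<forall>i. a i \<in> N) \<longrightarrow> (\<exists>n. left_product R a n = \<zero>\<^bsub>R\<^esub>))"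

end

theory Submission
  imports Defs
begin

text \<open>A countably generated projective right \<open>R\<close>-module is the same as a retract of the free module
  \<open>F\<close> on countably many generators, and projectivity enters only in this form
  (\<open>projective_countably_generated_iff\<close>). Reduction modulo \<open>N\<close> is described by maps
  \<open>\<pi> : M \<rightarrow> L\<close> onto an \<open>R/N\<close>-module that are linear along \<open>R \<rightarrow> R/N\<close> and have kernel \<open>MN\<close>. Such an
  \<open>L\<close> is unique up to isomorphism, and \<open>M/MN\<close> and \<open>M \<otimes> R/N\<close> are two models of it.

  T-nilpotency is used through two consequences of one induction principle
  (\<open>T_nilpotent_submodule_induct\<close>), which hold for all modules and not only for finitely
  generated ones. The first is Nakayama's lemma: if \<open>M = MN + H\<close>, then \<open>H = M\<close>. The second is that an
  endomorphism \<open>f\<close> of \<open>M\<close> with \<open>f(M) \<subseteq> MN\<close> is locally nilpotent.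

  The map \<open>[P] \<mapsto> [P/PN]\<close> is injective: an isomorphism \<open>P/PN \<rightarrow> Q/QN\<close> lifts to a homomorphism
  \<open>f : P \<rightarrow> Q\<close>, which is onto by Nakayama and hence has a right inverse \<open>g\<close>, because \<open>Q\<close> is
  projective. The reduction of \<open>g\<close> is inverse to the given isomorphism, so \<open>g\<close> is onto as well, and
  \<open>f\<close> is an isomorphism (\<open>isomorphic_if_reductions_isomorphic\<close>).

  It is surjective (\<open>lift_countably_projective\<close>): a countably generated projective \<open>R/N\<close>-module is
  the image of an idempotent endomorphism of the free module on countably many generators. Lift this
  idempotent to an endomorphism \<open>A\<close> of \<open>F\<close>. Then \<open>A(1 - A)\<close> maps \<open>F\<close> into \<open>FN\<close>, so it is locally
  nilpotent, and as in Fitting's lemma \<open>F\<close> is the direct sum of the elements killed by a power of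
  \<open>A\<close> and the elements killed by a power of \<open>1 - A\<close>. The second summand is projective and reduces to
  the given module.

  By Nakayama, \<open>P\<close> is finitely generated if and only if \<open>P/PN\<close> is, which gives the statement on
  \<open>V\<close>. For relatively big modules, let \<open>Q\<close> be the reduction of \<open>P'\<close>. Homomorphisms \<open>Q \<rightarrow> R/N\<close> lift to
  homomorphisms \<open>P' \<rightarrow> R\<close>, so the trace ideal of \<open>Q\<close> is the image of the trace ideal \<open>J\<close> of \<open>P'\<close>. Hence
  finite generation of \<open>P/PJ\<close> passes to and from the reductions, again by Nakayama, and so does
  \<open>P \<oplus> P'\<^sup>(\<^sup>\<omega>\<^sup>) \<cong> P\<close>, by functoriality and by injectivity. Every \<open>Q\<close> arises from some \<open>P'\<close> by surjectivity
  (\<open>relatively_big_reduction\<close>).\<close>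

section \<open>Modules, submodules and homomorphisms\<close>

context right_module
begin

lemma rsmult_zero_left:
  assumes "a \<in> carrier R" shows "\<zero>\<^bsub>M\<^esub> \<triangleleft>\<^bsub>M\<^esub> a = \<zero>\<^bsub>M\<^esub>"
proof -
  have "\<zero>\<^bsub>M\<^esub> \<triangleleft>\<^bsub>M\<^esub> a \<oplus>\<^bsub>M\<^esub> \<zero>\<^bsub>M\<^esub> \<triangleleft>\<^bsub>M\<^esub> a = \<zero>\<^bsub>M\<^esub> \<triangleleft>\<^bsub>M\<^esub> a"
    using assms rsmult_l_distr[of "\<zero>\<^bsub>M\<^esub>" "\<zero>\<^bsub>M\<^esub>" a] by simp
  then show ?thesis
    using assms by (metis M.add.l_cancel_one M.zero_closed rsmult_closed)
qed

lemma rsmult_zero_right: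
  assumes "x \<in> carrier M" shows "x \<triangleleft>\<^bsub>M\<^esub> \<zero>\<^bsub>R\<^esub> = \<zero>\<^bsub>M\<^esub>"
proof -
  have "x \<triangleleft>\<^bsub>M\<^esub> \<zero>\<^bsub>R\<^esub> \<oplus>\<^bsub>M\<^esub> x \<triangleleft>\<^bsub>M\<^esub> \<zero>\<^bsub>R\<^esub> = x \<triangleleft>\<^bsub>M\<^esub> \<zero>\<^bsub>R\<^esub>"
    using assms rsmult_r_distr[of x "\<zero>\<^bsub>R\<^esub>" "\<zero>\<^bsub>R\<^esub>"] by simp
  then show ?thesis
    using assms by (metis M.add.l_cancel_one R.zero_closed rsmult_closed)
qed

lemma rsmult_minus_right:
  assumes "x \<in> carrier M" "a \<in> carrier R"
  shows "x \<triangleleft>\<^bsub>M\<^esub> (\<ominus>\<^bsub>R\<^esub> a) = \<ominus>\<^bsub>M\<^esub> (x \<triangleleft>\<^bsub>M\<^esub> a)"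
proof -
  have "x \<triangleleft>\<^bsub>M\<^esub> (\<ominus>\<^bsub>R\<^esub> a) \<oplus>\<^bsub>M\<^esub> x \<triangleleft>\<^bsub>M\<^esub> a = \<zero>\<^bsub>M\<^esub>"
    using assms rsmult_r_distr[of x "\<ominus>\<^bsub>R\<^esub> a" a] by (simp add: R.l_neg rsmult_zero_right)
  then show ?thesis
    using assms by (simp add: M.minus_equality rsmult_closed)
qed

lemma rsmult_minus_one:
  assumes "x \<in> carrier M" shows "x \<triangleleft>\<^bsub>M\<^esub> (\<ominus>\<^bsub>R\<^esub> \<one>\<^bsub>R\<^esub>) = \<ominus>\<^bsub>M\<^esub> x"
  using assms by (simp add: rsmult_minus_right rsmult_one)

lemma minus_add_cancel:
  "\<lbrakk>x \<in> carrier M; y \<in> carrier M\<rbrakk> \<Longrightarrow> (x \<ominus>\<^bsub>M\<^esub> y) \<oplus>\<^bsub>M\<^esub> y = x"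
  by (simp add: a_minus_def M.a_assoc M.l_neg)

end

definition submodule ::
    "('a, 'r) ring_scheme \<Rightarrow> ('a, 'm) right_module \<Rightarrow> 'm set \<Rightarrow> bool"
  where "submodule R M H \<longleftrightarrow> H \<subseteq> carrier M \<and> \<zero>\<^bsub>M\<^esub> \<in> H \<and>
    (\<forall>x\<in>H. \<forall>y\<in>H. x \<oplus>\<^bsub>M\<^esub> y \<in> H) \<and> (\<forall>x\<in>H. \<forall>a\<in>carrier R. x \<triangleleft>\<^bsub>M\<^esub> a \<in> H)"

lemma submodule_zero: "right_module R M \<Longrightarrow> submodule R M {\<zero>\<^bsub>M\<^esub>}"
proof -
  assume "right_module R M"
  then interpret right_module R M .
  show ?thesis by (auto simp: submodule_def rsmult_zero_left)
qed

lemma submodule_minus: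
  fixes M (structure)
  assumes "right_module R M" "submodule R M H" "x \<in> H" shows "\<ominus> x \<in> H"
proof -
  interpret right_module R M by fact
  have "x \<in> carrier M" using assms by (auto simp: submodule_def)
  then have "\<ominus> x = x \<triangleleft> (\<ominus>\<^bsub>R\<^esub> \<one>\<^bsub>R\<^esub>)" by (simp add: rsmult_minus_one)
  then show ?thesis using assms by (simp add: submodule_def)
qed

lemma submodule_abelian_subgroup:
  assumes "right_module R M" "submodule R M H" shows "abelian_subgroup H M"
proof -
  interpret right_module R M by fact
  show ?thesis
  proof (rule abelian_subgroupI3)
    show "additive_subgroup H M"
      using assms submodule_minus[OF assms]
      by (auto simp: additive_subgroup_def submodule_def a_inv_def intro!: M.add.subgroupI)
  qed (rule M.abelian_group_axioms)
qed

lemma right_module_submodule: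
  assumes "right_module R M" "submodule R M H" shows "right_module R (M\<lparr>carrier := H\<rparr>)"
proof -
  interpret right_module R M by fact
  have sub: "x \<in> carrier M" if "x \<in> H" for x using assms that by (auto simp: submodule_def)
  have "abelian_group (M\<lparr>carrier := H\<rparr>)"
  proof (rule abelian_groupI)
    fix x assume "x \<in> carrier (M\<lparr>carrier := H\<rparr>)"
    then show "\<exists>y\<in>carrier (M\<lparr>carrier := H\<rparr>). y \<oplus>\<^bsub>M\<lparr>carrier := H\<rparr>\<^esub> x = \<zero>\<^bsub>M\<lparr>carrier := H\<rparr>\<^esub>"
      using submodule_minus[OF assms] sub by (auto intro!: bexI[of _ "\<ominus>\<^bsub>M\<^esub> x"] simp: M.l_neg)
  qed (use assms sub in \<open>auto simp: submodule_def M.a_ac\<close>)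
  then show ?thesis
    using assms sub
    by (auto simp: right_module_def right_module_axioms_def submodule_def R.ring_axioms
        rsmult_l_distr rsmult_r_distr rsmult_assoc rsmult_one)
qed

lemma rmod_homI:
  assumes "\<And>x. x \<in> carrier M \<Longrightarrow> f x \<in> carrier L"
    and "\<And>x y. \<lbrakk>x \<in> carrier M; y \<in> carrier M\<rbrakk> \<Longrightarrow> f (x \<oplus>\<^bsub>M\<^esub> y) = f x \<oplus>\<^bsub>L\<^esub> f y"
    and "\<And>x a. \<lbrakk>x \<in> carrier M; a \<in> carrier R\<rbrakk> \<Longrightarrow> f (x \<triangleleft>\<^bsub>M\<^esub> a) = f x \<triangleleft>\<^bsub>L\<^esub> a"
  shows "f \<in> rmod_hom R M L"
  using assms by (auto simp: rmod_hom_def)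

lemma rmod_hom_closed: "\<lbrakk>f \<in> rmod_hom R M L; x \<in> carrier M\<rbrakk> \<Longrightarrow> f x \<in> carrier L"
  by (auto simp: rmod_hom_def)

lemma rmod_hom_add:
  "\<lbrakk>f \<in> rmod_hom R M L; x \<in> carrier M; y \<in> carrier M\<rbrakk> \<Longrightarrow> f (x \<oplus>\<^bsub>M\<^esub> y) = f x \<oplus>\<^bsub>L\<^esub> f y"
  by (auto simp: rmod_hom_def)

lemma rmod_hom_smult:
  "\<lbrakk>f \<in> rmod_hom R M L; x \<in> carrier M; a \<in> carrier R\<rbrakk> \<Longrightarrow> f (x \<triangleleft>\<^bsub>M\<^esub> a) = f x \<triangleleft>\<^bsub>L\<^esub> a"
  by (auto simp: rmod_hom_def)

lemma rmod_hom_zero: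
  fixes M (structure)
  assumes "right_module R M" "right_module R L" "f \<in> rmod_hom R M L"
  shows "f \<zero> = \<zero>\<^bsub>L\<^esub>"
proof -
  interpret M: right_module R M by fact
  interpret L: right_module R L by fact
  have "f \<zero> \<oplus>\<^bsub>L\<^esub> f \<zero> = f \<zero>"
    using rmod_hom_add[OF assms(3), of "\<zero>" "\<zero>"] by simp
  then show ?thesis
    using rmod_hom_closed[OF assms(3)] by (metis L.M.add.l_cancel_one M.M.zero_closed)
qed

lemma rmod_hom_minus:
  assumes "right_module R M" "right_module R L" "f \<in> rmod_hom R M L" "x \<in> carrier M"
  shows "f (\<ominus>\<^bsub>M\<^esub> x) = \<ominus>\<^bsub>L\<^esub> f x"
proof -
  interpret M: right_module R M by fact
  interpret L: right_module R L by fact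
  show ?thesis
    using rmod_hom_smult[OF assms(3,4), of "\<ominus>\<^bsub>R\<^esub> \<one>\<^bsub>R\<^esub>"] rmod_hom_closed[OF assms(3,4)] assms(4)
    by (simp add: M.rsmult_minus_one L.rsmult_minus_one)
qed

lemma rmod_hom_diff:
  assumes "right_module R M" "right_module R L" "f \<in> rmod_hom R M L"
    "x \<in> carrier M" "y \<in> carrier M"
  shows "f (x \<ominus>\<^bsub>M\<^esub> y) = f x \<ominus>\<^bsub>L\<^esub> f y"
proof -
  interpret M: right_module R M by fact
  show ?thesis
    using assms by (simp add: a_minus_def rmod_hom_add rmod_hom_minus)
qed

lemma rmod_hom_id: "id \<in> rmod_hom R M M"
  by (auto simp: rmod_hom_def)

lemma rmod_hom_comp:
  "\<lbrakk>f \<in> rmod_hom R M L; g \<in> rmod_hom R L K\<rbrakk> \<Longrightarrow> g \<circ> f \<in> rmod_hom R M K"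
  by (auto simp: rmod_hom_def Pi_iff)

lemma rmod_hom_kernel_submodule:
  assumes "right_module R M" "right_module R L" "f \<in> rmod_hom R M L"
  shows "submodule R M {x \<in> carrier M. f x = \<zero>\<^bsub>L\<^esub>}"
proof -
  interpret M: right_module R M by fact
  interpret L: right_module R L by fact
  show ?thesis
    using assms by (auto simp: submodule_def rmod_hom_zero rmod_hom_add rmod_hom_smult
        M.rsmult_closed L.rsmult_zero_left)
qed

lemma rmod_hom_image_submodule:
  assumes "right_module R M" "right_module R L" "f \<in> rmod_hom R M L"
  shows "submodule R L (f ` carrier M)"
proof -
  interpret M: right_module R M by fact
  have "f x \<oplus>\<^bsub>L\<^esub> f y \<in> f ` carrier M" if "x \<in> carrier M" "y \<in> carrier M" for x y
    using that rmod_hom_add[OF assms(3), symmetric] by auto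
  moreover have "f x \<triangleleft>\<^bsub>L\<^esub> a \<in> f ` carrier M" if "x \<in> carrier M" "a \<in> carrier R" for x a
    using that rmod_hom_smult[OF assms(3), symmetric] M.rsmult_closed by auto
  moreover have "\<zero>\<^bsub>L\<^esub> \<in> f ` carrier M"
    using rmod_hom_zero[OF assms] by (metis M.M.zero_closed image_eqI)
  ultimately show ?thesis
    using rmod_hom_closed[OF assms(3)] by (auto simp: submodule_def)
qed

lemma rmod_hom_inj_on:
  fixes M (structure)
  assumes "right_module R M" "right_module R L" "f \<in> rmod_hom R M L"
    and "\<And>x. \<lbrakk>x \<in> carrier M; f x = \<zero>\<^bsub>L\<^esub>\<rbrakk> \<Longrightarrow> x = \<zero>"
  shows "inj_on f (carrier M)"
proof
  interpret M: right_module R M by fact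
  interpret L: right_module R L by fact
  fix x y assume xy: "x \<in> carrier M" "y \<in> carrier M" "f x = f y"
  then have "f (x \<ominus> y) = \<zero>\<^bsub>L\<^esub>"
    using rmod_hom_diff[OF assms(1-3), of x y] rmod_hom_closed[OF assms(3) xy(2)]
    by (simp add: L.M.r_neg a_minus_def)
  then have "x \<ominus> y = \<zero>" using assms(4) xy by simp
  then show "x = y" using xy M.minus_add_cancel[of x y] by simp
qed

lemma rmod_hom_inv_into:
  fixes M (structure)
  assumes "right_module R M" "f \<in> rmod_hom R M L" "bij_betw f (carrier M) (carrier L)"
  shows "inv_into (carrier M) f \<in> rmod_hom R L M"
proof (rule rmod_homI)
  interpret M: right_module R M by fact
  let ?g = "inv_into (carrier M) f"
  have g: "?g y \<in> carrier M" "f (?g y) = y" if "y \<in> carrier L" for y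
    using assms(3) that by (auto simp: bij_betw_def inv_into_into f_inv_into_f)
  have gf: "?g (f x) = x" if "x \<in> carrier M" for x
    using assms(3) that by (auto simp: bij_betw_def)
  show "?g y \<in> carrier M" if "y \<in> carrier L" for y using g that by simp
  show "?g (y \<oplus>\<^bsub>L\<^esub> z) = ?g y \<oplus> ?g z" if "y \<in> carrier L" "z \<in> carrier L" for y z
    using rmod_hom_add[OF assms(2) g(1) g(1), OF that] g(2) that gf[of "?g y \<oplus> ?g z"] g(1)
    by simp
  show "?g (y \<triangleleft>\<^bsub>L\<^esub> a) = ?g y \<triangleleft> a" if "y \<in> carrier L" "a \<in> carrier R" for y a
    using rmod_hom_smult[OF assms(2) g(1), OF that] g(2) that gf[of "?g y \<triangleleft> a"] g(1)
    by (simp add: M.rsmult_closed)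
qed

lemma rmod_isomorphic_refl: "rmod_isomorphic R M M"
  unfolding rmod_isomorphic_def using rmod_hom_id[of R M] bij_betw_id by blast

lemma rmod_isomorphic_sym:
  assumes "right_module R M" "rmod_isomorphic R M L" shows "rmod_isomorphic R L M"
  using assms rmod_hom_inv_into bij_betw_inv_into unfolding rmod_isomorphic_def by metis

lemma rmod_isomorphic_trans:
  "\<lbrakk>rmod_isomorphic R M L; rmod_isomorphic R L K\<rbrakk> \<Longrightarrow> rmod_isomorphic R M K"
  unfolding rmod_isomorphic_def by (meson rmod_hom_comp bij_betw_trans)

lemma rmod_isomorphicI:
  assumes "f \<in> rmod_hom R M L" "g \<in> rmod_hom R L M"
    and "\<And>x. x \<in> carrier M \<Longrightarrow> g (f x) = x" "\<And>y. y \<in> carrier L \<Longrightarrow> f (g y) = y"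
  shows "rmod_isomorphic R M L"
proof -
  have "bij_betw f (carrier M) (carrier L)"
    by (rule bij_betw_byWitness[of _ g])
       (use assms rmod_hom_closed[OF assms(1)] rmod_hom_closed[OF assms(2)] in auto)
  then show ?thesis using assms(1) by (auto simp: rmod_isomorphic_def)
qed

text \<open>Every construction of a quotient below is a surjective image of a module, and identities pass
  to surjective images; this replaces computations with cosets. The scalars may change along a
  surjective ring homomorphism.\<close>

lemma right_module_image:
  fixes M (structure)
  assumes "ring S" "right_module R M" "h \<in> ring_hom R S" "h ` carrier R = carrier S"
    and surj: "q ` carrier M = carrier Q" and zero: "q \<zero> = \<zero>\<^bsub>Q\<^esub>"
    and add: "\<And>x y. \<lbrakk>x \<in> carrier M; y \<in> carrier M\<rbrakk> \<Longrightarrow> q (x \<oplus> y) = q x \<oplus>\<^bsub>Q\<^esub> q y"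
    and smult: "\<And>x a. \<lbrakk>x \<in> carrier M; a \<in> carrier R\<rbrakk> \<Longrightarrow> q (x \<triangleleft> a) = q x \<triangleleft>\<^bsub>Q\<^esub> h a"
  shows "right_module S Q"
proof -
  interpret right_module R M by fact
  note [simp] = add[symmetric] smult[symmetric] zero[symmetric]
    ring_hom_add[OF assms(3), symmetric] ring_hom_mult[OF assms(3), symmetric]
    ring_hom_one[OF assms(3), symmetric]
  have "abelian_group Q"
  proof (rule abelian_groupI, unfold surj[symmetric])
    fix x assume "x \<in> q ` carrier M"
    then obtain y where "x = q y" "y \<in> carrier M" by auto
    then show "\<exists>y\<in>q ` carrier M. y \<oplus>\<^bsub>Q\<^esub> x = \<zero>\<^bsub>Q\<^esub>"
      by (intro bexI[of _ "q (\<ominus> y)"]) (auto simp: M.l_neg)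
  qed (auto simp: M.a_ac)
  then show ?thesis
    unfolding right_module_def right_module_axioms_def surj[symmetric] assms(4)[symmetric]
    using assms(1)
    by (auto simp: rsmult_closed rsmult_l_distr rsmult_r_distr rsmult_assoc rsmult_one)
qed

definition restrict_scalars ::
    "('a \<Rightarrow> 'b) \<Rightarrow> ('b, 'm) right_module \<Rightarrow> ('a, 'm) right_module"
  where "restrict_scalars h L =
    \<lparr>carrier = carrier L, monoid.mult = undefined, one = undefined, ring.zero = \<zero>\<^bsub>L\<^esub>,
     add = add L, rsmult = (\<lambda>x a. x \<triangleleft>\<^bsub>L\<^esub> h a)\<rparr>"

lemma restrict_scalars_simps [simp]:
  "carrier (restrict_scalars h L) = carrier L"
  "\<zero>\<^bsub>restrict_scalars h L\<^esub> = \<zero>\<^bsub>L\<^esub>"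
  "x \<oplus>\<^bsub>restrict_scalars h L\<^esub> y = x \<oplus>\<^bsub>L\<^esub> y"
  "x \<triangleleft>\<^bsub>restrict_scalars h L\<^esub> a = x \<triangleleft>\<^bsub>L\<^esub> h a"
  by (simp_all add: restrict_scalars_def)

lemma right_module_restrict_scalars:
  assumes "ring R" "h \<in> ring_hom R S" "right_module S L"
  shows "right_module R (restrict_scalars h L)"
proof -
  interpret right_module S L by fact
  have "abelian_group (restrict_scalars h L)"
    by (rule abelian_groupI) (auto simp: M.a_ac intro: M.l_neg M.a_inv_closed)
  then show ?thesis
    using assms(1) ring_hom_closed[OF assms(2)]
    by (auto simp: right_module_def right_module_axioms_def rsmult_closed rsmult_l_distr
        rsmult_r_distr rsmult_assoc rsmult_one ring_hom_add[OF assms(2)]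
        ring_hom_mult[OF assms(2)] ring_hom_one[OF assms(2)])
qed

lemma regular_module_simps [simp]:
  "carrier (regular_module R) = carrier R"
  "\<zero>\<^bsub>regular_module R\<^esub> = \<zero>\<^bsub>R\<^esub>"
  "x \<oplus>\<^bsub>regular_module R\<^esub> y = x \<oplus>\<^bsub>R\<^esub> y"
  "x \<triangleleft>\<^bsub>regular_module R\<^esub> a = x \<otimes>\<^bsub>R\<^esub> a"
  by (simp_all add: regular_module_def)

lemma right_module_regular: "ring R \<Longrightarrow> right_module R (regular_module R)"
proof -
  assume "ring R"
  then interpret ring R .
  have "abelian_group (regular_module R)"
    by (rule abelian_groupI) (auto simp: a_ac intro: l_neg a_inv_closed)
  then show ?thesis
    by (auto simp: right_module_def right_module_axioms_def ring_axioms l_distr r_distr m_assoc)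
qed

lemma right_module_zero: "ring R \<Longrightarrow> right_module R zero_module"
  by (auto simp: right_module_def right_module_axioms_def zero_module_def intro!: abelian_groupI)

lemma rmod_sum_simps [simp]:
  "carrier (rmod_sum M L) = carrier M \<times> carrier L"
  "\<zero>\<^bsub>rmod_sum M L\<^esub> = (\<zero>\<^bsub>M\<^esub>, \<zero>\<^bsub>L\<^esub>)"
  "(x, y) \<oplus>\<^bsub>rmod_sum M L\<^esub> (x', y') = (x \<oplus>\<^bsub>M\<^esub> x', y \<oplus>\<^bsub>L\<^esub> y')"
  "(x, y) \<triangleleft>\<^bsub>rmod_sum M L\<^esub> a = (x \<triangleleft>\<^bsub>M\<^esub> a, y \<triangleleft>\<^bsub>L\<^esub> a)"
  by (simp_all add: rmod_sum_def)

lemma right_module_sum: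
  assumes "right_module R M" "right_module R L" shows "right_module R (rmod_sum M L)"
proof -
  interpret M: right_module R M by fact
  interpret L: right_module R L by fact
  have "abelian_group (rmod_sum M L)"
    by (rule abelian_groupI)
       (auto simp: M.M.a_ac L.M.a_ac
          intro: M.M.l_neg L.M.l_neg M.M.a_inv_closed L.M.a_inv_closed)
  then show ?thesis
    unfolding right_module_def right_module_axioms_def
    by (simp add: M.R.ring_axioms split_paired_all
        M.rsmult_closed M.rsmult_l_distr M.rsmult_r_distr M.rsmult_assoc M.rsmult_one
        L.rsmult_closed L.rsmult_l_distr L.rsmult_r_distr L.rsmult_assoc L.rsmult_one)
qed

lemma rmod_hom_pair:
  assumes "f \<in> rmod_hom R M L" "g \<in> rmod_hom R M K"
  shows "(\<lambda>x. (f x, g x)) \<in> rmod_hom R M (rmod_sum L K)"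
  using assms by (auto simp: rmod_hom_def)

lemma rmod_hom_fst: "fst \<in> rmod_hom R (rmod_sum M L) M"
  and rmod_hom_snd: "snd \<in> rmod_hom R (rmod_sum M L) L"
  by (auto simp: rmod_hom_def)

lemma rmod_hom_plus:
  assumes "right_module R L" "f \<in> rmod_hom R M L" "g \<in> rmod_hom R M L"
  shows "(\<lambda>x. f x \<oplus>\<^bsub>L\<^esub> g x) \<in> rmod_hom R M L"
proof -
  interpret right_module R L by fact
  note cl = rmod_hom_closed[OF assms(2)] rmod_hom_closed[OF assms(3)]
  show ?thesis
    by (rule rmod_homI)
       (simp_all add: cl rmod_hom_add[OF assms(2)] rmod_hom_add[OF assms(3)] M.a_ac
          rmod_hom_smult[OF assms(2)] rmod_hom_smult[OF assms(3)] rsmult_l_distr)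
qed

lemma rmod_hom_minus_fun:
  assumes "right_module R L" "f \<in> rmod_hom R M L" "g \<in> rmod_hom R M L"
  shows "(\<lambda>x. f x \<ominus>\<^bsub>L\<^esub> g x) \<in> rmod_hom R M L"
proof -
  interpret right_module R L by fact
  note cl = rmod_hom_closed[OF assms(3)]
  have "(\<lambda>x. \<ominus>\<^bsub>L\<^esub> g x) \<in> rmod_hom R M L"
  proof (rule rmod_homI)
    fix x a assume x: "x \<in> carrier M" "a \<in> carrier R"
    have "(\<ominus>\<^bsub>L\<^esub> g x) \<triangleleft>\<^bsub>L\<^esub> a \<oplus>\<^bsub>L\<^esub> g x \<triangleleft>\<^bsub>L\<^esub> a = \<zero>\<^bsub>L\<^esub>"
      using x cl by (simp add: rsmult_l_distr[symmetric] M.l_neg rsmult_zero_left)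
    then have "\<ominus>\<^bsub>L\<^esub> (g x \<triangleleft>\<^bsub>L\<^esub> a) = (\<ominus>\<^bsub>L\<^esub> g x) \<triangleleft>\<^bsub>L\<^esub> a"
      using x cl by (intro M.minus_equality) (auto intro!: rsmult_closed)
    then show "\<ominus>\<^bsub>L\<^esub> g (x \<triangleleft>\<^bsub>M\<^esub> a) = (\<ominus>\<^bsub>L\<^esub> g x) \<triangleleft>\<^bsub>L\<^esub> a"
      using x by (simp add: rmod_hom_smult[OF assms(3)])
  qed (simp_all add: cl rmod_hom_add[OF assms(3)] M.minus_add)
  then show ?thesis
    unfolding a_minus_def by (rule rmod_hom_plus[OF assms(1,2)])
qed

lemma rmod_hom_on_submodule:
  assumes "f \<in> rmod_hom R M L" "submodule R M U"
  shows "f \<in> rmod_hom R (M\<lparr>carrier := U\<rparr>) L"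
proof -
  have "x \<in> carrier M" if "x \<in> U" for x using that assms(2) by (auto simp: submodule_def)
  then show ?thesis
    by (intro rmod_homI)
       (simp_all add: rmod_hom_closed[OF assms(1)] rmod_hom_add[OF assms(1)] rmod_hom_smult[OF assms(1)])
qed

section \<open>Generated submodules\<close>

lemma rmod_prod_subset:
  assumes "right_module R M" "T \<subseteq> carrier M" "A \<subseteq> carrier R"
  shows "rmod_prod M T A \<subseteq> carrier M"
proof -
  interpret right_module R M by fact
  show ?thesis
    unfolding rmod_prod_def
    by (rule M.add.generate_incl) (use assms(2,3) in \<open>auto intro!: rsmult_closed\<close>)
qed

lemma rmod_prod_zero: "\<zero>\<^bsub>M\<^esub> \<in> rmod_prod M T A"
  unfolding rmod_prod_def using generate.one[of "add_monoid M"] by simp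

lemma rmod_prod_smult: "\<lbrakk>x \<in> T; a \<in> A\<rbrakk> \<Longrightarrow> x \<triangleleft>\<^bsub>M\<^esub> a \<in> rmod_prod M T A"
  unfolding rmod_prod_def by (auto intro: generate.incl)

lemma rmod_prod_add:
  "\<lbrakk>x \<in> rmod_prod M T A; y \<in> rmod_prod M T A\<rbrakk> \<Longrightarrow> x \<oplus>\<^bsub>M\<^esub> y \<in> rmod_prod M T A"
  unfolding rmod_prod_def using generate.eng[of x "add_monoid M" _ y] by simp

lemma rmod_prod_induct [consumes 5, case_names zero smult add]:
  fixes M (structure)
  assumes "right_module R M" "T \<subseteq> carrier M" "A \<subseteq> carrier R"
    and A: "\<forall>a\<in>A. \<ominus>\<^bsub>R\<^esub> a \<in> A"
    and "x \<in> rmod_prod M T A"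
    and zero: "P \<zero>"
    and smult: "\<And>x a. \<lbrakk>x \<in> T; a \<in> A\<rbrakk> \<Longrightarrow> P (x \<triangleleft> a)"
    and add: "\<And>x y. \<lbrakk>x \<in> rmod_prod M T A; y \<in> rmod_prod M T A; P x; P y\<rbrakk> \<Longrightarrow> P (x \<oplus> y)"
  shows "P x"
proof -
  interpret right_module R M by fact
  have "x \<in> generate (add_monoid M) {x \<triangleleft> a | x a. x \<in> T \<and> a \<in> A}"
    using assms(5) by (simp add: rmod_prod_def)
  then show ?thesis
  proof (induction rule: generate.induct)
    case one
    then show ?case using zero by simp
  next
    case (incl h)
    then show ?case using smult by auto
  next
    case (inv h)
    then obtain x a where *: "h = x \<triangleleft> a" "x \<in> T" "a \<in> A" by auto
    then have "inv\<^bsub>add_monoid M\<^esub> h = x \<triangleleft> (\<ominus>\<^bsub>R\<^esub> a)"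
      using assms(2,3) rsmult_minus_right[of x a] by (simp add: a_inv_def[symmetric] subsetD)
    then show ?case using * smult A by simp
  next
    case (eng h1 h2)
    then show ?case using add by (simp add: rmod_prod_def)
  qed
qed

lemma submodule_rmod_prod:
  fixes M (structure)
  assumes "right_module R M" "T \<subseteq> carrier M" "A \<subseteq> carrier R" "\<forall>a\<in>A. \<ominus>\<^bsub>R\<^esub> a \<in> A"
    and "\<And>a b. \<lbrakk>a \<in> A; b \<in> carrier R\<rbrakk> \<Longrightarrow> a \<otimes>\<^bsub>R\<^esub> b \<in> A"
  shows "submodule R M (rmod_prod M T A)"
proof -
  interpret right_module R M by fact
  note sub = rmod_prod_subset[OF assms(1-3)]
  have "x \<triangleleft> b \<in> rmod_prod M T A" if "x \<in> rmod_prod M T A" "b \<in> carrier R" for x b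
    using assms(1-4) that(1)
  proof (induction rule: rmod_prod_induct)
    case zero
    then show ?case using that by (simp add: rsmult_zero_left rmod_prod_zero)
  next
    case (smult x a)
    then have "(x \<triangleleft> a) \<triangleleft> b = x \<triangleleft> (a \<otimes>\<^bsub>R\<^esub> b)"
      using assms(2,3) that rsmult_assoc by (metis subsetD)
    then show ?case using smult assms(5) that by (simp add: rmod_prod_smult)
  next
    case (add x y)
    then have "x \<in> carrier M" "y \<in> carrier M" using sub by auto
    then show ?case using add(3,4) that(2) by (simp add: rsmult_l_distr rmod_prod_add)
  qed
  then show ?thesis using sub by (auto simp: submodule_def rmod_prod_zero rmod_prod_add)
qed

lemma rmod_prod_subset_submodule:
  assumes "right_module R M" "submodule R M H" "T \<subseteq> carrier M" "A \<subseteq> carrier R"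
    and A: "\<forall>a\<in>A. \<ominus>\<^bsub>R\<^esub> a \<in> A"
    and TA: "\<And>x a. \<lbrakk>x \<in> T; a \<in> A\<rbrakk> \<Longrightarrow> x \<triangleleft>\<^bsub>M\<^esub> a \<in> H"
  shows "rmod_prod M T A \<subseteq> H"
proof
  fix x assume "x \<in> rmod_prod M T A"
  with assms(1,3,4) A show "x \<in> H"
    by (induction rule: rmod_prod_induct) (use assms(2) TA in \<open>auto simp: submodule_def\<close>)
qed

lemma submodule_span:
  assumes "right_module R M" "T \<subseteq> carrier M" shows "submodule R M (rmod_prod M T (carrier R))"
proof -
  interpret right_module R M by fact
  show ?thesis using assms by (intro submodule_rmod_prod) auto
qed

lemma subset_span:
  assumes "right_module R M" "T \<subseteq> carrier M" shows "T \<subseteq> rmod_prod M T (carrier R)"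
proof
  interpret right_module R M by fact
  fix x assume "x \<in> T"
  then show "x \<in> rmod_prod M T (carrier R)"
    using rmod_prod_smult[of x T "\<one>\<^bsub>R\<^esub>" "carrier R" M] assms by (auto simp: rsmult_one)
qed

lemma span_subset_submodule:
  assumes "right_module R M" "submodule R M H" "T \<subseteq> H"
  shows "rmod_prod M T (carrier R) \<subseteq> H"
proof -
  interpret right_module R M by fact
  show ?thesis
    using assms by (intro rmod_prod_subset_submodule[where R = R]) (auto simp: submodule_def)
qed

lemma submodule_prod_ideal:
  assumes "right_module R M" "ideal N R" shows "submodule R M (rmod_prod M (carrier M) N)"
proof -
  interpret ideal N R by fact
  show ?thesis
    using assms a_subset by (intro submodule_rmod_prod) (auto intro: I_r_closed)
qed

lemma prod_ideal_subset_submodule: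
  assumes "right_module R M" "ideal N R" "submodule R M H"
    and "\<And>x a. \<lbrakk>x \<in> carrier M; a \<in> N\<rbrakk> \<Longrightarrow> x \<triangleleft>\<^bsub>M\<^esub> a \<in> H"
  shows "rmod_prod M (carrier M) N \<subseteq> H"
proof -
  interpret ideal N R by fact
  show ?thesis
    using assms a_subset by (intro rmod_prod_subset_submodule[where R = R]) auto
qed

lemma rmod_hom_prod_ideal:
  assumes "right_module R M" "right_module R L" "ideal N R" "f \<in> rmod_hom R M L"
    and "x \<in> rmod_prod M (carrier M) N"
  shows "f x \<in> rmod_prod L (carrier L) N"
proof -
  interpret M: right_module R M by fact
  interpret ideal N R by fact
  note sub = submodule_prod_ideal[OF assms(2,3)]
  have "submodule R M {x \<in> carrier M. f x \<in> rmod_prod L (carrier L) N}"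
    using assms(1,2,4) sub
    by (auto simp: submodule_def rmod_hom_zero rmod_hom_add rmod_hom_smult M.rsmult_closed)
  then have "rmod_prod M (carrier M) N \<subseteq> {x \<in> carrier M. f x \<in> rmod_prod L (carrier L) N}"
    using assms M.rsmult_closed
    by (intro prod_ideal_subset_submodule)
       (auto simp: rmod_hom_smult intro!: rmod_prod_smult rmod_hom_closed[OF assms(4)])
  then show ?thesis using assms(5) by auto
qed

section \<open>Direct sums of copies of a module\<close>

definition rmod_single :: "'i set \<Rightarrow> ('a, 'm) right_module \<Rightarrow> 'i \<Rightarrow> 'm \<Rightarrow> 'i \<Rightarrow> 'm"
  where "rmod_single I M i m = (\<lambda>j\<in>I. if j = i then m else \<zero>\<^bsub>M\<^esub>)"

lemma rmod_power_simps:
  "carrier (rmod_power I M) = {f \<in> I \<rightarrow>\<^sub>E carrier M. finite {i \<in> I. f i \<noteq> \<zero>\<^bsub>M\<^esub>}}"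
  "\<zero>\<^bsub>rmod_power I M\<^esub> = (\<lambda>i\<in>I. \<zero>\<^bsub>M\<^esub>)"
  "f \<oplus>\<^bsub>rmod_power I M\<^esub> g = (\<lambda>i\<in>I. f i \<oplus>\<^bsub>M\<^esub> g i)"
  "f \<triangleleft>\<^bsub>rmod_power I M\<^esub> a = (\<lambda>i\<in>I. f i \<triangleleft>\<^bsub>M\<^esub> a)"
  by (simp_all add: rmod_power_def)

lemma rmod_power_memI:
  fixes M (structure)
  assumes "\<And>i. i \<in> I \<Longrightarrow> f i \<in> carrier M" "finite {i \<in> I. f i \<noteq> \<zero>}"
  shows "(\<lambda>i\<in>I. f i) \<in> carrier (rmod_power I M)"
proof -
  have "{i \<in> I. (\<lambda>i\<in>I. f i) i \<noteq> \<zero>} = {i \<in> I. f i \<noteq> \<zero>}" by auto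
  then show ?thesis using assms by (simp add: rmod_power_simps)
qed

lemma rmod_power_memD:
  assumes "f \<in> carrier (rmod_power I M)"
  shows "i \<in> I \<Longrightarrow> f i \<in> carrier M" "finite {i \<in> I. f i \<noteq> \<zero>\<^bsub>M\<^esub>}"
  using assms by (auto simp: rmod_power_simps)

lemma rmod_power_eqI:
  "\<lbrakk>f \<in> carrier (rmod_power I M); g \<in> carrier (rmod_power I M); \<And>i. i \<in> I \<Longrightarrow> f i = g i\<rbrakk> \<Longrightarrow> f = g"
  by (auto simp: rmod_power_simps intro: PiE_ext)

lemma right_module_power:
  fixes M (structure)
  assumes "right_module R M" shows "right_module R (rmod_power I M)"
proof -
  interpret right_module R M by fact
  let ?P = "rmod_power I M"
  have add: "f \<oplus>\<^bsub>?P\<^esub> g \<in> carrier ?P" if "f \<in> carrier ?P" "g \<in> carrier ?P" for f g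
    unfolding rmod_power_simps(3)
  proof (rule rmod_power_memI)
    show "finite {i \<in> I. f i \<oplus> g i \<noteq> \<zero>}"
      by (rule finite_subset[OF _ finite_UnI[OF rmod_power_memD(2)[OF that(1)]
              rmod_power_memD(2)[OF that(2)]]]) auto
  qed (simp add: rmod_power_memD(1)[OF that(1)] rmod_power_memD(1)[OF that(2)])
  have smult: "f \<triangleleft>\<^bsub>?P\<^esub> a \<in> carrier ?P" if "f \<in> carrier ?P" "a \<in> carrier R" for f a
    unfolding rmod_power_simps(4)
  proof (rule rmod_power_memI)
    show "finite {i \<in> I. f i \<triangleleft> a \<noteq> \<zero>}"
      by (rule finite_subset[OF _ rmod_power_memD(2)[OF that(1)]])
         (use that(2) rsmult_zero_left in auto)
  qed (simp add: that(2) rmod_power_memD(1)[OF that(1)] rsmult_closed)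
  have inv: "(\<lambda>i\<in>I. \<ominus> f i) \<in> carrier ?P" if "f \<in> carrier ?P" for f
  proof (rule rmod_power_memI)
    show "finite {i \<in> I. \<ominus> f i \<noteq> \<zero>}"
      by (rule finite_subset[OF _ rmod_power_memD(2)[OF that]]) auto
  qed (simp add: rmod_power_memD(1)[OF that])
  have zero: "\<zero>\<^bsub>?P\<^esub> \<in> carrier ?P"
    unfolding rmod_power_simps(2) by (rule rmod_power_memI) auto
  note mem = rmod_power_memD(1)
  have "abelian_group ?P"
  proof (rule abelian_groupI)
    fix f assume f: "f \<in> carrier ?P"
    show "\<exists>g\<in>carrier ?P. g \<oplus>\<^bsub>?P\<^esub> f = \<zero>\<^bsub>?P\<^esub>"
      by (rule bexI[OF _ inv[OF f]])
         (auto simp: rmod_power_simps(2,3) M.l_neg mem[OF f] intro!: restrict_ext)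
    show "\<zero>\<^bsub>?P\<^esub> \<oplus>\<^bsub>?P\<^esub> f = f"
      by (rule rmod_power_eqI[OF add[OF zero f] f]) (auto simp: rmod_power_simps(2,3) mem[OF f])
  next
    show "f \<oplus>\<^bsub>?P\<^esub> g \<in> carrier ?P" if "f \<in> carrier ?P" "g \<in> carrier ?P" for f g
      using that by (rule add)
  qed (auto simp: zero rmod_power_simps(3) M.a_ac mem intro!: restrict_ext)
  moreover have "f \<triangleleft>\<^bsub>?P\<^esub> \<one>\<^bsub>R\<^esub> = f" if "f \<in> carrier ?P" for f
    using that mem[OF that]
    by (intro rmod_power_eqI[OF smult]) (auto simp: rmod_power_simps(4) rsmult_one)
  ultimately show ?thesis
    unfolding right_module_def right_module_axioms_def
    by (auto simp: R.ring_axioms smult)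
       (auto simp: rmod_power_simps(3,4) rsmult_closed rsmult_l_distr rsmult_r_distr
          rsmult_assoc mem intro!: restrict_ext)
qed

lemma rmod_single_carrier:
  fixes M (structure)
  assumes "right_module R M" "m \<in> carrier M"
  shows "rmod_single I M i m \<in> carrier (rmod_power I M)"
  unfolding rmod_single_def
proof (rule rmod_power_memI)
  interpret right_module R M by fact
  show "finite {j \<in> I. (if j = i then m else \<zero>) \<noteq> \<zero>}"
    by (rule finite_subset[of _ "{i}"]) auto
  show "(if j = i then m else \<zero>) \<in> carrier M" for j using assms(2) by simp
qed

lemma rmod_single_smult:
  assumes "right_module R M" "a \<in> carrier R"
  shows "rmod_single I M i m \<triangleleft>\<^bsub>rmod_power I M\<^esub> a = rmod_single I M i (m \<triangleleft>\<^bsub>M\<^esub> a)"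
proof -
  interpret right_module R M by fact
  show ?thesis
    using assms(2) by (auto simp: rmod_power_simps rmod_single_def rsmult_zero_left intro!: restrict_ext)
qed

lemma rmod_power_induct [consumes 2, case_names zero single add]:
  fixes M (structure)
  assumes "right_module R M" "f \<in> carrier (rmod_power I M)"
    and zero: "P \<zero>\<^bsub>rmod_power I M\<^esub>"
    and single: "\<And>i m. \<lbrakk>i \<in> I; m \<in> carrier M\<rbrakk> \<Longrightarrow> P (rmod_single I M i m)"
    and add: "\<And>f g. \<lbrakk>f \<in> carrier (rmod_power I M); g \<in> carrier (rmod_power I M); P f; P g\<rbrakk> \<Longrightarrow>
      P (f \<oplus>\<^bsub>rmod_power I M\<^esub> g)"
  shows "P f"
proof -
  interpret right_module R M by fact
  interpret P: right_module R "rmod_power I M" by (rule right_module_power) fact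
  have "P f" if "finite A" "f \<in> carrier (rmod_power I M)" "{i \<in> I. f i \<noteq> \<zero>} = A" for f A
    using that
  proof (induction A arbitrary: f rule: finite_induct)
    case empty
    then have "f = \<zero>\<^bsub>rmod_power I M\<^esub>"
      by (intro rmod_power_eqI[OF _ P.M.zero_closed]) (auto simp: rmod_power_simps(2))
    then show ?case using zero by simp
  next
    case (insert i A)
    note mem = rmod_power_memD(1)[OF insert.prems(1)]
    define g where "g = (\<lambda>j\<in>I. if j = i then \<zero> else f j)"
    have i: "i \<in> I" "f i \<in> carrier M" using insert.prems(2) mem by auto
    have A: "{j \<in> I. g j \<noteq> \<zero>} = A" "{j \<in> I. (if j = i then \<zero> else f j) \<noteq> \<zero>} = A"
      using insert.prems(2) insert.hyps(2) by (auto simp: g_def)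
    have g: "g \<in> carrier (rmod_power I M)"
      unfolding g_def by (rule rmod_power_memI) (use mem A insert.hyps(1) in auto)
    have "f = rmod_single I M i (f i) \<oplus>\<^bsub>rmod_power I M\<^esub> g"
      using i mem
      by (intro rmod_power_eqI[OF insert.prems(1) P.M.a_closed[OF rmod_single_carrier[OF assms(1)] g]])
         (auto simp: g_def rmod_single_def rmod_power_simps(3))
    then show ?case
      using add[OF rmod_single_carrier[OF assms(1) i(2)] g single[OF i] insert.IH[OF g A(1)]] by metis
  qed
  then show ?thesis using rmod_power_memD(2)[OF assms(2)] assms(2) by blast
qed

text \<open>Homomorphisms out of a direct sum are determined by the summands, and the next lemma
  constructs them from the summands.\<close>

lemma rmod_hom_power_eqI:
  assumes "right_module R M" "right_module R L"
    and "f \<in> rmod_hom R (rmod_power I M) L" "g \<in> rmod_hom R (rmod_power I M) L"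
    and "\<And>i m. \<lbrakk>i \<in> I; m \<in> carrier M\<rbrakk> \<Longrightarrow> f (rmod_single I M i m) = g (rmod_single I M i m)"
    and "x \<in> carrier (rmod_power I M)"
  shows "f x = g x"
  using assms(1,6)
proof (induction rule: rmod_power_induct)
  case zero
  show ?case
    unfolding rmod_hom_zero[OF right_module_power[OF assms(1)] assms(2,3)]
      rmod_hom_zero[OF right_module_power[OF assms(1)] assms(2,4)] ..
next
  case (add x y)
  then show ?case by (simp only: rmod_hom_add[OF assms(3)] rmod_hom_add[OF assms(4)])
qed (use assms(5) in simp)

lemma rmod_power_universal:
  assumes "right_module R M" "right_module R L" "\<And>i. i \<in> I \<Longrightarrow> g i \<in> rmod_hom R M L"
  obtains G where "G \<in> rmod_hom R (rmod_power I M) L"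
    "\<And>i m. \<lbrakk>i \<in> I; m \<in> carrier M\<rbrakk> \<Longrightarrow> G (rmod_single I M i m) = g i m"
proof
  interpret M: right_module R M by fact
  interpret L: right_module R L by fact
  interpret P: right_module R "rmod_power I M" by (rule right_module_power) fact
  define G where "G f = gfinprod (add_monoid L) (\<lambda>i. g i (f i)) I" for f
  have g0: "g i \<zero>\<^bsub>M\<^esub> = \<zero>\<^bsub>L\<^esub>" if "i \<in> I" for i
    by (rule rmod_hom_zero[OF assms(1,2) assms(3)[OF that]])
  have gc: "(\<lambda>i. g i (f i)) \<in> I \<rightarrow> carrier L" if "f \<in> carrier (rmod_power I M)" for f
    using rmod_power_memD(1)[OF that] rmod_hom_closed[OF assms(3)] by blast
  have fin: "finite {i \<in> I. g i (f i) \<noteq> \<zero>\<^bsub>L\<^esub>}" if "f \<in> carrier (rmod_power I M)" for f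
    by (rule finite_subset[OF _ rmod_power_memD(2)[OF that]]) (use g0 in auto)
  have closed: "G f \<in> carrier L" if "f \<in> carrier (rmod_power I M)" for f
    unfolding G_def using L.M.add.gfinprod_closed gc[OF that] by blast
  have G_add: "G (f \<oplus>\<^bsub>rmod_power I M\<^esub> f') = G f \<oplus>\<^bsub>L\<^esub> G f'"
    if "f \<in> carrier (rmod_power I M)" "f' \<in> carrier (rmod_power I M)" for f f'
  proof -
    have "G (f \<oplus>\<^bsub>rmod_power I M\<^esub> f') = gfinprod (add_monoid L) (\<lambda>i. g i (f i) \<oplus>\<^bsub>L\<^esub> g i (f' i)) I"
      unfolding G_def
    proof (rule L.M.add.gfinprod_cong)
      show "I = I" ..
      show "(\<lambda>i. g i ((f \<oplus>\<^bsub>rmod_power I M\<^esub> f') i)) \<in> I \<rightarrow> carrier L"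
        by (rule gc[OF P.M.a_closed[OF that]])
      show "i \<in> I =simp=> g i ((f \<oplus>\<^bsub>rmod_power I M\<^esub> f') i) = g i (f i) \<oplus>\<^bsub>L\<^esub> g i (f' i)" for i
        using rmod_power_memD(1)[OF that(1)] rmod_power_memD(1)[OF that(2)]
        by (auto simp: simp_implies_def rmod_power_simps(3) intro!: rmod_hom_add[OF assms(3)])
    qed
    also have "\<dots> = G f \<oplus>\<^bsub>L\<^esub> G f'"
      unfolding G_def using fin that gc
      by (intro L.M.add.gfinprod_distrib[simplified]) auto
    finally show ?thesis .
  qed
  show sing: "G (rmod_single I M i m) = g i m" if "i \<in> I" "m \<in> carrier M" for i m
  proof -
    have "G (rmod_single I M i m) =
        gfinprod (add_monoid L) (\<lambda>j. g j (rmod_single I M i m j)) {i}"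
      unfolding G_def using that g0 rmod_hom_closed[OF assms(3)]
      by (intro L.M.add.gfinprod_mono_neutral_cong_right) (auto simp: rmod_single_def)
    also have "\<dots> = g i m"
      using that rmod_hom_closed[OF assms(3)[OF that(1)]] by (simp add: rmod_single_def)
    finally show ?thesis .
  qed
  show "G \<in> rmod_hom R (rmod_power I M) L"
  proof (rule rmod_homI)
    fix f a assume f: "f \<in> carrier (rmod_power I M)" and a: "a \<in> carrier R"
    show "G (f \<triangleleft>\<^bsub>rmod_power I M\<^esub> a) = G f \<triangleleft>\<^bsub>L\<^esub> a"
      using assms(1) f
    proof (induction rule: rmod_power_induct)
      case zero
      have "G \<zero>\<^bsub>rmod_power I M\<^esub> \<oplus>\<^bsub>L\<^esub> G \<zero>\<^bsub>rmod_power I M\<^esub> = G \<zero>\<^bsub>rmod_power I M\<^esub>"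
        using G_add[of "\<zero>\<^bsub>rmod_power I M\<^esub>" "\<zero>\<^bsub>rmod_power I M\<^esub>"] P.M.zero_closed P.M.l_zero by metis
      then have "G \<zero>\<^bsub>rmod_power I M\<^esub> = \<zero>\<^bsub>L\<^esub>"
        using closed[OF P.M.zero_closed] by (metis L.M.add.l_cancel_one)
      then show ?case using P.rsmult_zero_left[OF a] L.rsmult_zero_left[OF a] by metis
    next
      case (single i m)
      then show ?case
        using a sing M.rsmult_closed
        by (simp only: rmod_single_smult[OF assms(1) a] rmod_hom_smult[OF assms(3)])
    next
      case (add f f')
      then show ?case
        using a G_add closed
        by (simp only: P.rsmult_l_distr L.rsmult_l_distr P.rsmult_closed)
    qed
  qed (use closed G_add in auto)
qed

lemma rmod_power_map:
  assumes "right_module R M" "right_module R L" "f \<in> rmod_hom R M L"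
  shows "(\<lambda>x. \<lambda>i\<in>I. f (x i)) \<in> rmod_hom R (rmod_power I M) (rmod_power I L)"
proof (rule rmod_homI)
  fix x assume x: "x \<in> carrier (rmod_power I M)"
  show "(\<lambda>i\<in>I. f (x i)) \<in> carrier (rmod_power I L)"
  proof (rule rmod_power_memI)
    show "finite {i \<in> I. f (x i) \<noteq> \<zero>\<^bsub>L\<^esub>}"
      by (rule finite_subset[OF _ rmod_power_memD(2)[OF x]]) (use rmod_hom_zero[OF assms] in auto)
  qed (use rmod_hom_closed[OF assms(3)] rmod_power_memD(1)[OF x] in blast)
qed (auto simp: rmod_power_simps(3,4) rmod_hom_add[OF assms(3)] rmod_hom_smult[OF assms(3)]
      rmod_power_memD(1) intro!: restrict_ext)

lemma rmod_power_component: "i \<in> I \<Longrightarrow> (\<lambda>f. f i) \<in> rmod_hom R (rmod_power I M) M"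
  by (rule rmod_homI) (auto simp: rmod_power_simps(3,4) dest: rmod_power_memD(1))

lemma rmod_single_hom:
  assumes "right_module R M" shows "rmod_single I M i \<in> rmod_hom R M (rmod_power I M)"
proof (rule rmod_homI)
  interpret right_module R M by fact
  show "rmod_single I M i (x \<oplus>\<^bsub>M\<^esub> y) = rmod_single I M i x \<oplus>\<^bsub>rmod_power I M\<^esub> rmod_single I M i y"
    if "x \<in> carrier M" "y \<in> carrier M" for x y
    by (auto simp: rmod_single_def rmod_power_simps(3) intro!: restrict_ext)
qed (use rmod_single_carrier[OF assms] rmod_single_smult[OF assms] in metis)+

section \<open>Countably generated projective modules\<close>

lemma single_one_smult:
  assumes "ring R" "a \<in> carrier R"
  shows "rmod_single I (regular_module R) i \<one>\<^bsub>R\<^esub> \<triangleleft>\<^bsub>rmod_power I (regular_module R)\<^esub> a =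
    rmod_single I (regular_module R) i a"
proof -
  interpret ring R by fact
  show ?thesis
    using rmod_single_smult[OF right_module_regular[OF assms(1)] assms(2), of I i "\<one>\<^bsub>R\<^esub>"] assms(2)
    by simp
qed

lemma single_one_carrier:
  assumes "ring R"
  shows "rmod_single I (regular_module R) i \<one>\<^bsub>R\<^esub> \<in> carrier (rmod_power I (regular_module R))"
proof -
  interpret ring R by fact
  show ?thesis by (rule rmod_single_carrier[OF right_module_regular[OF assms]]) simp
qed

lemma free_module_universal:
  assumes "right_module R L" "\<And>i. i \<in> I \<Longrightarrow> x i \<in> carrier L"
  obtains G where "G \<in> rmod_hom R (rmod_power I (regular_module R)) L"
    "\<And>i. i \<in> I \<Longrightarrow> G (rmod_single I (regular_module R) i \<one>\<^bsub>R\<^esub>) = x i"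
proof -
  interpret right_module R L by fact
  have "(\<lambda>a. x i \<triangleleft>\<^bsub>L\<^esub> a) \<in> rmod_hom R (regular_module R) L" if "i \<in> I" for i
    using assms(2)[OF that] by (intro rmod_homI) (auto simp: rsmult_closed rsmult_r_distr rsmult_assoc)
  then obtain G where "G \<in> rmod_hom R (rmod_power I (regular_module R)) L"
    "\<And>i m. \<lbrakk>i \<in> I; m \<in> carrier R\<rbrakk> \<Longrightarrow> G (rmod_single I (regular_module R) i m) = x i \<triangleleft>\<^bsub>L\<^esub> m"
    using rmod_power_universal[OF right_module_regular assms(1), of I "\<lambda>i a. x i \<triangleleft>\<^bsub>L\<^esub> a"]
      R.ring_axioms by auto
  then show ?thesis using that assms(2) by (simp add: rsmult_one)
qed

lemma rmod_hom_free_eqI: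
  assumes "ring R" "right_module R L"
    and "f \<in> rmod_hom R (rmod_power I (regular_module R)) L"
      "g \<in> rmod_hom R (rmod_power I (regular_module R)) L"
    and "\<And>i. i \<in> I \<Longrightarrow> f (rmod_single I (regular_module R) i \<one>\<^bsub>R\<^esub>) =
      g (rmod_single I (regular_module R) i \<one>\<^bsub>R\<^esub>)"
    and "x \<in> carrier (rmod_power I (regular_module R))"
  shows "f x = g x"
proof (rule rmod_hom_power_eqI[OF right_module_regular[OF assms(1)] assms(2-4) _ assms(6)])
  fix i m assume i: "i \<in> I" and m: "m \<in> carrier (regular_module R)"
  then have "m \<in> carrier R" by simp
  then show "f (rmod_single I (regular_module R) i m) = g (rmod_single I (regular_module R) i m)"
    unfolding single_one_smult[OF assms(1) \<open>m \<in> carrier R\<close>, symmetric]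
    using rmod_hom_smult[OF assms(3) single_one_carrier[OF assms(1)]]
      rmod_hom_smult[OF assms(4) single_one_carrier[OF assms(1)]] assms(5)[OF i] by metis
qed

type_synonym 'a seq_module = "('a, nat \<Rightarrow> 'a) right_module"

abbreviation free_module :: "('a, 'r) ring_scheme \<Rightarrow> 'a seq_module"
  where "free_module R \<equiv> rmod_power UNIV (regular_module R)"

text \<open>Stating projectivity by a retraction from one fixed free module avoids any quantification over
  modules of other types.\<close>

definition countably_projective :: "('a, 'r) ring_scheme \<Rightarrow> ('a, 'm) right_module \<Rightarrow> bool"
  where "countably_projective R P \<longleftrightarrow> right_module R P \<and>
    (\<exists>s\<in>rmod_hom R P (free_module R). \<exists>p\<in>rmod_hom R (free_module R) P.
      \<forall>x\<in>carrier P. p (s x) = x)"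

lemma right_module_free: "ring R \<Longrightarrow> right_module R (free_module R)"
  by (intro right_module_power right_module_regular)

lemma countably_projective_module: "countably_projective R P \<Longrightarrow> right_module R P"
  by (simp add: countably_projective_def)

lemma free_module_lifting:
  assumes "right_module R A" "right_module R B" "q \<in> rmod_hom R A B" "q ` carrier A = carrier B"
    and "g \<in> rmod_hom R (rmod_power I (regular_module R)) B"
  obtains t where "t \<in> rmod_hom R (rmod_power I (regular_module R)) A"
    "\<And>x. x \<in> carrier (rmod_power I (regular_module R)) \<Longrightarrow> q (t x) = g x"
proof -
  interpret A: right_module R A by fact
  let ?e = "\<lambda>i. rmod_single I (regular_module R) i \<one>\<^bsub>R\<^esub>"
  have "\<exists>y. y \<in> carrier A \<and> q y = g (?e i)" for i
    using rmod_hom_closed[OF assms(5) single_one_carrier[OF A.R.ring_axioms]] assms(4)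
    by (metis imageE)
  then obtain y where y: "\<And>i. y i \<in> carrier A" "\<And>i. q (y i) = g (?e i)" by metis
  obtain t where t: "t \<in> rmod_hom R (rmod_power I (regular_module R)) A"
    "\<And>i. i \<in> I \<Longrightarrow> t (?e i) = y i"
    using free_module_universal[OF assms(1), of I y] y(1) by blast
  have "(q \<circ> t) x = g x" if "x \<in> carrier (rmod_power I (regular_module R))" for x
    by (rule rmod_hom_free_eqI[OF A.R.ring_axioms assms(2) rmod_hom_comp[OF t(1) assms(3)] assms(5) _ that])
       (simp add: t(2) y(2))
  then show ?thesis using that t(1) by simp
qed

lemma countably_projective_lifting:
  assumes "countably_projective R P" "right_module R A" "right_module R B"
    "q \<in> rmod_hom R A B" "q ` carrier A = carrier B" "g \<in> rmod_hom R P B"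
  obtains t where "t \<in> rmod_hom R P A" "\<And>x. x \<in> carrier P \<Longrightarrow> q (t x) = g x"
proof -
  obtain s p where sp: "s \<in> rmod_hom R P (free_module R)" "p \<in> rmod_hom R (free_module R) P"
    "\<And>x. x \<in> carrier P \<Longrightarrow> p (s x) = x"
    using assms(1) by (auto simp: countably_projective_def)
  obtain t where t: "t \<in> rmod_hom R (free_module R) A"
    "\<And>x. x \<in> carrier (free_module R) \<Longrightarrow> q (t x) = (g \<circ> p) x"
    using free_module_lifting[OF assms(2-5) rmod_hom_comp[OF sp(2) assms(6)]] by blast
  show ?thesis
    by (rule that[OF rmod_hom_comp[OF sp(1) t(1)]])
       (simp add: t(2)[OF rmod_hom_closed[OF sp(1)]] sp(3))
qed

lemma countably_projective_retract:
  assumes "countably_projective R P" "right_module R M"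
    "i \<in> rmod_hom R M P" "r \<in> rmod_hom R P M" "\<And>x. x \<in> carrier M \<Longrightarrow> r (i x) = x"
  shows "countably_projective R M"
proof -
  obtain s p where sp: "s \<in> rmod_hom R P (free_module R)" "p \<in> rmod_hom R (free_module R) P"
    "\<And>x. x \<in> carrier P \<Longrightarrow> p (s x) = x"
    using assms(1) by (auto simp: countably_projective_def)
  have "s \<circ> i \<in> rmod_hom R M (free_module R)" "r \<circ> p \<in> rmod_hom R (free_module R) M"
    using rmod_hom_comp assms(3,4) sp by blast+
  moreover have "(r \<circ> p) ((s \<circ> i) x) = x" if "x \<in> carrier M" for x
    using that assms(5) sp(3) rmod_hom_closed[OF assms(3)] by simp
  ultimately show ?thesis using assms(2) unfolding countably_projective_def by blast
qed

lemma countably_projective_free: "ring R \<Longrightarrow> countably_projective R (free_module R)"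
  unfolding countably_projective_def using right_module_free rmod_hom_id by (metis id_apply)

lemma countably_projective_iso:
  assumes "countably_projective R P" "right_module R M" "rmod_isomorphic R P M"
  shows "countably_projective R M"
proof -
  obtain f where f: "f \<in> rmod_hom R P M" "bij_betw f (carrier P) (carrier M)"
    using assms(3) by (auto simp: rmod_isomorphic_def)
  show ?thesis
    using countably_projective_retract[OF assms(1,2)
        rmod_hom_inv_into[OF countably_projective_module[OF assms(1)] f] f(1)] f(2)
    by (auto simp: bij_betw_def f_inv_into_f)
qed

text \<open>The image of the section into the free module is a copy whose elements are sequences of ring
  elements, as the isomorphism classes require.\<close>

lemma countably_projective_copy:
  fixes R :: "('a, 'r) ring_scheme"
  assumes "countably_projective R P"
  obtains L :: "'a seq_module"
  where "countably_projective R L" "rmod_isomorphic R P L"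
proof -
  obtain s p where sp: "s \<in> rmod_hom R P (free_module R)" "p \<in> rmod_hom R (free_module R) P"
    "\<And>x. x \<in> carrier P \<Longrightarrow> p (s x) = x"
    using assms by (auto simp: countably_projective_def)
  have P: "right_module R P" using assms by (rule countably_projective_module)
  then interpret right_module R P .
  have F: "right_module R (free_module R)" by (rule right_module_free) (rule R.ring_axioms)
  define L where "L = free_module R\<lparr>carrier := s ` carrier P\<rparr>"
  have L: "right_module R L"
    unfolding L_def by (rule right_module_submodule[OF F rmod_hom_image_submodule[OF P F sp(1)]])
  have "s \<in> rmod_hom R P L"
    using sp(1) by (auto simp: L_def rmod_hom_def)
  moreover have "bij_betw s (carrier P) (carrier L)"
    unfolding L_def bij_betw_def using sp(3) by (auto intro: inj_on_inverseI)
  ultimately have "rmod_isomorphic R P L" by (auto simp: rmod_isomorphic_def)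
  then show ?thesis using that L assms countably_projective_iso by blast
qed

lemma countably_generated_if_countably_projective:
  assumes "countably_projective R P" shows "countably_generated R P"
proof -
  obtain s p where sp: "s \<in> rmod_hom R P (free_module R)" "p \<in> rmod_hom R (free_module R) P"
    "\<And>x. x \<in> carrier P \<Longrightarrow> p (s x) = x"
    using assms by (auto simp: countably_projective_def)
  have P: "right_module R P" using assms by (rule countably_projective_module)
  then interpret right_module R P .
  note rR = R.ring_axioms
  let ?e = "\<lambda>i. rmod_single UNIV (regular_module R) i \<one>\<^bsub>R\<^esub>"
  define T where "T = range (\<lambda>i. p (?e i))"
  have T: "T \<subseteq> carrier P"
    unfolding T_def by (auto intro: rmod_hom_closed[OF sp(2) single_one_carrier[OF rR]])
  have "p x \<in> rmod_prod P T (carrier R)" if "x \<in> carrier (free_module R)" for x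
    using right_module_regular[OF rR] that
  proof (induction rule: rmod_power_induct)
    case zero
    show ?case
      using rmod_hom_zero[OF right_module_free[OF rR] P sp(2)] rmod_prod_zero[of P T] by metis
  next
    case (single i m)
    then have m: "m \<in> carrier R" by simp
    have "p (rmod_single UNIV (regular_module R) i m) = p (?e i) \<triangleleft>\<^bsub>P\<^esub> m"
      using rmod_hom_smult[OF sp(2) single_one_carrier[OF rR] m] single_one_smult[OF rR m] by metis
    then show ?case using m by (simp add: T_def rmod_prod_smult)
  next
    case (add f g)
    then show ?case using rmod_hom_add[OF sp(2)] rmod_prod_add by metis
  qed
  then have "carrier P \<subseteq> rmod_prod P T (carrier R)"
    using sp(3) rmod_hom_closed[OF sp(1)] by (metis subsetI)
  then have "rmod_prod P T (carrier R) = carrier P"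
    using rmod_prod_subset[OF P T order_refl] by (rule subset_antisym[rotated])
  moreover have "countable T" by (simp add: T_def)
  ultimately show ?thesis
    using T unfolding countably_generated_def by blast
qed

text \<open>The complement of \<open>P\<close> is the kernel of the evaluation map from the free module on the
  underlying set of \<open>P\<close>, which splits because \<open>P\<close> is a retract of a free module.\<close>

lemma projective_if_countably_projective:
  fixes R :: "('a, 'r) ring_scheme" and P :: "('a, 'm) right_module"
  assumes "countably_projective R P" shows "projective R P"
proof -
  have P: "right_module R P" using assms by (rule countably_projective_module)
  then interpret right_module R P .
  let ?F = "rmod_power (carrier P) (regular_module R)"
  let ?e = "\<lambda>i. rmod_single (carrier P) (regular_module R) i \<one>\<^bsub>R\<^esub>"
  have F: "right_module R ?F" by (intro right_module_power right_module_regular R.ring_axioms)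
  then interpret F: right_module R ?F .
  obtain ev where ev: "ev \<in> rmod_hom R ?F P" "\<And>m. m \<in> carrier P \<Longrightarrow> ev (?e m) = m"
    using free_module_universal[OF P, of "carrier P" "\<lambda>m. m"] by auto
  have "ev ` carrier ?F = carrier P"
  proof
    show "ev ` carrier ?F \<subseteq> carrier P" using rmod_hom_closed[OF ev(1)] by blast
    show "carrier P \<subseteq> ev ` carrier ?F"
      using ev(2) single_one_carrier[OF R.ring_axioms] by (metis image_eqI subsetI)
  qed
  then obtain s where s: "s \<in> rmod_hom R P ?F" "\<And>x. x \<in> carrier P \<Longrightarrow> ev (s x) = id x"
    using countably_projective_lifting[OF assms F P ev(1) _ rmod_hom_id] by blast
  define K where "K = {x \<in> carrier ?F. ev x = \<zero>\<^bsub>P\<^esub>}"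
  let ?Q = "?F\<lparr>carrier := K\<rparr>"
  have K: "submodule R ?F K" unfolding K_def by (rule rmod_hom_kernel_submodule[OF F P ev(1)])
  have Q: "right_module R ?Q" by (rule right_module_submodule[OF F K])
  have KF: "y \<in> carrier ?F" "ev y = \<zero>\<^bsub>P\<^esub>" if "y \<in> K" for y using that by (auto simp: K_def)
  let ?f = "\<lambda>z. (s \<circ> fst) z \<oplus>\<^bsub>?F\<^esub> (id \<circ> snd) z"
  let ?g = "\<lambda>x. (ev x, id x \<ominus>\<^bsub>?F\<^esub> (s \<circ> ev) x)"
  have incl: "id \<in> rmod_hom R ?Q ?F" by (rule rmod_hom_on_submodule[OF rmod_hom_id K])
  have f: "?f \<in> rmod_hom R (rmod_sum P ?Q) ?F"
    by (rule rmod_hom_plus[OF F rmod_hom_comp[OF rmod_hom_fst s(1)] rmod_hom_comp[OF rmod_hom_snd incl]])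
  have sev: "s (ev x) \<in> carrier ?F" "ev x \<in> carrier P" if "x \<in> carrier ?F" for x
    using rmod_hom_closed[OF s(1)] rmod_hom_closed[OF ev(1) that] by auto
  have "ev (x \<ominus>\<^bsub>?F\<^esub> s (ev x)) = \<zero>\<^bsub>P\<^esub>" if x: "x \<in> carrier ?F" for x
    using rmod_hom_diff[OF F P ev(1) x sev(1)[OF x]] s(2)[OF sev(2)[OF x]] sev(2)[OF x]
    by (simp add: a_minus_def M.r_neg)
  then have in_K: "x \<ominus>\<^bsub>?F\<^esub> s (ev x) \<in> K" if "x \<in> carrier ?F" for x
    using F.M.minus_closed[OF that sev(1)[OF that]] that by (simp add: K_def)
  have d: "(\<lambda>x. id x \<ominus>\<^bsub>?F\<^esub> (s \<circ> ev) x) \<in> rmod_hom R ?F ?F"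
    by (rule rmod_hom_minus_fun[OF F rmod_hom_id rmod_hom_comp[OF ev(1) s(1)]])
  have "(\<lambda>x. id x \<ominus>\<^bsub>?F\<^esub> (s \<circ> ev) x) \<in> rmod_hom R ?F ?Q"
    by (rule rmod_homI) (use in_K rmod_hom_add[OF d] rmod_hom_smult[OF d] in auto)
  then have g: "?g \<in> rmod_hom R ?F (rmod_sum P ?Q)" by (rule rmod_hom_pair[OF ev(1)])
  have "rmod_isomorphic R (rmod_sum P ?Q) ?F"
  proof (rule rmod_isomorphicI[OF f g])
    fix z assume "z \<in> carrier (rmod_sum P ?Q)"
    then obtain x y where z: "z = (x, y)" "x \<in> carrier P" "y \<in> K" by auto
    note sx = rmod_hom_closed[OF s(1) z(2)] and y = KF[OF z(3)]
    have e: "ev (s x \<oplus>\<^bsub>?F\<^esub> y) = x" using rmod_hom_add[OF ev(1) sx y(1)] s(2)[OF z(2)] y(2) z(2) by simp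
    have "(s x \<oplus>\<^bsub>?F\<^esub> y) \<ominus>\<^bsub>?F\<^esub> s x = y"
      using sx y(1) by (simp only: a_minus_def F.M.a_comm[OF sx y(1)])
        (simp only: F.M.a_assoc F.M.r_neg F.M.r_zero F.M.a_inv_closed)
    then show "?g (?f z) = z" by (simp only: z(1) o_apply fst_conv snd_conv id_apply e)
  next
    fix x assume x: "x \<in> carrier ?F"
    show "?f (?g x) = x"
      using F.minus_add_cancel[OF x sev(1)[OF x]] F.M.a_comm[OF sev(1)[OF x] F.M.minus_closed[OF x sev(1)[OF x]]]
      by (simp only: o_apply fst_conv snd_conv id_apply)
  qed
  then show ?thesis using P Q unfolding projective_def by blast
qed

lemma countable_surjection_from_free:
  assumes "right_module R M" "countably_generated R M"
  obtains q where "q \<in> rmod_hom R (free_module R) M" "q ` carrier (free_module R) = carrier M"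
proof -
  interpret right_module R M by fact
  let ?e = "\<lambda>i. rmod_single UNIV (regular_module R) i \<one>\<^bsub>R\<^esub>"
  obtain T where T: "T \<subseteq> carrier M" "countable T" "rmod_prod M T (carrier R) = carrier M"
    using assms(2) by (auto simp: countably_generated_def)
  define U where "U = insert \<zero>\<^bsub>M\<^esub> T"
  have U: "U \<subseteq> carrier M" "range (from_nat_into U) = U"
    using T by (auto simp: U_def intro!: range_from_nat_into)
  obtain q where q: "q \<in> rmod_hom R (free_module R) M" "\<And>i. q (?e i) = from_nat_into U i"
  proof (rule free_module_universal[OF assms(1), of UNIV "from_nat_into U"])
    show "from_nat_into U i \<in> carrier M" for i using U by blast
  qed auto
  have sub: "submodule R M (q ` carrier (free_module R))"
    by (rule rmod_hom_image_submodule[OF right_module_free[OF R.ring_axioms] assms(1) q(1)])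
  have "T \<subseteq> range (\<lambda>i. q (?e i))" using U(2) q(2) by (auto simp: U_def)
  also have "\<dots> \<subseteq> q ` carrier (free_module R)" by (auto intro: imageI[OF single_one_carrier[OF R.ring_axioms]])
  finally have "carrier M \<subseteq> q ` carrier (free_module R)"
    using span_subset_submodule[OF assms(1) sub] T(3) by metis
  then show ?thesis using that q(1) sub by (auto simp: submodule_def)
qed

text \<open>A projective module is a retract of a free module with an arbitrary basis. Lifting that
  retraction along a surjection from the countable free module, which exists by countable generation,
  moves the retraction to the countable free module.\<close>

lemma countably_projective_if_projective:
  fixes R :: "('a, 'r) ring_scheme" and P :: "('a, 'm) right_module"
  assumes "projective R P" "countably_generated R P" shows "countably_projective R P"
proof -
  have P: "right_module R P" using assms(1) by (simp add: projective_def)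
  then interpret right_module R P .
  obtain I :: "'m set" and Q :: "('a, 'm \<Rightarrow> 'a) right_module" and f where Q: "right_module R Q"
    and f: "f \<in> rmod_hom R (rmod_sum P Q) (rmod_power I (regular_module R))"
      "bij_betw f (carrier (rmod_sum P Q)) (carrier (rmod_power I (regular_module R)))"
    using assms(1) unfolding projective_def rmod_isomorphic_def by blast
  interpret Q: right_module R Q by fact
  let ?F = "rmod_power I (regular_module R)"
  let ?g = "inv_into (carrier (rmod_sum P Q)) f"
  have g: "?g \<in> rmod_hom R ?F (rmod_sum P Q)"
    by (rule rmod_hom_inv_into[OF right_module_sum[OF P Q] f])
  have i: "(\<lambda>x. (x, \<zero>\<^bsub>Q\<^esub>)) \<in> rmod_hom R P (rmod_sum P Q)"
    by (rule rmod_homI) (auto simp: Q.rsmult_zero_left)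
  have "fst \<in> rmod_hom R (rmod_sum P Q) P" by (rule rmod_homI) auto
  then have p: "fst \<circ> ?g \<in> rmod_hom R ?F P" using g by (rule rmod_hom_comp[rotated])
  obtain q where q: "q \<in> rmod_hom R (free_module R) P" "q ` carrier (free_module R) = carrier P"
    using countable_surjection_from_free[OF P assms(2)] by blast
  obtain t where t: "t \<in> rmod_hom R ?F (free_module R)"
    "\<And>x. x \<in> carrier ?F \<Longrightarrow> q (t x) = (fst \<circ> ?g) x"
    using free_module_lifting[OF right_module_free[OF R.ring_axioms] P q p] by blast
  have "q ((t \<circ> (f \<circ> (\<lambda>x. (x, \<zero>\<^bsub>Q\<^esub>)))) x) = x" if "x \<in> carrier P" for x
  proof -
    have x: "(x, \<zero>\<^bsub>Q\<^esub>) \<in> carrier (rmod_sum P Q)" using that by simp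
    show ?thesis
      using t(2)[OF rmod_hom_closed[OF f(1) x]] f(2) x by (simp add: bij_betw_def inv_into_f_f)
  qed
  moreover have "t \<circ> (f \<circ> (\<lambda>x. (x, \<zero>\<^bsub>Q\<^esub>))) \<in> rmod_hom R P (free_module R)"
    using rmod_hom_comp[OF rmod_hom_comp[OF i f(1)] t(1)] .
  ultimately show ?thesis
    using countably_projective_retract[OF countably_projective_free[OF R.ring_axioms] P _ q(1)] by blast
qed

lemma projective_countably_generated_iff:
  "projective R P \<and> countably_generated R P \<longleftrightarrow> countably_projective R P"
  using countably_projective_if_projective projective_if_countably_projective
    countably_generated_if_countably_projective by blast

text \<open>A pairing of the natural numbers identifies a basis of the countable power of the free module with
  a basis of the free module. The closure of countably generated projective modules under countable
  powers and finite sums reduces to this case.\<close>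

lemma free_power_retract:
  assumes "ring R"
  shows "countably_projective R (rmod_power (UNIV :: nat set) (free_module R))"
proof -
  let ?F = "free_module R" and ?e = "\<lambda>i. rmod_single UNIV (regular_module R) i \<one>\<^bsub>R\<^esub>"
  let ?G = "rmod_power (UNIV :: nat set) ?F"
  have F: "right_module R ?F" and G: "right_module R ?G"
    by (auto intro!: right_module_power right_module_regular assms)
  have e: "?e i \<in> carrier ?F" for i :: nat by (rule single_one_carrier[OF assms])
  have "\<exists>g. g \<in> rmod_hom R ?F ?F \<and> (\<forall>j. g (?e j) = ?e (prod_encode (i, j)))" for i
    using free_module_universal[OF F, of UNIV "\<lambda>j. ?e (prod_encode (i, j))"] e by (metis UNIV_I)
  then obtain g where g: "\<And>i. g i \<in> rmod_hom R ?F ?F" "\<And>i j. g i (?e j) = ?e (prod_encode (i, j))"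
    by metis
  obtain s where s: "s \<in> rmod_hom R ?G ?F"
    "\<And>i m. m \<in> carrier ?F \<Longrightarrow> s (rmod_single UNIV ?F i m) = g i m"
    using rmod_power_universal[OF F F, of UNIV g] g(1) by (metis UNIV_I)
  let ?y = "\<lambda>n. rmod_single UNIV ?F (fst (prod_decode n)) (?e (snd (prod_decode n)))"
  obtain p where p: "p \<in> rmod_hom R ?F ?G" "\<And>n. p (?e n) = ?y n"
    using free_module_universal[OF G, of UNIV ?y] rmod_single_carrier[OF F e] by (metis UNIV_I)
  have single: "(p \<circ> g i) m = rmod_single UNIV ?F i m" if "m \<in> carrier ?F" for i m
    by (rule rmod_hom_free_eqI[OF assms G rmod_hom_comp[OF g(1) p(1)] rmod_single_hom[OF F] _ that])
       (simp add: g(2) p(2))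
  have "(p \<circ> s) x = id x" if "x \<in> carrier ?G" for x
    by (rule rmod_hom_power_eqI[OF F G rmod_hom_comp[OF s(1) p(1)] rmod_hom_id _ that])
       (use s(2) single in simp)
  then have "p (s x) = x" if "x \<in> carrier ?G" for x using that by simp
  then show ?thesis
    by (rule countably_projective_retract[OF countably_projective_free[OF assms] G s(1) p(1)])
qed

lemma countably_projective_power:
  assumes "countably_projective R P"
  shows "countably_projective R (rmod_power (UNIV :: nat set) P)"
proof -
  obtain s p where sp: "s \<in> rmod_hom R P (free_module R)" "p \<in> rmod_hom R (free_module R) P"
    "\<And>x. x \<in> carrier P \<Longrightarrow> p (s x) = x"
    using assms by (auto simp: countably_projective_def)
  have P: "right_module R P" using assms by (rule countably_projective_module)
  then interpret right_module R P .
  have F: "right_module R (free_module R)" by (rule right_module_free) (rule R.ring_axioms)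
  show ?thesis
    by (rule countably_projective_retract[OF free_power_retract[OF R.ring_axioms]
          right_module_power[OF P] rmod_power_map[OF P F sp(1)] rmod_power_map[OF F P sp(2)]])
       (auto simp: rmod_power_memD(1) sp(3) restrict_UNIV)
qed

lemma countably_projective_sum:
  assumes "countably_projective R P" "countably_projective R Q"
  shows "countably_projective R (rmod_sum P Q)"
proof -
  obtain s p where sp: "s \<in> rmod_hom R P (free_module R)" "p \<in> rmod_hom R (free_module R) P"
    "\<And>x. x \<in> carrier P \<Longrightarrow> p (s x) = x"
    using assms(1) by (auto simp: countably_projective_def)
  obtain t q where tq: "t \<in> rmod_hom R Q (free_module R)" "q \<in> rmod_hom R (free_module R) Q"
    "\<And>x. x \<in> carrier Q \<Longrightarrow> q (t x) = x"
    using assms(2) by (auto simp: countably_projective_def)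
  have P: "right_module R P" and Q: "right_module R Q"
    using assms by (auto intro: countably_projective_module)
  interpret right_module R P by (rule P)
  let ?F = "free_module R"
  let ?G = "rmod_power (UNIV :: nat set) ?F"
  have F: "right_module R ?F" by (rule right_module_free) (rule R.ring_axioms)
  interpret F: right_module R ?F by (rule F)
  interpret G: right_module R ?G by (rule right_module_power[OF F])
  let ?i = "\<lambda>z. (rmod_single UNIV ?F (0::nat) \<circ> (s \<circ> fst)) z \<oplus>\<^bsub>?G\<^esub>
    (rmod_single UNIV ?F 1 \<circ> (t \<circ> snd)) z"
  let ?r = "\<lambda>f. ((p \<circ> (\<lambda>f. f 0)) f, (q \<circ> (\<lambda>f. f (1::nat))) f)"
  have i: "?i \<in> rmod_hom R (rmod_sum P Q) ?G"
    by (rule rmod_hom_plus[OF right_module_power[OF F]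
          rmod_hom_comp[OF rmod_hom_comp[OF rmod_hom_fst sp(1)] rmod_single_hom[OF F]]
          rmod_hom_comp[OF rmod_hom_comp[OF rmod_hom_snd tq(1)] rmod_single_hom[OF F]]])
  have r: "?r \<in> rmod_hom R ?G (rmod_sum P Q)"
    by (rule rmod_hom_pair[OF rmod_hom_comp[OF rmod_power_component sp(2)]
          rmod_hom_comp[OF rmod_power_component tq(2)]]) simp_all
  have "?r (?i z) = z" if "z \<in> carrier (rmod_sum P Q)" for z
  proof -
    obtain x y where z: "z = (x, y)" "x \<in> carrier P" "y \<in> carrier Q" using \<open>z \<in> _\<close> by auto
    have "s x \<in> carrier ?F" "t y \<in> carrier ?F"
      using z rmod_hom_closed sp(1) tq(1) by metis+
    then show ?thesis
      using sp(3)[OF z(2)] tq(3)[OF z(3)]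
      by (simp add: z(1) rmod_power_simps(3)[of _ ?F] rmod_single_def
          F.M.r_zero F.M.l_zero)
  qed
  then show ?thesis
    by (rule countably_projective_retract[OF free_power_retract[OF R.ring_axioms]
          right_module_sum[OF P Q] i r])
qed

lemma countably_projective_zero:
  assumes "ring R" shows "countably_projective R zero_module"
proof -
  interpret F: right_module R "free_module R" by (rule right_module_free) fact
  have "(\<lambda>_. \<zero>\<^bsub>free_module R\<^esub>) \<in> rmod_hom R zero_module (free_module R)"
    by (rule rmod_homI; (rule F.M.zero_closed | rule F.M.l_zero[OF F.M.zero_closed, symmetric]
          | rule F.rsmult_zero_left[symmetric], assumption))
  moreover have "(\<lambda>_. ()) \<in> rmod_hom R (free_module R) zero_module"
    by (rule rmod_homI) (auto simp: zero_module_def)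
  ultimately show ?thesis
    using right_module_zero[OF assms] unfolding countably_projective_def by auto
qed

section \<open>Right T-nilpotent ideals\<close>

text \<open>If \<open>m b\<close> is not in \<open>B\<close>, the hypothesis yields \<open>m'\<close> and \<open>a \<in> N\<close> such that \<open>m' (a b)\<close> is not
  in \<open>B\<close>. Iterating this from \<open>x = x 1\<close>, the successive coefficients \<open>a\<^sub>n \<cdots> a\<^sub>1 a\<^sub>0\<close> never vanish.\<close>

lemma T_nilpotent_induct:
  fixes M (structure)
  assumes "right_module R M" "ideal N R" "right_T_nilpotent R N" "\<zero> \<in> B"
    and step: "\<And>m b. \<lbrakk>m \<in> carrier M; b \<in> carrier R;
        \<And>m' a. \<lbrakk>m' \<in> carrier M; a \<in> N\<rbrakk> \<Longrightarrow> m' \<triangleleft> (a \<otimes>\<^bsub>R\<^esub> b) \<in> B\<rbrakk> \<Longrightarrow> m \<triangleleft> b \<in> B"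
  shows "carrier M \<subseteq> B"
proof (rule ccontr)
  interpret right_module R M by fact
  interpret N: ideal N R by fact
  assume "\<not> carrier M \<subseteq> B"
  then obtain x where x: "x \<in> carrier M" "x \<triangleleft> \<one>\<^bsub>R\<^esub> \<notin> B" by (auto simp: rsmult_one)
  have ex: "\<exists>m' a. m' \<in> carrier M \<and> a \<in> N \<and> a \<in> carrier R \<and> m' \<triangleleft> (a \<otimes>\<^bsub>R\<^esub> b) \<notin> B"
    if "m \<in> carrier M" "b \<in> carrier R" "m \<triangleleft> b \<notin> B" for m b
    using step[OF that(1,2)] that(3) N.a_Hcarr by blast
  \<comment> \<open>A state \<open>(m, a, b)\<close> records the last factor \<open>a\<close> and the product \<open>b\<close> so far; the product starts
    with the first \<open>a\<close>, without the initial factor \<open>1\<close>, to agree with \<open>left_product\<close>.\<close>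
  define Q where "Q n s \<longleftrightarrow> (case s of (m, a, b) \<Rightarrow> m \<in> carrier M \<and> a \<in> N \<and> b \<in> carrier R \<and>
    m \<triangleleft> b \<notin> B \<and> (n = 0 \<longrightarrow> b = a))" for n :: nat and s
  have "\<exists>f. \<forall>n. Q n (f n) \<and> snd (snd (f (Suc n))) = fst (snd (f (Suc n))) \<otimes>\<^bsub>R\<^esub> snd (snd (f n))"
  proof (rule dependent_nat_choice)
    obtain m a where "m \<in> carrier M" "a \<in> N" "a \<in> carrier R" "m \<triangleleft> (a \<otimes>\<^bsub>R\<^esub> \<one>\<^bsub>R\<^esub>) \<notin> B"
      using ex[OF x(1) R.one_closed x(2)] by blast
    then have "Q 0 (m, a, a)" by (simp add: Q_def)
    then show "\<exists>s. Q 0 s" ..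
  next
    fix s n assume s: "Q n s"
    obtain m a b where s': "s = (m, a, b)" by (cases s)
    with s obtain m' a' where "m' \<in> carrier M" "a' \<in> N" "a' \<in> carrier R"
      "m' \<triangleleft> (a' \<otimes>\<^bsub>R\<^esub> b) \<notin> B" "b \<in> carrier R"
      using ex[of m b] by (auto simp: Q_def)
    then show "\<exists>t. Q (Suc n) t \<and> snd (snd t) = fst (snd t) \<otimes>\<^bsub>R\<^esub> snd (snd s)"
      by (intro exI[of _ "(m', a', a' \<otimes>\<^bsub>R\<^esub> b)"]) (simp add: Q_def s')
  qed
  then obtain f where f: "\<And>n. Q n (f n)"
    "\<And>n. snd (snd (f (Suc n))) = fst (snd (f (Suc n))) \<otimes>\<^bsub>R\<^esub> snd (snd (f n))" by blast
  have lp: "left_product R (\<lambda>n. fst (snd (f n))) n = snd (snd (f n))" for n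
  proof (induction n)
    case 0
    then show ?case using f(1)[of 0] by (auto simp: Q_def split: prod.splits)
  next
    case (Suc n)
    then show ?case using f(2)[of n] by simp
  qed
  have "fst (snd (f n)) \<in> N" for n using f(1)[of n] by (auto simp: Q_def split: prod.splits)
  then obtain n where "left_product R (\<lambda>n. fst (snd (f n))) n = \<zero>\<^bsub>R\<^esub>"
    using assms(3) unfolding right_T_nilpotent_def by metis
  then have "snd (snd (f n)) = \<zero>\<^bsub>R\<^esub>" by (simp only: lp)
  then show False
    using f(1)[of n] assms(4) by (auto simp: Q_def rsmult_zero_right split: prod.splits)
qed

text \<open>The form used below: it suffices to pass from all of \<open>(MN)b\<close> to each \<open>m b\<close>.\<close>

lemma T_nilpotent_submodule_induct:
  fixes M (structure)
  assumes "right_module R M" "ideal N R" "right_T_nilpotent R N" "submodule R M B"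
    and step: "\<And>m b. \<lbrakk>m \<in> carrier M; b \<in> carrier R;
        \<And>y. y \<in> rmod_prod M (carrier M) N \<Longrightarrow> y \<triangleleft> b \<in> B\<rbrakk> \<Longrightarrow> m \<triangleleft> b \<in> B"
  shows "carrier M \<subseteq> B"
proof (rule T_nilpotent_induct[OF assms(1-3)])
  interpret right_module R M by fact
  interpret N: ideal N R by fact
  have B: "\<zero> \<in> B" "\<And>x y. \<lbrakk>x \<in> B; y \<in> B\<rbrakk> \<Longrightarrow> x \<oplus> y \<in> B"
    using assms(4) by (auto simp: submodule_def)
  then show "\<zero> \<in> B" by simp
  fix m b assume m: "m \<in> carrier M" and b: "b \<in> carrier R"
    and IH: "\<And>m' a. \<lbrakk>m' \<in> carrier M; a \<in> N\<rbrakk> \<Longrightarrow> m' \<triangleleft> (a \<otimes>\<^bsub>R\<^esub> b) \<in> B"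
  have sub: "rmod_prod M (carrier M) N \<subseteq> carrier M"
    using submodule_prod_ideal[OF assms(1,2)] by (simp add: submodule_def)
  have N': "N \<subseteq> carrier R" "\<forall>a\<in>N. \<ominus>\<^bsub>R\<^esub> a \<in> N" using N.a_subset by auto
  have "y \<triangleleft> b \<in> B" if "y \<in> rmod_prod M (carrier M) N" for y
    using assms(1) order_refl N' that
  proof (induction rule: rmod_prod_induct)
    case zero
    then show ?case using B b by (simp add: rsmult_zero_left)
  next
    case (smult x a)
    then show ?case using IH b N.a_Hcarr by (simp add: rsmult_assoc[symmetric])
  next
    case (add x y)
    then have "x \<in> carrier M" "y \<in> carrier M" using sub by auto
    then show ?case using add(3,4) B b by (simp add: rsmult_l_distr)
  qed
  then show "m \<triangleleft> b \<in> B" using step m b by blast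
qed

text \<open>Write \<open>m = y + z\<close> with \<open>y \<in> MN\<close> and \<open>z \<in> H\<close>. If \<open>y b\<close> lies in \<open>H\<close>, then so does \<open>m b\<close>; this is
  the induction step above for \<open>B = H\<close>.\<close>

lemma nakayama:
  fixes M (structure)
  assumes "right_module R M" "ideal N R" "right_T_nilpotent R N" "submodule R M H"
    and gen: "\<And>m. m \<in> carrier M \<Longrightarrow> \<exists>y\<in>rmod_prod M (carrier M) N. \<exists>z\<in>H. m = y \<oplus> z"
  shows "H = carrier M"
proof
  interpret right_module R M by fact
  show H: "H \<subseteq> carrier M" using assms(4) by (simp add: submodule_def)
  show "carrier M \<subseteq> H"
  proof (rule T_nilpotent_submodule_induct[OF assms(1-4)])
    fix m b assume m: "m \<in> carrier M" and b: "b \<in> carrier R"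
      and IH: "\<And>y. y \<in> rmod_prod M (carrier M) N \<Longrightarrow> y \<triangleleft> b \<in> H"
    obtain y z where yz: "y \<in> rmod_prod M (carrier M) N" "z \<in> H" "m = y \<oplus> z"
      using gen[OF m] by blast
    then have "y \<in> carrier M" "z \<in> carrier M"
      using submodule_prod_ideal[OF assms(1,2)] H by (auto simp: submodule_def)
    then show "m \<triangleleft> b \<in> H"
      using IH[OF yz(1)] yz(2,3) assms(4) b by (simp add: rsmult_l_distr submodule_def)
  qed
qed

lemma rmod_hom_funpow: "f \<in> rmod_hom R M M \<Longrightarrow> f ^^ n \<in> rmod_hom R M M"
  by (induction n) (auto intro: rmod_hom_comp simp: rmod_hom_id simp flip: id_def)

lemma iterated_kernel_submodule:
  fixes M (structure)
  assumes "right_module R M" "f \<in> rmod_hom R M M"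
  shows "submodule R M {x \<in> carrier M. \<exists>n. (f ^^ n) x = \<zero>}"
proof -
  interpret right_module R M by fact
  note fn = rmod_hom_funpow[OF assms(2)]
  have f0: "(f ^^ n) \<zero> = \<zero>" for n by (rule rmod_hom_zero[OF assms(1,1) fn])
  have mono: "(f ^^ (k + n)) x = \<zero>" if "(f ^^ n) x = \<zero>" for x k n
    using that f0 by (simp add: funpow_add)
  have "\<exists>n. (f ^^ n) (x \<oplus> y) = \<zero>"
    if "x \<in> carrier M" "y \<in> carrier M" "(f ^^ n) x = \<zero>" "(f ^^ k) y = \<zero>" for x y n k
    using rmod_hom_add[OF fn[of "k + n"] that(1,2)] mono[OF that(3), of k] mono[OF that(4), of n]
    by (intro exI[of _ "k + n"]) (simp add: add.commute)
  moreover have "\<exists>n. (f ^^ n) (x \<triangleleft> a) = \<zero>"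
    if "x \<in> carrier M" "a \<in> carrier R" "(f ^^ n) x = \<zero>" for x a n
    using rmod_hom_smult[OF fn[of n] that(1,2)] that by (intro exI[of _ n]) (simp add: rsmult_zero_left)
  ultimately show ?thesis using f0 by (auto simp: submodule_def rsmult_closed)
qed

text \<open>The induction principle is applied to the submodule of elements killed by some power of \<open>f\<close>:
  if it contains \<open>f(m) b = f(m b)\<close>, then it contains \<open>m b\<close>. For free modules of infinite rank this
  plays the part of Koenig's lemma for column-finite matrices.\<close>

lemma locally_nilpotent:
  fixes M (structure)
  assumes "right_module R M" "ideal N R" "right_T_nilpotent R N" "f \<in> rmod_hom R M M"
    and f: "\<And>m. m \<in> carrier M \<Longrightarrow> f m \<in> rmod_prod M (carrier M) N"
    and "x \<in> carrier M"
  shows "\<exists>n. (f ^^ n) x = \<zero>"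
proof -
  interpret right_module R M by fact
  define B where "B = {x \<in> carrier M. \<exists>n. (f ^^ n) x = \<zero>}"
  have B: "submodule R M B" unfolding B_def by (rule iterated_kernel_submodule[OF assms(1,4)])
  have "carrier M \<subseteq> B"
  proof (rule T_nilpotent_submodule_induct[OF assms(1-3) B])
    fix m b assume m: "m \<in> carrier M" and b: "b \<in> carrier R"
      and IH: "\<And>y. y \<in> rmod_prod M (carrier M) N \<Longrightarrow> y \<triangleleft> b \<in> B"
    have "f (m \<triangleleft> b) \<in> B" using IH[OF f[OF m]] rmod_hom_smult[OF assms(4) m b] by simp
    then obtain n where "(f ^^ Suc n) (m \<triangleleft> b) = \<zero>"
      by (auto simp: B_def funpow_Suc_right simp del: funpow.simps)
    then show "m \<triangleleft> b \<in> B" using m b unfolding B_def by (blast intro: rsmult_closed)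
  qed
  then show ?thesis using assms(6) by (auto simp: B_def)
qed

section \<open>Fitting decomposition\<close>

lemma direct_sum_projection:
  fixes M (structure)
  assumes "right_module R M" "submodule R M U" "submodule R M V"
    and disj: "\<And>x. \<lbrakk>x \<in> U; x \<in> V\<rbrakk> \<Longrightarrow> x = \<zero>"
    and span: "\<And>x. x \<in> carrier M \<Longrightarrow> \<exists>u\<in>U. \<exists>v\<in>V. x = u \<oplus> v"
  obtains e where "e \<in> rmod_hom R M (M\<lparr>carrier := V\<rparr>)" "\<And>x. x \<in> V \<Longrightarrow> e x = x"
proof -
  interpret right_module R M by fact
  have UV: "x \<in> carrier M" if "x \<in> U \<or> x \<in> V" for x
    using that assms(2,3) by (auto simp: submodule_def)
  have uniq: "v = v'" if "u \<in> U" "v \<in> V" "u' \<in> U" "v' \<in> V" "u \<oplus> v = u' \<oplus> v'" for u v u' v'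
  proof -
    have c: "u \<in> carrier M" "v \<in> carrier M" "u' \<in> carrier M" "v' \<in> carrier M"
      using that UV by auto
    have "v \<ominus> v' = (\<ominus> u \<oplus> (u \<oplus> v)) \<ominus> v'" using c by (simp add: M.r_neg1)
    also have "\<dots> = \<ominus> u \<oplus> u'"
      unfolding that(5) using c by (simp add: a_minus_def M.a_assoc M.r_neg)
    finally have eq: "v \<ominus> v' = \<ominus> u \<oplus> u'" .
    moreover have "\<ominus> u \<oplus> u' \<in> U"
      using that assms(2) submodule_minus[OF assms(1,2)] by (simp add: submodule_def)
    moreover have "v \<ominus> v' \<in> V"
      using that assms(3) submodule_minus[OF assms(1,3)] by (simp add: submodule_def a_minus_def)
    ultimately have "v \<ominus> v' = \<zero>" using disj by simp
    then show ?thesis using minus_add_cancel[OF c(2,4)] c by simp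
  qed
  have "\<forall>x. \<exists>u v. x \<in> carrier M \<longrightarrow> u \<in> U \<and> v \<in> V \<and> x = u \<oplus> v" using span by blast
  then obtain k e where ke: "\<And>x. x \<in> carrier M \<Longrightarrow> k x \<in> U"
    "\<And>x. x \<in> carrier M \<Longrightarrow> e x \<in> V" "\<And>x. x \<in> carrier M \<Longrightarrow> x = k x \<oplus> e x"
    by metis
  have e_eq: "e (u \<oplus> v) = v" if "u \<in> U" "v \<in> V" for u v
    by (rule uniq[OF ke(1,2) that ke(3)[symmetric]]) (use that UV in auto)
  show ?thesis
  proof
    show "e \<in> rmod_hom R M (M\<lparr>carrier := V\<rparr>)"
    proof (rule rmod_homI)
      fix x y assume x: "x \<in> carrier M" and y: "y \<in> carrier M"
      have "x \<oplus> y = (k x \<oplus> k y) \<oplus> (e x \<oplus> e y)"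
        by (subst ke(3)[OF x], subst ke(3)[OF y])
           (simp add: UV ke(1,2) x y M.a_ac)
      then show "e (x \<oplus> y) = e x \<oplus>\<^bsub>M\<lparr>carrier := V\<rparr>\<^esub> e y"
        using ke(1,2) x y assms(2,3) by (simp add: e_eq submodule_def)
    next
      fix x a assume x: "x \<in> carrier M" and a: "a \<in> carrier R"
      have "x \<triangleleft> a = (k x \<triangleleft> a) \<oplus> (e x \<triangleleft> a)"
        by (subst ke(3)[OF x]) (simp add: UV ke(1,2) x a rsmult_l_distr)
      then show "e (x \<triangleleft> a) = e x \<triangleleft>\<^bsub>M\<lparr>carrier := V\<rparr>\<^esub> a"
        using ke(1,2) x a assms(2,3) by (simp add: e_eq submodule_def)
    qed (simp add: ke)
    show "e x = x" if "x \<in> V" for x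
      using e_eq[of "\<zero>" x] that UV assms(2) by (simp add: submodule_def)
  qed
qed

text \<open>A pair \<open>A\<close>, \<open>C = 1 - A\<close> of endomorphisms. The symmetric formulation lets every fact be used with
  the two exchanged.\<close>

locale complementary_endomorphisms = right_module R M
  for R :: "('a, 'r) ring_scheme" and M :: "('a, 'm) right_module" (structure) +
  fixes A C :: "'m \<Rightarrow> 'm"
  assumes A: "A \<in> rmod_hom R M M" and C: "C \<in> rmod_hom R M M"
    and sum: "\<And>x. x \<in> carrier M \<Longrightarrow> A x \<oplus> C x = x"
begin

lemma mod: "right_module R M" by unfold_locales

lemma swap: "complementary_endomorphisms R M C A"
  by unfold_locales
     (use A C sum M.a_comm rmod_hom_closed[OF A] rmod_hom_closed[OF C] in auto)

lemmas closed = rmod_hom_closed[OF A] rmod_hom_closed[OF C]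
  rmod_hom_closed[OF rmod_hom_funpow[OF A]] rmod_hom_closed[OF rmod_hom_funpow[OF C]]

lemma commute:
  assumes "x \<in> carrier M" shows "A (C x) = C (A x)"
proof -
  have "A (A x) \<oplus> A (C x) = A x"
    using rmod_hom_add[OF A closed(1,2), OF assms assms] sum[OF assms] by simp
  also have "\<dots> = A (A x) \<oplus> C (A x)" using sum closed assms by simp
  finally have "A (C x) \<oplus> A (A x) = C (A x) \<oplus> A (A x)"
    using closed(1,2) assms by (simp only: M.a_comm)
  then show ?thesis using closed(1,2) assms by simp
qed

lemma funpow_commute:
  assumes "x \<in> carrier M" shows "(A ^^ n) (C x) = C ((A ^^ n) x)"
  using assms by (induction n) (simp_all add: commute closed)

text \<open>On the elements killed by a power of \<open>A\<close>, the map \<open>C = 1 - A\<close> is onto: the preimage of \<open>y\<close> is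
  the finite geometric series \<open>y + A y + A (A y) + \<dots>\<close>.\<close>

lemma preimage_in_iterated_kernel:
  assumes "y \<in> carrier M" "(A ^^ n) y = \<zero>"
  shows "\<exists>w\<in>carrier M. (A ^^ n) w = \<zero> \<and> C w = y"
  using assms
proof (induction n arbitrary: y)
  case 0
  then show ?case using rmod_hom_zero[OF mod mod C] by auto
next
  case (Suc n)
  have "(A ^^ n) (A y) = \<zero>"
    using Suc.prems(2) by (simp only: funpow_Suc_right o_apply)
  then obtain w where w: "w \<in> carrier M" "(A ^^ n) w = \<zero>" "C w = A y"
    using Suc.IH closed(1) Suc.prems(1) by blast
  have "(A ^^ Suc n) w = \<zero>" using w(2) rmod_hom_zero[OF mod mod A] by simp
  then have "(A ^^ Suc n) (y \<oplus> w) = \<zero>"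
    using rmod_hom_add[OF rmod_hom_funpow[OF A, of "Suc n"] Suc.prems(1) w(1)] Suc.prems(2)
    by (simp del: funpow.simps)
  moreover have "C (y \<oplus> w) = y"
    using sum[OF Suc.prems(1)] closed(1,2)[OF Suc.prems(1)] w
    by (simp add: rmod_hom_add[OF C Suc.prems(1)] M.a_comm)
  ultimately show ?case using Suc.prems(1) w(1) by blast
qed

definition ker0 where "ker0 = {x \<in> carrier M. \<exists>n. (A ^^ n) x = \<zero>}"
definition ker1 where "ker1 = {x \<in> carrier M. \<exists>n. (C ^^ n) x = \<zero>}"

lemma submodule_ker0: "submodule R M ker0"
  unfolding ker0_def by (rule iterated_kernel_submodule[OF mod A])

lemma submodule_ker1: "submodule R M ker1"
  unfolding ker1_def by (rule iterated_kernel_submodule[OF mod C])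

text \<open>On the elements killed by a power of \<open>A\<close>, the map \<open>C\<close> is also injective, since \<open>C x = 0\<close> gives
  \<open>A x = x\<close>.\<close>

lemma ker_disjoint:
  assumes "x \<in> ker0" "x \<in> ker1" shows "x = \<zero>"
proof -
  have inj: "x = \<zero>" if x: "x \<in> carrier M" "(A ^^ n) x = \<zero>" "C x = \<zero>" for x n
  proof -
    have "A x = x" using sum[OF x(1)] closed(1)[OF x(1)] x(3) by simp
    then have "(A ^^ n) x = x" by (induction n) simp_all
    then show ?thesis using x(2) by simp
  qed
  obtain n k where nk: "x \<in> carrier M" "(A ^^ n) x = \<zero>" "(C ^^ k) x = \<zero>"
    using assms by (auto simp: ker0_def ker1_def)
  then show ?thesis
  proof (induction k arbitrary: x)
    case (Suc k)
    have "(C ^^ k) (C x) = \<zero>" using Suc.prems(3) by (simp only: funpow_Suc_right o_apply)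
    moreover have "(A ^^ n) (C x) = \<zero>"
      using funpow_commute[OF Suc.prems(1)] Suc.prems(2) rmod_hom_zero[OF mod mod C] by simp
    ultimately have "C x = \<zero>" using Suc.IH closed(2) Suc.prems(1) by blast
    then show ?case using inj Suc.prems by blast
  qed simp
qed

text \<open>Choose \<open>w\<close> in \<open>ker1\<close> with \<open>A w = y1\<close>; then \<open>A (u - w) = y0\<close> is killed by a power of \<open>A\<close>, and so
  is \<open>u - w\<close>.\<close>

lemma ker_sum_pullback:
  assumes "u \<in> carrier M" "A u = y0 \<oplus> y1" "y0 \<in> ker0" "y1 \<in> ker1"
  obtains x0 x1 where "x0 \<in> ker0" "x1 \<in> ker1" "u = x0 \<oplus> x1"
proof -
  obtain k where k: "y1 \<in> carrier M" "(C ^^ k) y1 = \<zero>" using assms(4) by (auto simp: ker1_def)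
  then obtain w where w: "w \<in> ker1" "A w = y1"
    using complementary_endomorphisms.preimage_in_iterated_kernel[OF swap] unfolding ker1_def by blast
  have wc: "w \<in> carrier M" "y0 \<in> carrier M"
    using w(1) assms(3) by (auto simp: ker0_def ker1_def)
  obtain n where n: "(A ^^ n) y0 = \<zero>" using assms(3) by (auto simp: ker0_def)
  have "A (u \<ominus> w) = y0"
    using rmod_hom_diff[OF mod mod A assms(1) wc(1)] wc k(1)
    by (simp add: assms(2) w(2) a_minus_def M.a_assoc M.r_neg)
  then have "(A ^^ Suc n) (u \<ominus> w) = \<zero>" using n by (simp only: funpow_Suc_right o_apply)
  then have "u \<ominus> w \<in> ker0" using assms(1) wc unfolding ker0_def by blast
  then show ?thesis using that w(1) minus_add_cancel[OF assms(1) wc(1)] by metis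
qed

text \<open>If \<open>A (C x)\<close> is decomposed, then so is \<open>C x\<close>, and then so is \<open>x\<close>: the previous lemma applies twice,
  the second time with \<open>A\<close> and \<open>C\<close> exchanged.\<close>

lemma fitting:
  assumes "x \<in> carrier M" "((A \<circ> C) ^^ n) x = \<zero>"
  shows "\<exists>x0\<in>ker0. \<exists>x1\<in>ker1. x = x0 \<oplus> x1"
  using assms
proof (induction n arbitrary: x)
  case 0
  have "\<zero> \<in> ker0" "\<zero> \<in> ker1"
    using submodule_ker0 submodule_ker1 by (auto simp: submodule_def)
  then show ?case using 0 by force
next
  case (Suc n)
  interpret sw: complementary_endomorphisms R M C A by (rule swap)
  have kers: "sw.ker0 = ker1" "sw.ker1 = ker0"
    by (simp_all add: sw.ker0_def sw.ker1_def ker0_def ker1_def)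
  have comm: "v \<oplus> u = u \<oplus> v" if "u \<in> ker0" "v \<in> ker1" for u v
    using that M.a_comm by (auto simp: ker0_def ker1_def)
  have "((A \<circ> C) ^^ n) (A (C x)) = \<zero>"
    using Suc.prems(2) by (simp add: funpow_Suc_right o_def del: funpow.simps)
  then obtain y0 y1 where y: "y0 \<in> ker0" "y1 \<in> ker1" "A (C x) = y0 \<oplus> y1"
    using Suc.IH[OF closed(1)[OF closed(2)[OF Suc.prems(1)]]] by blast
  obtain z0 z1 where z: "z0 \<in> ker0" "z1 \<in> ker1" "C x = z0 \<oplus> z1"
    using ker_sum_pullback[OF closed(2)[OF Suc.prems(1)] y(3,1,2)] by blast
  have "C x = z1 \<oplus> z0" using z(3) comm[OF z(1,2)] by simp
  then obtain x1 x0 where x: "x1 \<in> ker1" "x0 \<in> ker0" "x = x1 \<oplus> x0"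
    using sw.ker_sum_pullback[OF Suc.prems(1), unfolded kers] z(1,2) by blast
  then show ?case using comm[OF x(2,1)] by blast
qed

end

section \<open>Reduction modulo an ideal\<close>

text \<open>The quotient map \<open>R \<rightarrow> R/N\<close> up to isomorphism. Working with an arbitrary surjection of kernel \<open>N\<close>
  keeps cosets out of the arguments.\<close>

locale surjective_ring_hom =
  fixes R :: "('a, 'r) ring_scheme" and S :: "('b, 's) ring_scheme"
    and h :: "'a \<Rightarrow> 'b" and N :: "'a set"
  assumes ring_R: "ring R" and ring_S: "ring S" and ideal_N: "ideal N R"
    and hom_h: "h \<in> ring_hom R S" and surj_h: "h ` carrier R = carrier S"
    and kernel_h: "\<And>a. a \<in> carrier R \<Longrightarrow> h a = \<zero>\<^bsub>S\<^esub> \<longleftrightarrow> a \<in> N"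
begin

text \<open>One inclusion suffices for the kernel: \<open>MN\<close> maps to zero because \<open>N\<close> annihilates every module
  restricted along \<open>h\<close>.\<close>

definition reduction :: "('a, 'm) right_module \<Rightarrow> ('b, 'k) right_module \<Rightarrow> ('m \<Rightarrow> 'k) \<Rightarrow> bool"
  where "reduction M L \<pi> \<longleftrightarrow> right_module R M \<and> right_module S L \<and>
    \<pi> \<in> rmod_hom R M (restrict_scalars h L) \<and> \<pi> ` carrier M = carrier L \<and>
    (\<forall>x\<in>carrier M. \<pi> x = \<zero>\<^bsub>L\<^esub> \<longrightarrow> x \<in> rmod_prod M (carrier M) N)"

lemma reductionD:
  assumes "reduction M L \<pi>"
  shows "right_module R M" "right_module S L" "\<pi> \<in> rmod_hom R M (restrict_scalars h L)"
    "\<pi> ` carrier M = carrier L"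
    "\<And>x. \<lbrakk>x \<in> carrier M; \<pi> x = \<zero>\<^bsub>L\<^esub>\<rbrakk> \<Longrightarrow> x \<in> rmod_prod M (carrier M) N"
  using assms by (auto simp: reduction_def)

lemma right_module_restrict:
  "right_module S L \<Longrightarrow> right_module R (restrict_scalars h L)"
  by (rule right_module_restrict_scalars[OF ring_R hom_h])

lemma rmod_hom_restrict:
  assumes "f \<in> rmod_hom S L L'"
  shows "f \<in> rmod_hom R (restrict_scalars h L) (restrict_scalars h L')"
  using assms ring_hom_closed[OF hom_h] by (auto simp: rmod_hom_def)

lemma reduction_closed: "\<lbrakk>reduction M L \<pi>; x \<in> carrier M\<rbrakk> \<Longrightarrow> \<pi> x \<in> carrier L"
  and reduction_add: "\<lbrakk>reduction M L \<pi>; x \<in> carrier M; y \<in> carrier M\<rbrakk> \<Longrightarrow>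
    \<pi> (x \<oplus>\<^bsub>M\<^esub> y) = \<pi> x \<oplus>\<^bsub>L\<^esub> \<pi> y"
  and reduction_smult: "\<lbrakk>reduction M L \<pi>; x \<in> carrier M; a \<in> carrier R\<rbrakk> \<Longrightarrow>
    \<pi> (x \<triangleleft>\<^bsub>M\<^esub> a) = \<pi> x \<triangleleft>\<^bsub>L\<^esub> h a"
  by (auto simp: reduction_def rmod_hom_def)

lemma minus_restrict:
  "x \<ominus>\<^bsub>restrict_scalars h L\<^esub> y = x \<ominus>\<^bsub>L\<^esub> y"
  by (simp add: a_minus_def a_inv_def m_inv_def)

lemma reduction_zero_elem: "reduction M L \<pi> \<Longrightarrow> \<pi> \<zero>\<^bsub>M\<^esub> = \<zero>\<^bsub>L\<^esub>"
  using rmod_hom_zero right_module_restrict reductionD restrict_scalars_simps(2) by metis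

lemma reduction_diff:
  assumes "reduction M L \<pi>" "x \<in> carrier M" "y \<in> carrier M"
  shows "\<pi> (x \<ominus>\<^bsub>M\<^esub> y) = \<pi> x \<ominus>\<^bsub>L\<^esub> \<pi> y"
  using rmod_hom_diff[OF reductionD(1)[OF assms(1)]
      right_module_restrict[OF reductionD(2)[OF assms(1)]] reductionD(3)[OF assms(1)] assms(2,3)]
  by (simp add: minus_restrict)

lemma rmod_hom_kills_prod:
  assumes "right_module R M" "right_module S L" "f \<in> rmod_hom R M (restrict_scalars h L)"
    and "x \<in> rmod_prod M (carrier M) N"
  shows "f x = \<zero>\<^bsub>L\<^esub>"
proof -
  interpret M: right_module R M by fact
  interpret L: right_module S L by fact
  interpret N: ideal N R by (rule ideal_N)
  have "rmod_prod M (carrier M) N \<subseteq> {x \<in> carrier M. f x = \<zero>\<^bsub>restrict_scalars h L\<^esub>}"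
  proof (rule prod_ideal_subset_submodule[OF assms(1) ideal_N
        rmod_hom_kernel_submodule[OF assms(1) right_module_restrict[OF assms(2)] assms(3)]])
    fix x a assume x: "x \<in> carrier M" and a: "a \<in> N"
    have "f (x \<triangleleft>\<^bsub>M\<^esub> a) = f x \<triangleleft>\<^bsub>L\<^esub> h a"
      using rmod_hom_smult[OF assms(3) x N.a_Hcarr[OF a]] by simp
    also have "\<dots> = \<zero>\<^bsub>L\<^esub>"
      using kernel_h[OF N.a_Hcarr[OF a]] a rmod_hom_closed[OF assms(3) x]
      by (simp add: L.rsmult_zero_right)
    finally show "x \<triangleleft>\<^bsub>M\<^esub> a \<in> {x \<in> carrier M. f x = \<zero>\<^bsub>restrict_scalars h L\<^esub>}"
      using M.rsmult_closed[OF x N.a_Hcarr[OF a]] by simp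
  qed
  then show ?thesis using assms(4) by auto
qed

lemma reduction_eqD:
  assumes "reduction M L \<pi>" "x \<in> carrier M" "y \<in> carrier M" "\<pi> x = \<pi> y"
  shows "x \<ominus>\<^bsub>M\<^esub> y \<in> rmod_prod M (carrier M) N"
proof -
  interpret M: right_module R M by (rule reductionD(1)[OF assms(1)])
  interpret L: right_module S L by (rule reductionD(2)[OF assms(1)])
  have "\<pi> (x \<ominus>\<^bsub>M\<^esub> y) = \<zero>\<^bsub>L\<^esub>"
    using reduction_diff[OF assms(1-3)] reduction_closed[OF assms(1,3)] assms(4)
    by (simp add: a_minus_def L.M.r_neg)
  then show ?thesis using reductionD(5)[OF assms(1)] assms(2,3) by simp
qed

text \<open>The universal property of the reduction: it is the largest quotient of \<open>M\<close> on which \<open>N\<close> acts as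
  zero.\<close>

lemma reduction_factor:
  fixes M (structure)
  assumes "reduction M L \<pi>" "right_module S L'" "g \<in> rmod_hom R M (restrict_scalars h L')"
  obtains g' where "g' \<in> rmod_hom S L L'" "\<And>x. x \<in> carrier M \<Longrightarrow> g' (\<pi> x) = g x"
proof -
  note M = reductionD(1)[OF assms(1)] and surj = reductionD(4)[OF assms(1)]
  interpret M: right_module R M by (rule M)
  interpret L': right_module S L' by fact
  have well: "g x = g y" if "x \<in> carrier M" "y \<in> carrier M" "\<pi> x = \<pi> y" for x y
  proof -
    have "g (x \<ominus> y) = \<zero>\<^bsub>L'\<^esub>"
      using rmod_hom_kills_prod[OF M assms(2,3)] reduction_eqD[OF assms(1) that] by blast
    then have "g x \<ominus>\<^bsub>L'\<^esub> g y = \<zero>\<^bsub>L'\<^esub>"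
      using rmod_hom_diff[OF M right_module_restrict[OF assms(2)] assms(3) that(1,2)]
      by (simp add: minus_restrict)
    then show ?thesis
      using L'.minus_add_cancel[of "g x" "g y"] rmod_hom_closed[OF assms(3)] that by simp
  qed
  define g' where "g' l = g (SOME x. x \<in> carrier M \<and> \<pi> x = l)" for l
  have g': "g' (\<pi> x) = g x" if "x \<in> carrier M" for x
  proof -
    have "(SOME y. y \<in> carrier M \<and> \<pi> y = \<pi> x) \<in> carrier M \<and>
        \<pi> (SOME y. y \<in> carrier M \<and> \<pi> y = \<pi> x) = \<pi> x"
      by (rule someI[of _ x]) (use that in simp)
    then show ?thesis using well that unfolding g'_def by blast
  qed
  have "g' \<in> rmod_hom S L L'"
  proof (rule rmod_homI, unfold surj[symmetric] surj_h[symmetric])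
    fix l assume "l \<in> \<pi> ` carrier M"
    then show "g' l \<in> carrier L'" using g' rmod_hom_closed[OF assms(3)] by auto
  next
    fix l k assume "l \<in> \<pi> ` carrier M" "k \<in> \<pi> ` carrier M"
    then obtain x y where xy: "l = \<pi> x" "k = \<pi> y" "x \<in> carrier M" "y \<in> carrier M" by auto
    show "g' (l \<oplus>\<^bsub>L\<^esub> k) = g' l \<oplus>\<^bsub>L'\<^esub> g' k"
      using g'[of "x \<oplus> y"] rmod_hom_add[OF assms(3) xy(3,4)] xy(3,4)
      by (simp add: xy(1,2) g' reduction_add[OF assms(1)])
  next
    fix l b assume "l \<in> \<pi> ` carrier M" "b \<in> h ` carrier R"
    then obtain x a where xa: "l = \<pi> x" "b = h a" "x \<in> carrier M" "a \<in> carrier R" by auto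
    show "g' (l \<triangleleft>\<^bsub>L\<^esub> b) = g' l \<triangleleft>\<^bsub>L'\<^esub> b"
      using g'[of "x \<triangleleft> a"] rmod_hom_smult[OF assms(3) xa(3,4)] xa(3,4)
      by (simp add: xa(1,2) g' reduction_smult[OF assms(1)] M.rsmult_closed)
  qed
  then show ?thesis using that g' by blast
qed

lemma reduction_map:
  assumes "reduction M L \<pi>" "reduction M' L' \<pi>'" "f \<in> rmod_hom R M M'"
  obtains f' where "f' \<in> rmod_hom S L L'" "\<And>x. x \<in> carrier M \<Longrightarrow> f' (\<pi> x) = \<pi>' (f x)"
  using reduction_factor[OF assms(1) reductionD(2)[OF assms(2)]
      rmod_hom_comp[OF assms(3) reductionD(3)[OF assms(2)]]] by auto

lemma reduction_lift:
  assumes "countably_projective R P" "reduction P L \<pi>" "reduction M' L' \<pi>'" "g \<in> rmod_hom S L L'"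
  obtains f where "f \<in> rmod_hom R P M'" "\<And>x. x \<in> carrier P \<Longrightarrow> \<pi>' (f x) = g (\<pi> x)"
proof -
  have "\<pi>' ` carrier M' = carrier (restrict_scalars h L')" using reductionD(4)[OF assms(3)] by simp
  then show ?thesis
    using countably_projective_lifting[OF assms(1) reductionD(1)[OF assms(3)]
        right_module_restrict[OF reductionD(2)[OF assms(3)]] reductionD(3)[OF assms(3)] _
        rmod_hom_comp[OF reductionD(3)[OF assms(2)] rmod_hom_restrict[OF assms(4)]]] that
    by auto
qed

lemma reduction_isomorphic:
  assumes "reduction M L \<pi>" "reduction M' L' \<pi>'" "rmod_isomorphic R M M'"
  shows "rmod_isomorphic S L L'"
proof -
  obtain f where f: "f \<in> rmod_hom R M M'" "bij_betw f (carrier M) (carrier M')"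
    using assms(3) by (auto simp: rmod_isomorphic_def)
  let ?g = "inv_into (carrier M) f"
  have g: "?g \<in> rmod_hom R M' M" by (rule rmod_hom_inv_into[OF reductionD(1)[OF assms(1)] f])
  obtain f' where f': "f' \<in> rmod_hom S L L'" "\<And>x. x \<in> carrier M \<Longrightarrow> f' (\<pi> x) = \<pi>' (f x)"
    using reduction_map[OF assms(1,2) f(1)] by blast
  obtain g' where g': "g' \<in> rmod_hom S L' L" "\<And>x. x \<in> carrier M' \<Longrightarrow> g' (\<pi>' x) = \<pi> (?g x)"
    using reduction_map[OF assms(2,1) g] by blast
  have fg: "?g (f x) = x" "f x \<in> carrier M'" if "x \<in> carrier M" for x
    using f that rmod_hom_closed[OF f(1)] by (auto simp: bij_betw_def)
  have gf: "f (?g x) = x" "?g x \<in> carrier M" if "x \<in> carrier M'" for x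
    using f that rmod_hom_closed[OF g] by (auto simp: bij_betw_def f_inv_into_f)
  show ?thesis
  proof (rule rmod_isomorphicI[OF f'(1) g'(1)])
    show "g' (f' l) = l" if "l \<in> carrier L" for l
      using that unfolding reductionD(4)[OF assms(1), symmetric] by (auto simp: f' g' fg)
    show "f' (g' l) = l" if "l \<in> carrier L'" for l
      using that unfolding reductionD(4)[OF assms(2), symmetric] by (auto simp: f' g' gf)
  qed
qed

lemma reduction_regular: "reduction (regular_module R) (regular_module S) h"
proof -
  interpret R: ring R by (rule ring_R)
  have "a \<in> rmod_prod (regular_module R) (carrier R) N" if "a \<in> N" "a \<in> carrier R" for a
    using rmod_prod_smult[of "\<one>\<^bsub>R\<^esub>" "carrier R" a N "regular_module R"] that by simp
  moreover have "h \<in> rmod_hom R (regular_module R) (restrict_scalars h (regular_module S))"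
    by (rule rmod_homI)
       (auto simp: ring_hom_closed[OF hom_h] ring_hom_add[OF hom_h] ring_hom_mult[OF hom_h])
  ultimately show ?thesis
    using right_module_regular[OF ring_R] right_module_regular[OF ring_S] surj_h kernel_h
    by (auto simp: reduction_def)
qed

lemma reduction_zero_module: "reduction zero_module zero_module (\<lambda>_. ())"
  unfolding reduction_def
  using right_module_zero[OF ring_R] right_module_zero[OF ring_S]
    rmod_prod_zero[of "zero_module :: ('a, unit) right_module"]
  by (auto simp: rmod_hom_def zero_module_def restrict_scalars_def)

lemma reduction_sum:
  assumes "reduction M L \<pi>" "reduction M' L' \<pi>'"
  shows "reduction (rmod_sum M M') (rmod_sum L L') (\<lambda>(x, y). (\<pi> x, \<pi>' y))"
proof -
  note M = reductionD(1)[OF assms(1)] and M' = reductionD(1)[OF assms(2)]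
  interpret M: right_module R M by (rule M)
  interpret M': right_module R M' by (rule M')
  have i: "(\<lambda>x. (x, \<zero>\<^bsub>M'\<^esub>)) \<in> rmod_hom R M (rmod_sum M M')"
    by (rule rmod_homI) (auto simp: M'.rsmult_zero_left)
  have j: "(\<lambda>y. (\<zero>\<^bsub>M\<^esub>, y)) \<in> rmod_hom R M' (rmod_sum M M')"
    by (rule rmod_homI) (auto simp: M.rsmult_zero_left)
  have "(x, y) \<in> rmod_prod (rmod_sum M M') (carrier (rmod_sum M M')) N"
    if xy: "x \<in> carrier M" "y \<in> carrier M'" "\<pi> x = \<zero>\<^bsub>L\<^esub>" "\<pi>' y = \<zero>\<^bsub>L'\<^esub>" for x y
  proof -
    have "(x, \<zero>\<^bsub>M'\<^esub>) \<oplus>\<^bsub>rmod_sum M M'\<^esub> (\<zero>\<^bsub>M\<^esub>, y) \<in> rmod_prod (rmod_sum M M') (carrier (rmod_sum M M')) N"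
      by (rule rmod_prod_add[OF
            rmod_hom_prod_ideal[OF M right_module_sum[OF M M'] ideal_N i reductionD(5)[OF assms(1)]]
            rmod_hom_prod_ideal[OF M' right_module_sum[OF M M'] ideal_N j reductionD(5)[OF assms(2)]]])
         (use xy in auto)
    then show ?thesis using xy by simp
  qed
  moreover have "(\<lambda>(x, y). (\<pi> x, \<pi>' y)) \<in> rmod_hom R (rmod_sum M M') (restrict_scalars h (rmod_sum L L'))"
    by (rule rmod_homI)
       (auto simp: reduction_closed[OF assms(1)] reduction_closed[OF assms(2)]
          reduction_add[OF assms(1)] reduction_add[OF assms(2)]
          reduction_smult[OF assms(1)] reduction_smult[OF assms(2)])
  moreover have "(\<lambda>(x, y). (\<pi> x, \<pi>' y)) ` carrier (rmod_sum M M') = carrier (rmod_sum L L')"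
    unfolding rmod_sum_simps(1) reductionD(4)[OF assms(1), symmetric]
      reductionD(4)[OF assms(2), symmetric] by (auto simp: image_iff)
  ultimately show ?thesis
    using right_module_sum[OF M M'] right_module_sum[OF reductionD(2)[OF assms(1)] reductionD(2)[OF assms(2)]]
    unfolding reduction_def by auto
qed

text \<open>For the kernel: a finitely supported family with entries in \<open>MN\<close> is an element of the direct
  sum of copies of \<open>MN\<close>, hence a finite sum of elements \<open>x a\<close> of the direct sum of copies of \<open>M\<close>.\<close>

lemma reduction_power:
  fixes M (structure)
  assumes "reduction M L \<pi>"
  shows "reduction (rmod_power I M) (rmod_power I L) (\<lambda>x. \<lambda>i\<in>I. \<pi> (x i))"
proof -
  note M = reductionD(1)[OF assms] and L = reductionD(2)[OF assms]
  interpret M: right_module R M by (rule M)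
  interpret L: right_module S L by (rule L)
  let ?N = "rmod_prod M (carrier M) N" and ?P = "rmod_power I M"
  let ?K = "M\<lparr>carrier := ?N\<rparr>"
  note sub = submodule_prod_ideal[OF M ideal_N]
  have K: "right_module R ?K" by (rule right_module_submodule[OF M sub])
  have PN: "x \<in> rmod_prod ?P (carrier ?P) N" if "x \<in> carrier (rmod_power I ?K)" for x
    using K that
  proof (induction rule: rmod_power_induct)
    case zero
    have "\<zero>\<^bsub>rmod_power I ?K\<^esub> = \<zero>\<^bsub>?P\<^esub>" by (simp add: rmod_power_def)
    then show ?case by (simp only: rmod_prod_zero)
  next
    case (single i m)
    have "rmod_single I ?K i m = rmod_single I M i m" by (simp add: rmod_single_def cong: if_cong)
    then show ?case
      using rmod_hom_prod_ideal[OF M right_module_power[OF M] ideal_N rmod_single_hom[OF M], of m I i]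
        single(2) by simp
  next
    case (add f g)
    have "f \<oplus>\<^bsub>rmod_power I ?K\<^esub> g = f \<oplus>\<^bsub>?P\<^esub> g" by (simp add: rmod_power_def)
    then show ?case using add(3,4) by (simp only: rmod_prod_add)
  qed
  have ker: "x \<in> rmod_prod ?P (carrier ?P) N"
    if x: "x \<in> carrier ?P" "(\<lambda>i\<in>I. \<pi> (x i)) = \<zero>\<^bsub>rmod_power I L\<^esub>" for x
  proof (rule PN)
    have "\<pi> (x i) = \<zero>\<^bsub>L\<^esub>" if "i \<in> I" for i
      using fun_cong[OF x(2), of i] that by (simp add: rmod_power_simps(2))
    then have "x i \<in> ?N" if "i \<in> I" for i
      using reductionD(5)[OF assms rmod_power_memD(1)[OF x(1)]] that by blast
    then show "x \<in> carrier (rmod_power I ?K)"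
      using x(1) by (auto simp: rmod_power_simps(1) PiE_iff)
  qed
  have hom: "(\<lambda>x. \<lambda>i\<in>I. \<pi> (x i)) \<in> rmod_hom R ?P (restrict_scalars h (rmod_power I L))"
  proof (rule rmod_homI)
    fix x assume x: "x \<in> carrier ?P"
    show "(\<lambda>i\<in>I. \<pi> (x i)) \<in> carrier (restrict_scalars h (rmod_power I L))"
      unfolding restrict_scalars_simps
    proof (rule rmod_power_memI)
      show "finite {i \<in> I. \<pi> (x i) \<noteq> \<zero>\<^bsub>L\<^esub>}"
        by (rule finite_subset[OF _ rmod_power_memD(2)[OF x]])
           (use reduction_zero_elem[OF assms] in auto)
    qed (use reduction_closed[OF assms] rmod_power_memD(1)[OF x] in auto)
  qed (auto simp: rmod_power_simps(3,4) rmod_power_memD(1) reduction_add[OF assms]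
        reduction_smult[OF assms] intro!: restrict_ext)
  have "y \<in> (\<lambda>x. \<lambda>i\<in>I. \<pi> (x i)) ` carrier ?P" if y: "y \<in> carrier (rmod_power I L)" for y
  proof -
    have "\<exists>m. m \<in> carrier M \<and> \<pi> m = y i \<and> (y i = \<zero>\<^bsub>L\<^esub> \<longrightarrow> m = \<zero>)" if "i \<in> I" for i
      using rmod_power_memD(1)[OF y that] reduction_zero_elem[OF assms] M.M.zero_closed
      unfolding reductionD(4)[OF assms, symmetric] by (metis imageE)
    then obtain x where x: "\<And>i. i \<in> I \<Longrightarrow> x i \<in> carrier M" "\<And>i. i \<in> I \<Longrightarrow> \<pi> (x i) = y i"
      "\<And>i. \<lbrakk>i \<in> I; y i = \<zero>\<^bsub>L\<^esub>\<rbrakk> \<Longrightarrow> x i = \<zero>" by metis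
    have mem: "(\<lambda>i\<in>I. x i) \<in> carrier ?P"
    proof (rule rmod_power_memI)
      show "finite {i \<in> I. x i \<noteq> \<zero>}"
        by (rule finite_subset[OF _ rmod_power_memD(2)[OF y]]) (use x(3) in auto)
    qed (rule x(1))
    have eq: "(\<lambda>i\<in>I. \<pi> ((\<lambda>i\<in>I. x i) i)) = y"
      using y x(2) by (auto simp: rmod_power_simps(1) PiE_iff extensional_def fun_eq_iff)
    show ?thesis
      by (rule image_eqI[where f = "\<lambda>x. \<lambda>i\<in>I. \<pi> (x i)", OF eq[symmetric] mem])
  qed
  then have "(\<lambda>x. \<lambda>i\<in>I. \<pi> (x i)) ` carrier ?P = carrier (rmod_power I L)"
    using rmod_hom_closed[OF hom] by auto
  then show ?thesis
    using hom ker right_module_power[OF M] right_module_power[OF L] unfolding reduction_def by blast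
qed

lemma countably_projective_reduction:
  assumes "countably_projective R P" "reduction P L \<pi>"
  shows "countably_projective S L"
proof -
  obtain s p where sp: "s \<in> rmod_hom R P (free_module R)" "p \<in> rmod_hom R (free_module R) P"
    "\<And>x. x \<in> carrier P \<Longrightarrow> p (s x) = x"
    using assms(1) by (auto simp: countably_projective_def)
  note F = reduction_power[OF reduction_regular, of UNIV]
  let ?\<rho> = "\<lambda>x. \<lambda>i\<in>UNIV. h (x i)"
  obtain s' where s': "s' \<in> rmod_hom S L (free_module S)"
    "\<And>x. x \<in> carrier P \<Longrightarrow> s' (\<pi> x) = ?\<rho> (s x)"
    using reduction_map[OF assms(2) F sp(1)] by blast
  obtain p' where p': "p' \<in> rmod_hom S (free_module S) L"
    "\<And>x. x \<in> carrier (free_module R) \<Longrightarrow> p' (?\<rho> x) = \<pi> (p x)"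
    using reduction_map[OF F assms(2) sp(2)] by blast
  have "p' (s' l) = l" if "l \<in> carrier L" for l
    using that sp(3) s'(2) p'(2)[OF rmod_hom_closed[OF sp(1)]]
    unfolding reductionD(4)[OF assms(2), symmetric] by auto
  then show ?thesis
    using s'(1) p'(1) reductionD(2)[OF assms(2)] unfolding countably_projective_def by blast
qed

section \<open>Lifting isomorphisms and projective modules\<close>

text \<open>Surjectivity modulo \<open>N\<close> says \<open>M' = M'N + f(M)\<close>, so Nakayama's lemma applies.\<close>

lemma surj_if_reduction_surj:
  assumes "right_T_nilpotent R N" "reduction M L \<pi>" "reduction M' L' \<pi>'" "f \<in> rmod_hom R M M'"
    and "f' ` carrier L = carrier L'" "\<And>x. x \<in> carrier M \<Longrightarrow> \<pi>' (f x) = f' (\<pi> x)"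
  shows "f ` carrier M = carrier M'"
proof -
  note M' = reductionD(1)[OF assms(3)]
  interpret M': right_module R M' by (rule M')
  show ?thesis
  proof (rule nakayama[OF M' ideal_N assms(1) rmod_hom_image_submodule[OF reductionD(1)[OF assms(2)] M' assms(4)]])
    fix m assume m: "m \<in> carrier M'"
    have "\<pi>' m \<in> f' ` \<pi> ` carrier M"
      using reduction_closed[OF assms(3) m] assms(5) reductionD(4)[OF assms(2)] by simp
    then obtain x where x: "x \<in> carrier M" "\<pi>' m = \<pi>' (f x)" using assms(6) by auto
    have fx: "f x \<in> carrier M'" using rmod_hom_closed[OF assms(4) x(1)] .
    show "\<exists>y\<in>rmod_prod M' (carrier M') N. \<exists>z\<in>f ` carrier M. m = y \<oplus>\<^bsub>M'\<^esub> z"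
      using reduction_eqD[OF assms(3) m fx x(2)] x(1) M'.minus_add_cancel[OF m fx]
      by (metis image_eqI)
  qed
qed

lemma isomorphic_if_reductions_isomorphic:
  assumes "right_T_nilpotent R N" "countably_projective R P" "countably_projective R P'"
    and "reduction P L \<pi>" "reduction P' L' \<pi>'" "rmod_isomorphic S L L'"
  shows "rmod_isomorphic R P P'"
proof -
  note P = countably_projective_module[OF assms(2)] and P' = countably_projective_module[OF assms(3)]
  obtain f' where f': "f' \<in> rmod_hom S L L'" "bij_betw f' (carrier L) (carrier L')"
    using assms(6) by (auto simp: rmod_isomorphic_def)
  obtain f where f: "f \<in> rmod_hom R P P'" "\<And>x. x \<in> carrier P \<Longrightarrow> \<pi>' (f x) = f' (\<pi> x)"
    using reduction_lift[OF assms(2,4,5) f'(1)] by blast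
  have f_surj: "f ` carrier P = carrier P'"
    using surj_if_reduction_surj[OF assms(1,4,5) f(1) _ f(2)] f'(2) by (auto simp: bij_betw_def)
  obtain g where g: "g \<in> rmod_hom R P' P" "\<And>x. x \<in> carrier P' \<Longrightarrow> f (g x) = id x"
    using countably_projective_lifting[OF assms(3) P P' f(1) f_surj rmod_hom_id] by blast
  obtain g' where g': "g' \<in> rmod_hom S L' L" "\<And>x. x \<in> carrier P' \<Longrightarrow> g' (\<pi>' x) = \<pi> (g x)"
    using reduction_map[OF assms(5,4) g(1)] by blast
  have f'g': "f' (g' l) = l" if l: "l \<in> carrier L'" for l
  proof -
    obtain x where x: "x \<in> carrier P'" "l = \<pi>' x" using l reductionD(4)[OF assms(5)] by auto
    then have "f' (g' l) = \<pi>' (f (g x))"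
      using g'(2)[OF x(1)] f(2)[OF rmod_hom_closed[OF g(1) x(1)]] by simp
    then show ?thesis using g(2)[OF x(1)] x(2) by simp
  qed
  have "g' ` carrier L' = carrier L"
  proof
    show "g' ` carrier L' \<subseteq> carrier L" using rmod_hom_closed[OF g'(1)] by auto
    show "carrier L \<subseteq> g' ` carrier L'"
    proof
      fix l assume l: "l \<in> carrier L"
      then have fl: "f' l \<in> carrier L'" by (rule rmod_hom_closed[OF f'(1)])
      have "g' (f' l) = l"
        using f'(2) l f'g'[OF fl] rmod_hom_closed[OF g'(1) fl] by (auto simp: bij_betw_def dest: inj_onD)
      then show "l \<in> g' ` carrier L'" using fl by (metis image_eqI)
    qed
  qed
  then have g_surj: "g ` carrier P' = carrier P"
    using surj_if_reduction_surj[OF assms(1,5,4) g(1)] g'(2) by simp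
  have gf: "g (f x) = x" if x: "x \<in> carrier P" for x
  proof -
    obtain y where "y \<in> carrier P'" "x = g y" using x g_surj by auto
    then show ?thesis using g(2) by simp
  qed
  show ?thesis
    by (rule rmod_isomorphicI[OF f(1) g(1)]) (simp_all add: gf g(2))
qed

text \<open>Let \<open>s\<close> and \<open>p\<close> exhibit \<open>L\<close> as a retract of the free \<open>S\<close>-module. The idempotent \<open>s p\<close> lifts to \<open>A\<close>,
  and \<open>ker1\<close>, the elements killed by a power of \<open>1 - A\<close>, is the required module: \<open>p\<close> after reduction
  vanishes on \<open>ker0\<close>, and the only elements of \<open>ker1\<close> on which it vanishes are those that reduce
  to zero.\<close>

lemma lift_countably_projective:
  assumes "right_T_nilpotent R N" "countably_projective S L"
  obtains P :: "'a seq_module" and \<pi>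
  where "countably_projective R P" "reduction P L \<pi>"
proof -
  obtain s p where sp: "s \<in> rmod_hom S L (free_module S)" "p \<in> rmod_hom S (free_module S) L"
    "\<And>x. x \<in> carrier L \<Longrightarrow> p (s x) = x"
    using assms(2) by (auto simp: countably_projective_def)
  have L: "right_module S L" using assms(2) by (rule countably_projective_module)
  then interpret L: right_module S L .
  let ?F = "free_module R"
  define \<rho> where "\<rho> = (\<lambda>x :: nat \<Rightarrow> 'a. \<lambda>i\<in>UNIV. h (x i))"
  have red: "reduction ?F (free_module S) \<rho>"
    unfolding \<rho>_def by (rule reduction_power[OF reduction_regular])
  note F = reductionD(1)[OF red] and FS = reductionD(2)[OF red]
  interpret F: right_module R ?F by (rule F)
  interpret FS: right_module S "free_module S" by (rule FS)
  have sp_hom: "s \<circ> p \<in> rmod_hom S (free_module S) (free_module S)"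
    by (rule rmod_hom_comp[OF sp(2,1)])
  obtain A where hom_A: "A \<in> rmod_hom R ?F ?F"
    and rho_A: "\<And>x. x \<in> carrier ?F \<Longrightarrow> \<rho> (A x) = (s \<circ> p) (\<rho> x)"
    using reduction_lift[OF countably_projective_free[OF ring_R] red red sp_hom] by blast
  define C where "C = (\<lambda>x. id x \<ominus>\<^bsub>?F\<^esub> A x)"
  have C: "C \<in> rmod_hom R ?F ?F"
    unfolding C_def by (rule rmod_hom_minus_fun[OF F rmod_hom_id hom_A])
  interpret complementary_endomorphisms R ?F A C
  proof (unfold_locales, fact hom_A, fact C)
    fix x assume x: "x \<in> carrier ?F"
    then show "A x \<oplus>\<^bsub>?F\<^esub> C x = x"
      using F.minus_add_cancel[OF x rmod_hom_closed[OF hom_A x]]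
        F.M.a_comm[OF rmod_hom_closed[OF hom_A x] rmod_hom_closed[OF C x]]
      by (simp only: C_def id_apply)
  qed
  note pc = rmod_hom_closed[OF sp(2)] and rc = reduction_closed[OF red]
  have rho_C: "\<rho> (C x) = \<rho> x \<ominus>\<^bsub>free_module S\<^esub> s (p (\<rho> x))" if "x \<in> carrier ?F" for x
    using reduction_diff[OF red that closed(1)[OF that]] rho_A[OF that] by (simp only: C_def id_apply o_apply)
  have p_rho_C: "p (\<rho> (C x)) = \<zero>\<^bsub>L\<^esub>" if x: "x \<in> carrier ?F" for x
    using rmod_hom_diff[OF FS L sp(2) rc[OF x] rmod_hom_closed[OF sp(1) pc[OF rc[OF x]]]]
      sp(3)[OF pc[OF rc[OF x]]] pc[OF rc[OF x]]
    by (simp only: rho_C[OF x]) (simp add: a_minus_def L.M.r_neg)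
  \<comment> \<open>Modulo \<open>N\<close>, the map \<open>A C\<close> is \<open>e (1 - e)\<close> for the idempotent \<open>e = s p\<close>.\<close>
  have "(A \<circ> C) x \<in> rmod_prod ?F (carrier ?F) N" if x: "x \<in> carrier ?F" for x
  proof (rule reductionD(5)[OF red])
    show "(A \<circ> C) x \<in> carrier ?F" using closed(1,2) x by (simp only: o_apply)
    show "\<rho> ((A \<circ> C) x) = \<zero>\<^bsub>free_module S\<^esub>"
      using rho_A[OF closed(2)[OF x]] p_rho_C[OF x] rmod_hom_zero[OF L FS sp(1)] by (simp only: o_apply)
  qed
  then have nil: "\<exists>n. ((A \<circ> C) ^^ n) x = \<zero>\<^bsub>?F\<^esub>" if "x \<in> carrier ?F" for x
    using locally_nilpotent[OF F ideal_N assms(1) rmod_hom_comp[OF C hom_A] _ that] by blast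
  have span: "\<exists>u\<in>ker0. \<exists>v\<in>ker1. x = u \<oplus>\<^bsub>?F\<^esub> v" if x: "x \<in> carrier ?F" for x
    using fitting[OF x] nil[OF x] by blast
  obtain e where e: "e \<in> rmod_hom R ?F (?F\<lparr>carrier := ker1\<rparr>)" "\<And>x. x \<in> ker1 \<Longrightarrow> e x = x"
    using direct_sum_projection[OF F submodule_ker0 submodule_ker1 ker_disjoint span] by blast
  let ?P = "?F\<lparr>carrier := ker1\<rparr>"
  have P: "right_module R ?P" by (rule right_module_submodule[OF F submodule_ker1])
  have ker1_F: "x \<in> carrier ?F" if "x \<in> ker1" for x using that by (auto simp: ker1_def)
  have incl: "id \<in> rmod_hom R ?P ?F" by (rule rmod_homI) (use ker1_F in auto)
  have cP: "countably_projective R ?P"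
    by (rule countably_projective_retract[OF countably_projective_free[OF ring_R] P incl e(1)])
       (simp add: e(2))
  have on_ker0: "p (\<rho> x) = \<zero>\<^bsub>L\<^esub>" if x: "x \<in> ker0" for x
  proof -
    obtain n where "x \<in> carrier ?F" "(A ^^ n) x = \<zero>\<^bsub>?F\<^esub>" using x by (auto simp: ker0_def)
    then show ?thesis
    proof (induction n arbitrary: x)
      case 0
      then show ?case
        using reduction_zero_elem[OF red] rmod_hom_zero[OF FS L sp(2)] by (simp only: funpow_0)
    next
      case (Suc n)
      have "p (\<rho> (A x)) = \<zero>\<^bsub>L\<^esub>"
        using Suc.IH[OF closed(1)[OF Suc.prems(1)]] Suc.prems(2) by (simp only: funpow_Suc_right o_apply)
      then show ?case
        using rho_A[OF Suc.prems(1)] sp(3)[OF pc[OF rc[OF Suc.prems(1)]]] by (simp only: o_apply)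
    qed
  qed
  have on_ker1: "\<rho> x = \<zero>\<^bsub>free_module S\<^esub>" if x: "x \<in> ker1" "p (\<rho> x) = \<zero>\<^bsub>L\<^esub>" for x
  proof -
    obtain n where "x \<in> carrier ?F" "(C ^^ n) x = \<zero>\<^bsub>?F\<^esub>" using x(1) by (auto simp: ker1_def)
    then show ?thesis using x(2)
    proof (induction n arbitrary: x)
      case 0
      then show ?case using reduction_zero_elem[OF red] by (simp only: funpow_0)
    next
      case (Suc n)
      have "\<rho> (C x) = \<zero>\<^bsub>free_module S\<^esub>"
        using Suc.IH[OF closed(2)[OF Suc.prems(1)] _ p_rho_C[OF Suc.prems(1)]] Suc.prems(2)
        by (simp only: funpow_Suc_right o_apply)
      then have "\<rho> x \<ominus>\<^bsub>free_module S\<^esub> \<zero>\<^bsub>free_module S\<^esub> = \<zero>\<^bsub>free_module S\<^esub>"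
        using rho_C[OF Suc.prems(1)] Suc.prems(3) rmod_hom_zero[OF L FS sp(1)] by (simp only:)
      then show ?case
        using FS.minus_add_cancel[OF rc[OF Suc.prems(1)] FS.M.zero_closed] FS.M.l_zero[OF FS.M.zero_closed]
        by (simp only:)
    qed
  qed
  have hom: "p \<circ> \<rho> \<in> rmod_hom R ?P (restrict_scalars h L)"
    using rmod_hom_comp[OF rmod_hom_comp[OF incl reductionD(3)[OF red]] rmod_hom_restrict[OF sp(2)]]
    by (simp only: o_id comp_id)
  have "\<exists>x\<in>ker1. l = (p \<circ> \<rho>) x" if l: "l \<in> carrier L" for l
  proof -
    obtain x where x: "x \<in> carrier ?F" "s l = \<rho> x"
      using rmod_hom_closed[OF sp(1) l] reductionD(4)[OF red] by (metis imageE)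
    obtain u v where uv: "u \<in> ker0" "v \<in> ker1" "x = u \<oplus>\<^bsub>?F\<^esub> v" using span[OF x(1)] by blast
    have u: "u \<in> carrier ?F" using uv(1) by (auto simp: ker0_def)
    note v = ker1_F[OF uv(2)]
    have "p (\<rho> x) = p (\<rho> u) \<oplus>\<^bsub>L\<^esub> p (\<rho> v)"
      unfolding uv(3) reduction_add[OF red u v] by (rule rmod_hom_add[OF sp(2) rc[OF u] rc[OF v]])
    then have "l = p (\<rho> v)"
      using on_ker0[OF uv(1)] sp(3)[OF l] x(2) pc[OF rc[OF v]] by simp
    then show ?thesis using uv(2) by auto
  qed
  moreover have "(p \<circ> \<rho>) x \<in> carrier L" if "x \<in> ker1" for x
    using pc[OF rc[OF ker1_F[OF that]]] by simp
  ultimately have surj: "(p \<circ> \<rho>) ` carrier ?P = carrier L" by auto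
  have "x \<in> rmod_prod ?P (carrier ?P) N" if "x \<in> ker1" "(p \<circ> \<rho>) x = \<zero>\<^bsub>L\<^esub>" for x
  proof -
    have "x \<in> rmod_prod ?F (carrier ?F) N"
      using reductionD(5)[OF red ker1_F[OF that(1)]] on_ker1[OF that(1)] that(2) by simp
    then show ?thesis using rmod_hom_prod_ideal[OF F P ideal_N e(1)] e(2)[OF that(1)] by metis
  qed
  then have "reduction ?P L (p \<circ> \<rho>)"
    using P L hom surj unfolding reduction_def by simp
  then show ?thesis using that cP by blast
qed

lemma submodule_of_restrict:
  assumes "right_module S L" shows "submodule R (restrict_scalars h L) U \<longleftrightarrow> submodule S L U"
  unfolding submodule_def surj_h[symmetric] by auto

lemma submodule_reduction_image:
  assumes "reduction M L \<pi>" "submodule R M U" shows "submodule S L (\<pi> ` U)"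
proof -
  have "\<pi> \<in> rmod_hom R (M\<lparr>carrier := U\<rparr>) (restrict_scalars h L)"
    by (rule rmod_hom_on_submodule[OF reductionD(3)[OF assms(1)] assms(2)])
  from rmod_hom_image_submodule[OF right_module_submodule[OF reductionD(1)[OF assms(1)] assms(2)]
      right_module_restrict[OF reductionD(2)[OF assms(1)]] this]
  show ?thesis using submodule_of_restrict[OF reductionD(2)[OF assms(1)]] by simp
qed

lemma submodule_reduction_vimage:
  assumes "reduction M L \<pi>" "submodule S L V" shows "submodule R M {x \<in> carrier M. \<pi> x \<in> V}"
proof -
  interpret right_module R M by (rule reductionD(1)[OF assms(1)])
  show ?thesis
    using assms(2) ring_hom_closed[OF hom_h] reduction_zero_elem[OF assms(1)]
    by (auto simp: submodule_def reduction_add[OF assms(1)] reduction_smult[OF assms(1)] rsmult_closed)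
qed

text \<open>Besides existence, the point is that the elements of \<open>L\<close> are sequences: \<open>L\<close> is the image of
  \<open>P\<close> in the free \<open>S\<close>-module.\<close>

lemma reduction_exists:
  assumes "countably_projective R P"
  obtains L :: "'b seq_module" and \<pi> where "reduction P L \<pi>"
proof -
  obtain s p where sp: "s \<in> rmod_hom R P (free_module R)" "p \<in> rmod_hom R (free_module R) P"
    "\<And>x. x \<in> carrier P \<Longrightarrow> p (s x) = x"
    using assms by (auto simp: countably_projective_def)
  note P = countably_projective_module[OF assms]
  define \<rho> where "\<rho> = (\<lambda>x :: nat \<Rightarrow> 'a. \<lambda>i\<in>UNIV. h (x i))"
  have red: "reduction (free_module R) (free_module S) \<rho>"
    unfolding \<rho>_def by (rule reduction_power[OF reduction_regular])
  note F = reductionD(1)[OF red] and FS = reductionD(2)[OF red]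
  let ?L = "free_module S\<lparr>carrier := \<rho> ` s ` carrier P\<rparr>"
  have L: "right_module S ?L"
    by (rule right_module_submodule[OF FS
          submodule_reduction_image[OF red rmod_hom_image_submodule[OF P F sp(1)]]])
  have "\<rho> \<circ> s \<in> rmod_hom R P (restrict_scalars h (free_module S))"
    by (rule rmod_hom_comp[OF sp(1) reductionD(3)[OF red]])
  then have hom: "\<rho> \<circ> s \<in> rmod_hom R P (restrict_scalars h ?L)"
    by (auto simp: rmod_hom_def)
  have "x \<in> rmod_prod P (carrier P) N" if "x \<in> carrier P" "(\<rho> \<circ> s) x = \<zero>\<^bsub>?L\<^esub>" for x
  proof -
    have "s x \<in> rmod_prod (free_module R) (carrier (free_module R)) N"
      using reductionD(5)[OF red rmod_hom_closed[OF sp(1) that(1)]] that(2) by simp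
    then show ?thesis using rmod_hom_prod_ideal[OF F P ideal_N sp(2)] sp(3)[OF that(1)] by metis
  qed
  then have "reduction P ?L (\<rho> \<circ> s)"
    using P L hom unfolding reduction_def by (simp add: image_comp)
  then show ?thesis using that by blast
qed

end

section \<open>Finite generation\<close>

text \<open>Finite generation of \<open>M/H\<close>, expressed in \<open>M\<close> for the sake of Nakayama's lemma.\<close>

definition finitely_generated_modulo ::
    "('a, 'r) ring_scheme \<Rightarrow> ('a, 'm) right_module \<Rightarrow> 'm set \<Rightarrow> bool"
  where "finitely_generated_modulo R M H \<longleftrightarrow> (\<exists>T\<subseteq>carrier M. finite T \<and>
    (\<forall>x\<in>carrier M. \<exists>y\<in>rmod_prod M T (carrier R). \<exists>z\<in>H. x = y \<oplus>\<^bsub>M\<^esub> z))"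

lemma rmod_hom_span:
  assumes "right_module R M" "right_module R L" "f \<in> rmod_hom R M L" "T \<subseteq> carrier M"
  shows "f ` rmod_prod M T (carrier R) = rmod_prod L (f ` T) (carrier R)"
proof
  interpret M: right_module R M by fact
  have fT: "f ` T \<subseteq> carrier L" using assms(4) rmod_hom_closed[OF assms(3)] by auto
  note span = submodule_span[OF assms(1,4)] and span' = submodule_span[OF assms(2) fT]
  have "f \<in> rmod_hom R (M\<lparr>carrier := rmod_prod M T (carrier R)\<rparr>) L"
    by (rule rmod_hom_on_submodule[OF assms(3) span])
  from rmod_hom_image_submodule[OF right_module_submodule[OF assms(1) span] assms(2) this]
  have "submodule R L (f ` rmod_prod M T (carrier R))" by simp
  then show "rmod_prod L (f ` T) (carrier R) \<subseteq> f ` rmod_prod M T (carrier R)"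
    by (rule span_subset_submodule[OF assms(2)]) (use subset_span[OF assms(1,4)] in blast)
  have "submodule R M {x \<in> carrier M. f x \<in> rmod_prod L (f ` T) (carrier R)}"
    using span' rmod_hom_zero[OF assms(1-3)]
    by (auto simp: submodule_def rmod_hom_add[OF assms(3)] rmod_hom_smult[OF assms(3)] M.rsmult_closed)
  from span_subset_submodule[OF assms(1) this, of T]
  show "f ` rmod_prod M T (carrier R) \<subseteq> rmod_prod L (f ` T) (carrier R)"
    using assms(4) subset_span[OF assms(2) fT] by auto
qed

lemma finitely_generated_image_iff:
  fixes M (structure)
  assumes "right_module R M" "right_module R Q" "q \<in> rmod_hom R M Q" "q ` carrier M = carrier Q"
  shows "finitely_generated R Q \<longleftrightarrow>
    finitely_generated_modulo R M {x \<in> carrier M. q x = \<zero>\<^bsub>Q\<^esub>}" (is "_ \<longleftrightarrow> finitely_generated_modulo R M ?K")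
proof
  interpret M: right_module R M by fact
  interpret Q: right_module R Q by fact
  show "finitely_generated_modulo R M ?K" if "finitely_generated R Q"
  proof -
    obtain T' where T': "T' \<subseteq> carrier Q" "finite T'" "rmod_prod Q T' (carrier R) = carrier Q"
      using \<open>finitely_generated R Q\<close> by (auto simp: finitely_generated_def)
    then obtain T where T: "T \<subseteq> carrier M" "finite T" "T' = q ` T"
      using finite_subset_image[of T' q "carrier M"] assms(4) by auto
    have "\<exists>y\<in>rmod_prod M T (carrier R). \<exists>z\<in>?K. x = y \<oplus> z"
      if x: "x \<in> carrier M" for x
    proof -
      have "q x \<in> q ` rmod_prod M T (carrier R)"
        using rmod_hom_span[OF assms(1-3) T(1)] T'(3) T(3) rmod_hom_closed[OF assms(3) x] by simp
      then obtain y where y: "y \<in> rmod_prod M T (carrier R)" "q x = q y" by auto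
      have yM: "y \<in> carrier M" using y(1) submodule_span[OF assms(1) T(1)] by (auto simp: submodule_def)
      have "q (x \<ominus> y) = \<zero>\<^bsub>Q\<^esub>"
        using rmod_hom_diff[OF assms(1-3) x yM] y(2) rmod_hom_closed[OF assms(3) yM]
        by (simp add: a_minus_def Q.M.r_neg)
      then show ?thesis
        using y(1) x yM M.minus_add_cancel[OF x yM] M.M.a_comm[of y "x \<ominus> y"]
        by (intro bexI[of _ y] bexI[of _ "x \<ominus> y"]) auto
    qed
    then show ?thesis using T(1,2) unfolding finitely_generated_modulo_def by blast
  qed
  show "finitely_generated R Q" if fg: "finitely_generated_modulo R M ?K"
  proof -
    obtain T where T: "T \<subseteq> carrier M" "finite T"
      "\<And>x. x \<in> carrier M \<Longrightarrow> \<exists>y\<in>rmod_prod M T (carrier R). \<exists>z\<in>?K. x = y \<oplus> z"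
      using fg unfolding finitely_generated_modulo_def by blast
    have "q x \<in> rmod_prod Q (q ` T) (carrier R)" if x: "x \<in> carrier M" for x
    proof -
      obtain y z where yz: "y \<in> rmod_prod M T (carrier R)" "z \<in> carrier M" "q z = \<zero>\<^bsub>Q\<^esub>" "x = y \<oplus> z"
        using T(3)[OF x] by blast
      have "y \<in> carrier M" using yz(1) submodule_span[OF assms(1) T(1)] by (auto simp: submodule_def)
      then have "q x = q y"
        using yz rmod_hom_add[OF assms(3), of y z] rmod_hom_closed[OF assms(3), of y] by simp
      then show ?thesis using yz(1) rmod_hom_span[OF assms(1-3) T(1)] by blast
    qed
    then have "carrier Q \<subseteq> rmod_prod Q (q ` T) (carrier R)"
      unfolding assms(4)[symmetric] by (rule image_subsetI)
    moreover have qT: "q ` T \<subseteq> carrier Q" unfolding assms(4)[symmetric] using T(1) by (rule image_mono)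
    ultimately show ?thesis
      using submodule_span[OF assms(2) qT] T(2) unfolding finitely_generated_def submodule_def
      by (intro exI[of _ "q ` T"]) auto
  qed
qed

lemma finitely_generated_modulo_mono:
  "\<lbrakk>finitely_generated_modulo R M H; H \<subseteq> K\<rbrakk> \<Longrightarrow> finitely_generated_modulo R M K"
  unfolding finitely_generated_modulo_def by (meson subsetD)

lemma submodule_sum:
  fixes M (structure)
  assumes "right_module R M" "submodule R M U" "submodule R M V"
  shows "submodule R M {u \<oplus> v | u v. u \<in> U \<and> v \<in> V}" (is "submodule R M ?W")
proof -
  interpret right_module R M by fact
  have U: "x \<in> carrier M" if "x \<in> U" for x using that assms(2) by (auto simp: submodule_def)
  have V: "x \<in> carrier M" if "x \<in> V" for x using that assms(3) by (auto simp: submodule_def)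
  have zero: "\<zero> = \<zero> \<oplus> \<zero>" by simp
  have add: "(u \<oplus> v) \<oplus> (u' \<oplus> v') = (u \<oplus> u') \<oplus> (v \<oplus> v')"
    if "u \<in> U" "v \<in> V" "u' \<in> U" "v' \<in> V" for u v u' v'
    using that U V by (simp add: M.a_ac)
  show ?thesis
    unfolding submodule_def
  proof (intro conjI ballI)
    show "?W \<subseteq> carrier M" using U V by auto
    show "\<zero> \<in> ?W"
      using zero assms(2,3) unfolding submodule_def by blast
  next
    fix x y assume "x \<in> ?W" "y \<in> ?W"
    then obtain u v u' v' where *: "x = u \<oplus> v" "y = u' \<oplus> v'" "u \<in> U" "v \<in> V" "u' \<in> U" "v' \<in> V"
      by blast
    then have "u \<oplus> u' \<in> U" "v \<oplus> v' \<in> V" using assms(2,3) by (auto simp: submodule_def)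
    then show "x \<oplus> y \<in> ?W"
      using add[OF *(3-6)] *(1,2) by blast
  next
    fix x a assume "x \<in> ?W" and a: "a \<in> carrier R"
    then obtain u v where *: "x = u \<oplus> v" "u \<in> U" "v \<in> V" by blast
    then have "u \<triangleleft> a \<in> U" "v \<triangleleft> a \<in> V" "x \<triangleleft> a = u \<triangleleft> a \<oplus> v \<triangleleft> a"
      using assms(2,3) a U V by (auto simp: submodule_def rsmult_l_distr)
    then show "x \<triangleleft> a \<in> ?W" by blast
  qed
qed

text \<open>If \<open>K \<subseteq> MN + H\<close> and a finite set together with \<open>K\<close> generates \<open>M\<close>, then the same set together
  with \<open>H\<close> generates \<open>M\<close> up to \<open>MN\<close>, hence all of \<open>M\<close>.\<close>

lemma finitely_generated_modulo_nakayama: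
  fixes M (structure)
  assumes "right_module R M" "ideal N R" "right_T_nilpotent R N" "submodule R M H"
    and KH: "\<And>x. x \<in> K \<Longrightarrow> \<exists>y\<in>rmod_prod M (carrier M) N. \<exists>z\<in>H. x = y \<oplus> z"
    and "finitely_generated_modulo R M K"
  shows "finitely_generated_modulo R M H"
proof -
  interpret right_module R M by fact
  obtain T where T: "T \<subseteq> carrier M" "finite T"
    "\<And>x. x \<in> carrier M \<Longrightarrow> \<exists>y\<in>rmod_prod M T (carrier R). \<exists>z\<in>K. x = y \<oplus> z"
    using assms(6) unfolding finitely_generated_modulo_def by blast
  let ?W = "{u \<oplus> v | u v. u \<in> rmod_prod M T (carrier R) \<and> v \<in> H}"
  note span = submodule_span[OF assms(1) T(1)]
  have "?W = carrier M"
  proof (rule nakayama[OF assms(1-3) submodule_sum[OF assms(1) span assms(4)]])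
    fix m assume "m \<in> carrier M"
    then obtain u k where uk: "u \<in> rmod_prod M T (carrier R)" "k \<in> K" "m = u \<oplus> k" using T(3) by blast
    then obtain y z where yz: "y \<in> rmod_prod M (carrier M) N" "z \<in> H" "k = y \<oplus> z" using KH by blast
    have "u \<in> carrier M" "y \<in> carrier M" "z \<in> carrier M"
      using uk(1) yz(1,2) span assms(4) submodule_prod_ideal[OF assms(1,2)] by (auto simp: submodule_def)
    then have "m = y \<oplus> (u \<oplus> z)" unfolding uk(3) yz(3) by (simp add: M.a_ac)
    then show "\<exists>y\<in>rmod_prod M (carrier M) N.
        \<exists>z\<in>?W. m = y \<oplus> z"
      using yz(1,2) uk(1) by blast
  qed
  then have "\<exists>y\<in>rmod_prod M T (carrier R). \<exists>z\<in>H. x = y \<oplus> z" if "x \<in> carrier M" for x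
    using that by blast
  then show ?thesis using T(1,2) unfolding finitely_generated_modulo_def by blast
qed

text \<open>For additive monoids that differ only in the type of the record, such as those of a module and of
  its restriction of scalars.\<close>

lemma generate_cong:
  assumes "\<one>\<^bsub>G\<^esub> = \<one>\<^bsub>G'\<^esub>" "\<And>x y. x \<otimes>\<^bsub>G\<^esub> y = x \<otimes>\<^bsub>G'\<^esub> y" "\<And>x. inv\<^bsub>G\<^esub> x = inv\<^bsub>G'\<^esub> x"
  shows "generate G H = generate G' H"
proof (intro equalityI subsetI)
  fix x assume "x \<in> generate G H"
  then show "x \<in> generate G' H" by (induction rule: generate.induct) (auto simp: assms intro: generate.intros)
next
  fix x assume "x \<in> generate G' H"
  then show "x \<in> generate G H"
    by (induction rule: generate.induct) (auto simp flip: assms intro: generate.intros)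
qed

lemma rmod_quot:
  fixes M (structure)
  assumes "right_module R M" "submodule R M H"
  shows "right_module R (rmod_quot M H)" "(+>) H \<in> rmod_hom R M (rmod_quot M H)"
    "(+>) H ` carrier M = carrier (rmod_quot M H)"
    "\<And>x. x \<in> carrier M \<Longrightarrow> H +> x = \<zero>\<^bsub>rmod_quot M H\<^esub> \<longleftrightarrow> x \<in> H"
proof -
  interpret right_module R M by fact
  interpret H: abelian_subgroup H M by (rule submodule_abelian_subgroup[OF assms])
  have HM: "x \<in> carrier M" if "x \<in> H" for x using that assms(2) by (auto simp: submodule_def)
  show surj: "(+>) H ` carrier M = carrier (rmod_quot M H)"
    by (auto simp: rmod_quot_def A_RCOSETS_def')
  have add: "H +> (x \<oplus> y) = (H +> x) \<oplus>\<^bsub>rmod_quot M H\<^esub> (H +> y)"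
    if "x \<in> carrier M" "y \<in> carrier M" for x y
    using H.a_rcos_sum that by (simp add: rmod_quot_def)
  have smult: "H +> (x \<triangleleft> a) = (H +> x) \<triangleleft>\<^bsub>rmod_quot M H\<^esub> a"
    if x: "x \<in> carrier M" and a: "a \<in> carrier R" for x a
  proof -
    have "H +> (y \<triangleleft> a) = H +> (x \<triangleleft> a)" if y: "y \<in> H +> x" for y
    proof -
      obtain z where z: "z \<in> H" "y = z \<oplus> x" using y by (auto simp: a_r_coset_def')
      have "y \<triangleleft> a \<in> H +> (x \<triangleleft> a)"
        using z HM x a assms(2) by (auto simp: a_r_coset_def' rsmult_l_distr submodule_def)
      then show ?thesis using H.a_repr_independence' x a by (metis rsmult_closed)
    qed
    then have "(\<Union>y\<in>H +> x. H +> (y \<triangleleft> a)) = H +> (x \<triangleleft> a)"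
      by (intro UN_constant_eq[OF H.a_rcos_self[OF x]] ballI)
    then show ?thesis by (simp add: rmod_quot_def)
  qed
  show "H +> x = \<zero>\<^bsub>rmod_quot M H\<^esub> \<longleftrightarrow> x \<in> H" if "x \<in> carrier M" for x
    using that H.a_rcos_self[OF that] H.a_rcos_const by (auto simp: rmod_quot_def)
  have zero: "H +> \<zero> = \<zero>\<^bsub>rmod_quot M H\<^esub>"
    using M.a_coset_add_zero[of H] assms(2) by (simp add: submodule_def rmod_quot_def)
  have "id \<in> ring_hom R R" by (auto simp: ring_hom_def)
  from right_module_image[OF R.ring_axioms assms(1) this, of "(+>) H" "rmod_quot M H"]
  show "right_module R (rmod_quot M H)" using surj zero add smult by simp
  show "(+>) H \<in> rmod_hom R M (rmod_quot M H)"
    by (rule rmod_homI) (use surj add smult in auto)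
qed

lemma finitely_generated_quot_iff:
  assumes "right_module R M" "submodule R M H"
  shows "finitely_generated R (rmod_quot M H) \<longleftrightarrow> finitely_generated_modulo R M H"
proof -
  have "{x \<in> carrier M. H +>\<^bsub>M\<^esub> x = \<zero>\<^bsub>rmod_quot M H\<^esub>} = H"
    using rmod_quot(4)[OF assms] assms(2) by (auto simp: submodule_def)
  then show ?thesis using finitely_generated_image_iff[OF assms(1) rmod_quot(1-3)[OF assms]] by simp
qed

lemma finitely_generated_iff_modulo_zero:
  fixes M (structure)
  assumes "right_module R M"
  shows "finitely_generated R M \<longleftrightarrow> finitely_generated_modulo R M {\<zero>}"
proof -
  interpret right_module R M by fact
  have "{x \<in> carrier M. id x = \<zero>} = {\<zero>}" by auto
  then show ?thesis using finitely_generated_image_iff[OF assms assms rmod_hom_id] by simp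
qed

context surjective_ring_hom
begin

lemma finitely_generated_restrict:
  "finitely_generated R (restrict_scalars h L) \<longleftrightarrow> finitely_generated S L"
proof -
  have "rmod_prod (restrict_scalars h L) T (carrier R) = rmod_prod L T (carrier S)" for T
  proof -
    have "{x \<triangleleft>\<^bsub>restrict_scalars h L\<^esub> a | x a. x \<in> T \<and> a \<in> carrier R} =
        {x \<triangleleft>\<^bsub>L\<^esub> b | x b. x \<in> T \<and> b \<in> carrier S}"
      unfolding surj_h[symmetric] by auto
    then show ?thesis
      unfolding rmod_prod_def by (simp only:) (rule generate_cong; simp add: m_inv_def)
  qed
  then show ?thesis by (simp add: finitely_generated_def)
qed

text \<open>Both sides compare to generation of \<open>M\<close> modulo the preimage of \<open>V\<close>, which is contained in
  \<open>MN + U\<close>.\<close>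

lemma finitely_generated_quot_reduction:
  assumes "right_T_nilpotent R N" "reduction M L \<pi>" "submodule R M U" "submodule S L V" "\<pi> ` U = V"
  shows "finitely_generated R (rmod_quot M U) \<longleftrightarrow> finitely_generated S (rmod_quot L V)"
proof -
  note M = reductionD(1)[OF assms(2)] and L = reductionD(2)[OF assms(2)]
  interpret M: right_module R M by (rule M)
  note Q = rmod_quot[OF L assms(4)]
  have UM: "x \<in> carrier M" if "x \<in> U" for x using that assms(3) by (auto simp: submodule_def)
  define K where "K = {x \<in> carrier M. \<pi> x \<in> V}"
  let ?q = "(+>\<^bsub>L\<^esub>) V \<circ> \<pi>"
  have q: "?q \<in> rmod_hom R M (restrict_scalars h (rmod_quot L V))"
    by (rule rmod_hom_comp[OF reductionD(3)[OF assms(2)] rmod_hom_restrict[OF Q(2)]])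
  have "?q ` carrier M = carrier (restrict_scalars h (rmod_quot L V))"
    using reductionD(4)[OF assms(2)] Q(3) by (simp only: image_comp[symmetric] restrict_scalars_simps)
  from finitely_generated_image_iff[OF M right_module_restrict[OF Q(1)] q this]
  have "finitely_generated S (rmod_quot L V) \<longleftrightarrow>
      finitely_generated_modulo R M {x \<in> carrier M. ?q x = \<zero>\<^bsub>rmod_quot L V\<^esub>}"
    by (simp only: finitely_generated_restrict restrict_scalars_simps)
  also have "{x \<in> carrier M. ?q x = \<zero>\<^bsub>rmod_quot L V\<^esub>} = K"
    using Q(4)[OF reduction_closed[OF assms(2)]] by (auto simp: K_def)
  also have "finitely_generated_modulo R M K \<longleftrightarrow> finitely_generated_modulo R M U"
  proof
    assume "finitely_generated_modulo R M U"
    then show "finitely_generated_modulo R M K"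
      by (rule finitely_generated_modulo_mono) (use UM assms(5) in \<open>auto simp: K_def\<close>)
  next
    assume "finitely_generated_modulo R M K"
    then show "finitely_generated_modulo R M U"
    proof (rule finitely_generated_modulo_nakayama[OF M ideal_N assms(1,3), rotated])
      fix x assume "x \<in> K"
      then obtain u where u: "x \<in> carrier M" "u \<in> U" "\<pi> x = \<pi> u" using assms(5) by (auto simp: K_def)
      then show "\<exists>y\<in>rmod_prod M (carrier M) N. \<exists>z\<in>U. x = y \<oplus>\<^bsub>M\<^esub> z"
        using reduction_eqD[OF assms(2) u(1) UM[OF u(2)] u(3)] M.minus_add_cancel[OF u(1) UM[OF u(2)]]
        by metis
    qed
  qed
  finally show ?thesis using finitely_generated_quot_iff[OF M assms(3)] by simp
qed

lemma finitely_generated_reduction: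
  assumes "right_T_nilpotent R N" "reduction M L \<pi>"
  shows "finitely_generated R M \<longleftrightarrow> finitely_generated S L"
proof -
  note M = reductionD(1)[OF assms(2)] and L = reductionD(2)[OF assms(2)]
  show ?thesis
    using finitely_generated_quot_reduction[OF assms submodule_zero[OF M] submodule_zero[OF L]]
      reduction_zero_elem[OF assms(2)] finitely_generated_iff_modulo_zero[OF M]
      finitely_generated_iff_modulo_zero[OF L] finitely_generated_quot_iff[OF M submodule_zero[OF M]]
      finitely_generated_quot_iff[OF L submodule_zero[OF L]] by simp
qed

end

section \<open>Trace ideals and relatively big modules\<close>

text \<open>The images of the functionals form a set closed under right multiplication, so the additive
  subgroup they generate is already a right submodule of \<open>R\<close>.\<close>

lemma trace_ideal_eq_span:
  assumes "right_module R M"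
  shows "trace_ideal R M =
    rmod_prod (regular_module R) (\<Union>f\<in>rmod_hom R M (regular_module R). f ` carrier M) (carrier R)"
proof -
  interpret right_module R M by fact
  let ?U = "\<Union>f\<in>rmod_hom R M (regular_module R). f ` carrier M"
  have "{x \<triangleleft>\<^bsub>regular_module R\<^esub> a | x a. x \<in> ?U \<and> a \<in> carrier R} = ?U"
  proof (intro equalityI subsetI)
    fix y assume "y \<in> {x \<triangleleft>\<^bsub>regular_module R\<^esub> a | x a. x \<in> ?U \<and> a \<in> carrier R}"
    then obtain f m a where *: "f \<in> rmod_hom R M (regular_module R)" "m \<in> carrier M" "a \<in> carrier R"
      "y = f m \<triangleleft>\<^bsub>regular_module R\<^esub> a" by auto
    then have "y = f (m \<triangleleft>\<^bsub>M\<^esub> a)" by (simp only: rmod_hom_smult[OF *(1-3)])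
    then show "y \<in> ?U" using * rsmult_closed by auto
  next
    fix y assume "y \<in> ?U"
    then have "y \<in> carrier R" using rmod_hom_closed[of _ R M "regular_module R"] by auto
    then have "y = y \<triangleleft>\<^bsub>regular_module R\<^esub> \<one>\<^bsub>R\<^esub>" by simp
    then show "y \<in> {x \<triangleleft>\<^bsub>regular_module R\<^esub> a | x a. x \<in> ?U \<and> a \<in> carrier R}"
      using \<open>y \<in> ?U\<close> R.one_closed by blast
  qed
  then show ?thesis
    unfolding trace_ideal_def rmod_prod_def
    by (simp only:) (rule generate_cong; simp add: m_inv_def)
qed

lemma submodule_trace_ideal:
  assumes "right_module R M" shows "submodule R (regular_module R) (trace_ideal R M)"
proof -
  interpret right_module R M by fact
  show ?thesis
    unfolding trace_ideal_eq_span[OF assms]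
    by (rule submodule_span[OF right_module_regular[OF R.ring_axioms]])
       (use rmod_hom_closed[of _ R M "regular_module R"] in auto)
qed

lemma right_ideal_minus:
  assumes "ring R" "submodule R (regular_module R) J" "a \<in> J"
  shows "\<ominus>\<^bsub>R\<^esub> a \<in> J"
proof -
  interpret ring R by fact
  have "a \<in> carrier R" "a \<otimes>\<^bsub>R\<^esub> (\<ominus>\<^bsub>R\<^esub> \<one>\<^bsub>R\<^esub>) \<in> J"
    using assms(2,3) by (auto simp: submodule_def)
  then show ?thesis by (simp add: r_minus)
qed

lemma submodule_prod_right_ideal:
  assumes "right_module R M" "submodule R (regular_module R) J"
  shows "submodule R M (rmod_prod M (carrier M) J)"
proof -
  interpret right_module R M by fact
  show ?thesis
    using assms right_ideal_minus[OF R.ring_axioms assms(2)]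
    by (intro submodule_rmod_prod) (auto simp: submodule_def)
qed

context surjective_ring_hom
begin

text \<open>Functionals on \<open>P\<close> induce functionals on \<open>L\<close>, and projectivity of \<open>P\<close> lifts every functional on
  \<open>L\<close> to one on \<open>P\<close>.\<close>

lemma trace_ideal_reduction:
  assumes "countably_projective R P" "reduction P L \<pi>"
  shows "trace_ideal S L = h ` trace_ideal R P"
proof
  note P = reductionD(1)[OF assms(2)] and L = reductionD(2)[OF assms(2)]
  let ?U = "\<Union>f\<in>rmod_hom R P (regular_module R). f ` carrier P"
  let ?V = "\<Union>f\<in>rmod_hom S L (regular_module S). f ` carrier L"
  have U: "?U \<subseteq> carrier (regular_module R)" using rmod_hom_closed[of _ R P "regular_module R"] by blast
  have V: "?V \<subseteq> carrier (regular_module S)" using rmod_hom_closed[of _ S L "regular_module S"] by blast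
  show "trace_ideal S L \<subseteq> h ` trace_ideal R P"
    unfolding trace_ideal_eq_span[OF L]
  proof (rule span_subset_submodule[OF right_module_regular[OF ring_S]
        submodule_reduction_image[OF reduction_regular submodule_trace_ideal[OF P]]], clarify)
    fix g l assume g: "g \<in> rmod_hom S L (regular_module S)" and "l \<in> carrier L"
    then obtain x where x: "x \<in> carrier P" "l = \<pi> x" using reductionD(4)[OF assms(2)] by auto
    obtain f where f: "f \<in> rmod_hom R P (regular_module R)" "\<And>x. x \<in> carrier P \<Longrightarrow> h (f x) = g (\<pi> x)"
      using reduction_lift[OF assms reduction_regular g] by blast
    have "f x \<in> ?U" using f(1) x(1) by blast
    then have "f x \<in> trace_ideal R P"
      unfolding trace_ideal_eq_span[OF P] using subset_span[OF right_module_regular[OF ring_R] U] by blast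
    then show "g l \<in> h ` trace_ideal R P" using f(2)[OF x(1)] x(2) by (metis image_eqI)
  qed
  have "trace_ideal R P \<subseteq> {a \<in> carrier (regular_module R). h a \<in> trace_ideal S L}"
    unfolding trace_ideal_eq_span[OF P]
  proof (rule span_subset_submodule[OF right_module_regular[OF ring_R]
        submodule_reduction_vimage[OF reduction_regular submodule_trace_ideal[OF L]]], clarify)
    fix f x assume f: "f \<in> rmod_hom R P (regular_module R)" and x: "x \<in> carrier P"
    obtain f' where f': "f' \<in> rmod_hom S L (regular_module S)" "\<And>x. x \<in> carrier P \<Longrightarrow> f' (\<pi> x) = h (f x)"
      using reduction_map[OF assms(2) reduction_regular f] by blast
    have "f' (\<pi> x) \<in> ?V" using f'(1) reduction_closed[OF assms(2) x] by blast
    then have "f' (\<pi> x) \<in> trace_ideal S L"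
      unfolding trace_ideal_eq_span[OF L] using subset_span[OF right_module_regular[OF ring_S] V] by blast
    then show "f x \<in> carrier (regular_module R) \<and> h (f x) \<in> trace_ideal S L"
      using f'(2)[OF x] rmod_hom_closed[OF f x] by simp
  qed
  then show "h ` trace_ideal R P \<subseteq> trace_ideal S L" by blast
qed

lemma reduction_image_prod:
  assumes "reduction M L \<pi>" "submodule R (regular_module R) J"
  shows "\<pi> ` rmod_prod M (carrier M) J = rmod_prod L (carrier L) (h ` J)" (is "_ ` ?U = ?V")
    and "submodule R M (rmod_prod M (carrier M) J)"
    and "submodule S L (rmod_prod L (carrier L) (h ` J))"
proof -
  note M = reductionD(1)[OF assms(1)] and L = reductionD(2)[OF assms(1)]
  interpret M: right_module R M by (rule M)
  show U: "submodule R M (?U)" by (rule submodule_prod_right_ideal[OF M assms(2)])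
  note hJ = submodule_reduction_image[OF reduction_regular assms(2)]
  have J: "J \<subseteq> carrier R" "\<forall>a\<in>J. \<ominus>\<^bsub>R\<^esub> a \<in> J"
    using assms(2) right_ideal_minus[OF ring_R assms(2)] by (auto simp: submodule_def)
  have hJ': "h ` J \<subseteq> carrier S" "\<forall>a\<in>h ` J. \<ominus>\<^bsub>S\<^esub> a \<in> h ` J"
    using hJ right_ideal_minus[OF ring_S hJ] by (auto simp: submodule_def)
  show V: "submodule S L (?V)"
    by (rule submodule_prod_right_ideal[OF L hJ])
  show "\<pi> ` ?U = ?V"
  proof
    have "?U \<subseteq> {x \<in> carrier M. \<pi> x \<in> ?V}"
    proof (rule rmod_prod_subset_submodule[OF M submodule_reduction_vimage[OF assms(1) V] order_refl J])
      fix x a assume x: "x \<in> carrier M" "a \<in> J"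
      then have a: "a \<in> carrier R" using J by auto
      have "\<pi> x \<triangleleft>\<^bsub>L\<^esub> h a \<in> ?V"
        using reduction_closed[OF assms(1) x(1)] x(2) by (intro rmod_prod_smult) auto
      then show "x \<triangleleft>\<^bsub>M\<^esub> a \<in> {x \<in> carrier M. \<pi> x \<in> ?V}"
        using reduction_smult[OF assms(1) x(1) a] M.rsmult_closed[OF x(1) a] by simp
    qed
    then show "\<pi> ` ?U \<subseteq> ?V" by blast
    show "?V \<subseteq> \<pi> ` ?U"
    proof (rule rmod_prod_subset_submodule[OF L submodule_reduction_image[OF assms(1) U] order_refl hJ'])
      fix l b assume "l \<in> carrier L" "b \<in> h ` J"
      then have "l \<in> \<pi> ` carrier M" "b \<in> h ` J" using reductionD(4)[OF assms(1)] by simp_all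
      then obtain x a where x: "x \<in> carrier M" "l = \<pi> x" "a \<in> J" "b = h a"
        by blast
      then have "l \<triangleleft>\<^bsub>L\<^esub> b = \<pi> (x \<triangleleft>\<^bsub>M\<^esub> a)" using reduction_smult[OF assms(1) x(1)] J by auto
      then show "l \<triangleleft>\<^bsub>L\<^esub> b \<in> \<pi> ` ?U"
        using rmod_prod_smult[OF x(1,3)] by blast
    qed
  qed
qed

lemma relatively_big_reduction:
  assumes T: "right_T_nilpotent R N" and "countably_projective R P" "reduction P L \<pi>"
  shows "relatively_big R P \<longleftrightarrow> relatively_big S L"
proof -
  note cP = assms(2) and red = assms(3)
  have cL: "countably_projective S L" by (rule countably_projective_reduction[OF cP red])
  have quot: "finitely_generated R (rmod_quot P (rmod_prod P (carrier P) (trace_ideal R P'))) \<longleftrightarrow>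
      finitely_generated S (rmod_quot L (rmod_prod L (carrier L) (trace_ideal S Q)))"
    if "countably_projective R P'" "reduction P' Q \<pi>'"
    for P' :: "'a seq_module" and Q :: "'b seq_module" and \<pi>'
  proof -
    note J = submodule_trace_ideal[OF countably_projective_module[OF that(1)]]
    show ?thesis
      unfolding trace_ideal_reduction[OF that]
      using finitely_generated_quot_reduction[OF T red reduction_image_prod(2,3,1)[OF red J]] .
  qed
  have power: "reduction (rmod_sum P (rmod_power (UNIV :: nat set) P')) (rmod_sum L (rmod_power UNIV Q))
      (\<lambda>(x, y). (\<pi> x, \<lambda>i\<in>UNIV. \<pi>' (y i)))"
    if "reduction P' Q \<pi>'" for P' :: "'a seq_module" and Q :: "'b seq_module" and \<pi>'
    using reduction_sum[OF red reduction_power[OF that]] .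
  show ?thesis
  proof
    assume "relatively_big R P"
    then obtain P' :: "'a seq_module" where P': "countably_projective R P'"
      "rmod_isomorphic R (rmod_sum P (rmod_power (UNIV :: nat set) P')) P"
      "finitely_generated R (rmod_quot P (rmod_prod P (carrier P) (trace_ideal R P')))"
      unfolding relatively_big_def projective_countably_generated_iff[symmetric] by blast
    obtain Q :: "'b seq_module" and \<pi>' where Q: "reduction P' Q \<pi>'"
      using reduction_exists[OF P'(1)] by blast
    have "rmod_isomorphic S (rmod_sum L (rmod_power (UNIV :: nat set) Q)) L"
      by (rule reduction_isomorphic[OF power[OF Q] red P'(2)])
    then show "relatively_big S L"
      using cL countably_projective_reduction[OF P'(1) Q] quot[OF P'(1) Q] P'(3)
      unfolding relatively_big_def projective_countably_generated_iff[symmetric] by blast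
  next
    assume "relatively_big S L"
    then obtain Q :: "'b seq_module" where Q: "countably_projective S Q"
      "rmod_isomorphic S (rmod_sum L (rmod_power (UNIV :: nat set) Q)) L"
      "finitely_generated S (rmod_quot L (rmod_prod L (carrier L) (trace_ideal S Q)))"
      unfolding relatively_big_def projective_countably_generated_iff[symmetric] by blast
    obtain P' :: "'a seq_module" and \<pi>' where P': "countably_projective R P'" "reduction P' Q \<pi>'"
      using lift_countably_projective[OF T Q(1)] by blast
    have "rmod_isomorphic R (rmod_sum P (rmod_power (UNIV :: nat set) P')) P"
      by (rule isomorphic_if_reductions_isomorphic[OF T
            countably_projective_sum[OF cP countably_projective_power[OF P'(1)]] cP power[OF P'(2)] red Q(2)])
    then show "relatively_big R P"
      using cP P'(1) quot[OF P'] Q(3)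
      unfolding relatively_big_def projective_countably_generated_iff[symmetric] by blast
  qed
qed

end

section \<open>Quotients and extension of scalars\<close>

lemma surjective_ring_hom_quotient:
  assumes "ring R" "ideal N R" shows "surjective_ring_hom R (R Quot N) ((+>\<^bsub>R\<^esub>) N) N"
proof -
  interpret N: ideal N R by fact
  show ?thesis
  proof (rule surjective_ring_hom.intro)
    show "(+>\<^bsub>R\<^esub>) N ` carrier R = carrier (R Quot N)" by (auto simp: FactRing_def A_RCOSETS_def')
    show "N +>\<^bsub>R\<^esub> a = \<zero>\<^bsub>R Quot N\<^esub> \<longleftrightarrow> a \<in> N" if "a \<in> carrier R" for a
      using N.a_rcos_self[OF that] N.a_rcos_const by (auto simp: FactRing_def)
  qed (rule assms N.quotient_is_ring N.rcos_ring_hom)+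
qed

lemma reduction_rmod_reduction:
  fixes M (structure)
  assumes "right_module R M" "ideal N R"
  shows "surjective_ring_hom.reduction R (R Quot N) ((+>\<^bsub>R\<^esub>) N) N M (rmod_reduction M N)
    ((+>) (rmod_prod M (carrier M) N))"
proof -
  interpret right_module R M by fact
  interpret N: ideal N R by fact
  interpret surjective_ring_hom R "R Quot N" "(+>\<^bsub>R\<^esub>) N" N
    by (rule surjective_ring_hom_quotient[OF R.ring_axioms assms(2)])
  define H where "H = rmod_prod M (carrier M) N"
  have H: "submodule R M H" unfolding H_def by (rule submodule_prod_ideal[OF assms])
  interpret H: abelian_subgroup H M by (rule submodule_abelian_subgroup[OF assms(1) H])
  have HM: "x \<in> carrier M" if "x \<in> H" for x using that H by (auto simp: submodule_def)
  let ?Q = "rmod_reduction M N"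
  have Q: "carrier ?Q = a_rcosets H" "\<zero>\<^bsub>?Q\<^esub> = H" "\<And>X Y. X \<oplus>\<^bsub>?Q\<^esub> Y = X <+> Y"
    "\<And>X A. X \<triangleleft>\<^bsub>?Q\<^esub> A = (\<Union>x\<in>X. \<Union>a\<in>A. H +> (x \<triangleleft> a))"
    by (simp_all add: rmod_reduction_def Let_def H_def)
  have surj: "(+>) H ` carrier M = carrier ?Q" by (auto simp: Q A_RCOSETS_def')
  have add: "H +> (x \<oplus> y) = (H +> x) \<oplus>\<^bsub>?Q\<^esub> (H +> y)"
    if "x \<in> carrier M" "y \<in> carrier M" for x y
    using H.a_rcos_sum that by (simp add: Q)
  have smult: "H +> (x \<triangleleft> a) = (H +> x) \<triangleleft>\<^bsub>?Q\<^esub> (N +>\<^bsub>R\<^esub> a)"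
    if x: "x \<in> carrier M" and a: "a \<in> carrier R" for x a
  proof -
    \<comment> \<open>For \<open>y = z + x\<close> and \<open>b = n + a\<close>, \<open>y b = (z b + x n) + x a\<close>, and the bracket lies in \<open>H = MN\<close>.\<close>
    have const: "H +> (y \<triangleleft> b) = H +> (x \<triangleleft> a)"
      if y: "y \<in> H +> x" and b: "b \<in> N +>\<^bsub>R\<^esub> a" for y b
    proof -
      obtain z where z: "z \<in> H" "y = z \<oplus> x" using y by (auto simp: a_r_coset_def')
      obtain n where n: "n \<in> N" "b = n \<oplus>\<^bsub>R\<^esub> a" using b by (auto simp: a_r_coset_def')
      have nR: "n \<in> carrier R" by (rule N.a_Hcarr[OF n(1)])
      then have bR: "b \<in> carrier R" using n(2) a by simp
      have "z \<triangleleft> b \<in> H" using z(1) bR H by (simp add: submodule_def)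
      moreover have "x \<triangleleft> n \<in> H" unfolding H_def using x n(1) by (rule rmod_prod_smult)
      ultimately have w: "z \<triangleleft> b \<oplus> x \<triangleleft> n \<in> H" using H by (simp add: submodule_def)
      have "y \<triangleleft> b = z \<triangleleft> b \<oplus> x \<triangleleft> b"
        unfolding z(2) by (rule rsmult_l_distr[OF HM[OF z(1)] x bR])
      also have "x \<triangleleft> b = x \<triangleleft> n \<oplus> x \<triangleleft> a"
        unfolding n(2) by (rule rsmult_r_distr[OF x nR a])
      finally have "y \<triangleleft> b = (z \<triangleleft> b \<oplus> x \<triangleleft> n) \<oplus> x \<triangleleft> a"
        using x a bR nR HM[OF z(1)] by (simp add: M.a_assoc rsmult_closed)
      then have "y \<triangleleft> b \<in> H +> (x \<triangleleft> a)" using w by (auto simp: a_r_coset_def')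
      from H.a_repr_independence'[OF this rsmult_closed[OF x a]] show ?thesis by simp
    qed
    have "(\<Union>b\<in>N +>\<^bsub>R\<^esub> a. H +> (y \<triangleleft> b)) = H +> (x \<triangleleft> a)" if "y \<in> H +> x" for y
      using const[OF that] by (intro UN_constant_eq[OF N.a_rcos_self[OF a]] ballI)
    then have "(\<Union>y\<in>H +> x. \<Union>b\<in>N +>\<^bsub>R\<^esub> a. H +> (y \<triangleleft> b)) = H +> (x \<triangleleft> a)"
      by (intro UN_constant_eq[OF H.a_rcos_self[OF x]] ballI)
    then show ?thesis by (simp add: Q)
  qed
  have zero: "H +> \<zero> = \<zero>\<^bsub>?Q\<^esub>" using M.a_coset_add_zero[of H] H by (simp add: submodule_def Q)
  have "right_module (R Quot N) ?Q"
    by (rule right_module_image[OF ring_S assms(1) hom_h surj_h surj zero add smult])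
  moreover have "(+>) H \<in> rmod_hom R M (restrict_scalars ((+>\<^bsub>R\<^esub>) N) ?Q)"
    by (rule rmod_homI) (use surj add smult in auto)
  moreover have "x \<in> H" if "x \<in> carrier M" "H +> x = \<zero>\<^bsub>?Q\<^esub>" for x
    using H.a_rcos_self[OF that(1)] that(2) by (simp add: Q)
  ultimately show ?thesis
    unfolding reduction_def H_def[symmetric] using assms(1) surj by blast
qed

lemma tensor_relatorsE:
  assumes "u \<in> tensor_relators R S h M"
  obtains (add_left) x y s where "u = frag_of (x \<oplus>\<^bsub>M\<^esub> y, s) - frag_of (x, s) - frag_of (y, s)"
      "x \<in> carrier M" "y \<in> carrier M" "s \<in> carrier S"
    | (add_right) x s s' where "u = frag_of (x, s \<oplus>\<^bsub>S\<^esub> s') - frag_of (x, s) - frag_of (x, s')"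
      "x \<in> carrier M" "s \<in> carrier S" "s' \<in> carrier S"
    | (balanced) x a s where "u = frag_of (x \<triangleleft>\<^bsub>M\<^esub> a, s) - frag_of (x, h a \<otimes>\<^bsub>S\<^esub> s)"
      "x \<in> carrier M" "a \<in> carrier R" "s \<in> carrier S"
  using assms unfolding tensor_relators_def by blast

context surjective_ring_hom
begin

text \<open>The isomorphism is induced by \<open>x \<mapsto> x \<otimes> 1\<close>, which is onto since \<open>x \<otimes> h a = x a \<otimes> 1\<close>. It is
  injective because \<open>(x, s) \<mapsto> \<pi>(x) s\<close> respects the relations of the tensor product, so that
  \<open>x \<otimes> 1 = 0\<close> forces \<open>\<pi>(x) = 0\<close>.\<close>

lemma reduction_isomorphic_extend_scalars:
  fixes M (structure)
  assumes "reduction M L \<pi>"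
  shows "rmod_isomorphic S L (extend_scalars R S h M)"
proof -
  note mod_M = reductionD(1)[OF assms] and mod_L = reductionD(2)[OF assms]
  interpret M: right_module R M by (rule mod_M)
  interpret L: right_module S L by (rule mod_L)
  define F where "F = free_Abelian_group (carrier M \<times> carrier S)"
  define K where "K = generate F (tensor_relators R S h M)"
  let ?E = "extend_scalars R S h M"
  let ?m = "\<lambda>t. frag_extend (\<lambda>(x, s). frag_of (x, s \<otimes>\<^bsub>S\<^esub> t))"
  have E: "carrier ?E = rcosets\<^bsub>F\<^esub> K" "\<zero>\<^bsub>?E\<^esub> = K" "\<And>X Y. X \<oplus>\<^bsub>?E\<^esub> Y = X <#>\<^bsub>F\<^esub> Y"
    "\<And>X t. X \<triangleleft>\<^bsub>?E\<^esub> t = (\<Union>c\<in>X. K #>\<^bsub>F\<^esub> ?m t c)"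
    by (simp_all add: extend_scalars_def Let_def F_def K_def)
  interpret F: comm_group F unfolding F_def by (rule abelian_free_Abelian_group)
  have F_simps: "\<one>\<^bsub>F\<^esub> = 0" "\<And>x y. x \<otimes>\<^bsub>F\<^esub> y = x + y" by (simp_all add: F_def)
  have inv_F: "inv\<^bsub>F\<^esub> x = - x" if "x \<in> carrier F" for x using that by (simp add: F_def)
  have frag_F: "frag_of (x, s) \<in> carrier F" if "x \<in> carrier M" "s \<in> carrier S" for x s
    using that by (simp add: F_def)
  have F_diff: "u - v \<in> carrier F" if "u \<in> carrier F" "v \<in> carrier F" for u v
    using F.m_closed[OF that(1) F.inv_closed[OF that(2)]] by (simp add: inv_F[OF that(2)] F_simps)
  have rel_F: "tensor_relators R S h M \<subseteq> carrier F"
    using frag_F ring_hom_closed[OF hom_h] L.R.a_closed L.R.m_closed F_diff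
    by (auto simp: tensor_relators_def M.rsmult_closed)
  have K: "subgroup K F" unfolding K_def by (rule F.generate_is_subgroup[OF rel_F])
  interpret K: normal K F by (rule F.subgroup_imp_normal[OF K])
  have K_F: "u \<in> carrier F" if "u \<in> K" for u using that K.subset by blast
  have K_zero: "0 \<in> K" using K.one_closed by (simp add: F_simps)
  have K_add: "u + v \<in> K" if "u \<in> K" "v \<in> K" for u v using K.m_closed[OF that] by (simp add: F_simps)
  have K_uminus: "- u \<in> K" if "u \<in> K" for u
    using K.m_inv_closed[OF that] by (simp add: inv_F[OF K_F[OF that]])
  have K_diff: "u - v \<in> K" if "u \<in> K" "v \<in> K" for u v using K_add[OF that(1) K_uminus[OF that(2)]] by simp
  have K_rel: "u \<in> K" if "u \<in> tensor_relators R S h M" for u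
    unfolding K_def using that by (rule generate.incl)
  have rel_add_left: "frag_of (x \<oplus> y, s) - frag_of (x, s) - frag_of (y, s) \<in> K"
    if "x \<in> carrier M" "y \<in> carrier M" "s \<in> carrier S" for x y s
    using that by (intro K_rel) (auto simp: tensor_relators_def)
  have rel_smult: "frag_of (x \<triangleleft> a, s) - frag_of (x, h a \<otimes>\<^bsub>S\<^esub> s) \<in> K"
    if "x \<in> carrier M" "a \<in> carrier R" "s \<in> carrier S" for x a s
    using that by (intro K_rel) (auto simp: tensor_relators_def)
  have coset_eq: "K #>\<^bsub>F\<^esub> u = K #>\<^bsub>F\<^esub> v" if "u - v \<in> K" "u \<in> carrier F" "v \<in> carrier F" for u v
  proof -
    have "u \<in> K #>\<^bsub>F\<^esub> v" using that(1) by (auto simp: r_coset_def F_simps intro!: bexI[of _ "u - v"])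
    then show ?thesis using F.repr_independence[OF _ that(3) K] by simp
  qed
  let ?one = "\<one>\<^bsub>S\<^esub>"
  have one: "?one \<in> carrier S" by (rule L.R.one_closed)
  define \<gamma> where "\<gamma> x = K #>\<^bsub>F\<^esub> frag_of (x, ?one)" for x
  have rel: "?m t u \<in> tensor_relators R S h M" if t: "t \<in> carrier S" and u: "u \<in> tensor_relators R S h M" for t u
  proof -
    have tc: "s \<otimes>\<^bsub>S\<^esub> t \<in> carrier S" if "s \<in> carrier S" for s
      using that t by (rule L.R.m_closed)
    from u show ?thesis
    proof (cases rule: tensor_relatorsE)
      case (add_left x y s)
      then have "?m t u = frag_of (x \<oplus> y, s \<otimes>\<^bsub>S\<^esub> t) - frag_of (x, s \<otimes>\<^bsub>S\<^esub> t) - frag_of (y, s \<otimes>\<^bsub>S\<^esub> t)"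
        by (simp add: frag_extend_diff)
      then show ?thesis using add_left tc unfolding tensor_relators_def by blast
    next
      case (add_right x s s')
      then have "?m t u = frag_of (x, (s \<otimes>\<^bsub>S\<^esub> t) \<oplus>\<^bsub>S\<^esub> (s' \<otimes>\<^bsub>S\<^esub> t)) - frag_of (x, s \<otimes>\<^bsub>S\<^esub> t) - frag_of (x, s' \<otimes>\<^bsub>S\<^esub> t)"
        using t by (simp add: frag_extend_diff L.R.l_distr)
      then show ?thesis using add_right tc unfolding tensor_relators_def by blast
    next
      case (balanced x a s)
      then have "?m t u = frag_of (x \<triangleleft> a, s \<otimes>\<^bsub>S\<^esub> t) - frag_of (x, h a \<otimes>\<^bsub>S\<^esub> (s \<otimes>\<^bsub>S\<^esub> t))"
        using t ring_hom_closed[OF hom_h] by (simp add: frag_extend_diff L.R.m_assoc)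
      then show ?thesis using balanced tc unfolding tensor_relators_def by blast
    qed
  qed
  have K_mult: "?m t u \<in> K" if t: "t \<in> carrier S" and u: "u \<in> K" for t u
    using u unfolding K_def
  proof (induction rule: generate.induct)
    case one
    then show ?case using K_zero by (simp add: F_simps K_def)
  next
    case (incl u)
    then show ?case using rel[OF t] K_rel by (simp add: K_def)
  next
    case (inv u)
    then show ?case
      using K_uminus[OF K_rel[OF rel[OF t]]] rel_F inv_F[of u] by (auto simp: frag_extend_minus K_def)
  next
    case (eng u v)
    then show ?case using K_add by (simp add: F_simps frag_extend_add K_def)
  qed
  have m_F: "?m t u \<in> carrier F" if "t \<in> carrier S" "u \<in> carrier F" for t u
  proof -
    have "Poly_Mapping.keys u \<subseteq> carrier M \<times> carrier S" using that(2) by (simp add: F_def)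
    then show ?thesis
    proof (induction u rule: frag_induction)
      case zero
      show ?case using F.one_closed by (simp add: F_simps)
    next
      case (one z)
      then show ?case using that(1) by (cases z) (simp add: frag_F)
    next
      case (diff u v)
      then show ?case using F_diff by (simp add: frag_extend_diff)
    qed
  qed
  have coset_mult: "(K #>\<^bsub>F\<^esub> u) \<triangleleft>\<^bsub>?E\<^esub> t = K #>\<^bsub>F\<^esub> ?m t u" if t: "t \<in> carrier S" and u: "u \<in> carrier F" for t u
    unfolding E(4)
  proof (intro UN_constant_eq[OF F.rcos_self[OF u K]] ballI)
    fix c assume "c \<in> K #>\<^bsub>F\<^esub> u"
    then obtain k where k: "k \<in> K" "c = k + u" by (auto simp: r_coset_def F_simps)
    then have c: "c \<in> carrier F" using F.m_closed[OF K_F[OF k(1)] u] by (simp add: F_simps)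
    show "K #>\<^bsub>F\<^esub> ?m t c = K #>\<^bsub>F\<^esub> ?m t u"
      by (rule coset_eq) (use K_mult[OF t k(1)] k(2) m_F[OF t c] m_F[OF t u] in \<open>simp_all add: frag_extend_add\<close>)
  qed
  have \<gamma>_add: "\<gamma> (x \<oplus> y) = \<gamma> x \<oplus>\<^bsub>?E\<^esub> \<gamma> y" if x: "x \<in> carrier M" and y: "y \<in> carrier M" for x y
  proof -
    have "frag_of (x, ?one) + frag_of (y, ?one) \<in> carrier F"
      using F.m_closed[OF frag_F[OF x one] frag_F[OF y one]] by (simp add: F_simps)
    then have "\<gamma> (x \<oplus> y) = K #>\<^bsub>F\<^esub> (frag_of (x, ?one) + frag_of (y, ?one))"
      unfolding \<gamma>_def using rel_add_left[OF x y one] frag_F[OF M.M.a_closed[OF x y] one]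
      by (intro coset_eq) (simp_all add: diff_diff_eq)
    then show ?thesis
      using K.rcos_sum[OF frag_F[OF x one] frag_F[OF y one]] by (simp add: E(3) \<gamma>_def F_simps)
  qed
  have \<gamma>_smult: "\<gamma> (x \<triangleleft> a) = \<gamma> x \<triangleleft>\<^bsub>?E\<^esub> h a" if x: "x \<in> carrier M" and a: "a \<in> carrier R" for x a
  proof -
    have ha: "h a \<in> carrier S" by (rule ring_hom_closed[OF hom_h a])
    have "\<gamma> (x \<triangleleft> a) = K #>\<^bsub>F\<^esub> frag_of (x, h a)"
      unfolding \<gamma>_def using rel_smult[OF x a one] frag_F[OF M.rsmult_closed[OF x a] one] frag_F[OF x ha] ha
      by (intro coset_eq) simp_all
    then show ?thesis using coset_mult[OF ha frag_F[OF x one]] ha by (simp add: \<gamma>_def)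
  qed
  have \<gamma>_zero: "\<gamma> \<zero> = \<zero>\<^bsub>?E\<^esub>"
  proof -
    have "- frag_of (\<zero>, ?one) \<in> K"
      using rel_add_left[OF M.M.zero_closed M.M.zero_closed one] by simp
    then have "frag_of (\<zero>, ?one) \<in> K" using K_uminus by fastforce
    then show ?thesis unfolding \<gamma>_def E(2) by (rule K.rcos_const[OF F.is_group])
  qed
  have rep: "\<exists>x\<in>carrier M. c - frag_of (x, ?one) \<in> K" if "Poly_Mapping.keys c \<subseteq> carrier M \<times> carrier S" for c
    using that
  proof (induction c rule: frag_induction)
    case zero
    show ?case
      using rel_add_left[OF M.M.zero_closed M.M.zero_closed one] M.M.zero_closed by force
  next
    case (one z)
    then obtain x s where z: "z = (x, s)" "x \<in> carrier M" "s \<in> carrier S" by auto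
    then obtain a where a: "a \<in> carrier R" "s = h a" using surj_h by (metis imageE)
    have "- (frag_of (x \<triangleleft> a, ?one) - frag_of (x, h a \<otimes>\<^bsub>S\<^esub> ?one)) \<in> K"
      by (rule K_uminus[OF rel_smult[OF z(2) a(1) \<open>?one \<in> carrier S\<close>]])
    then have "frag_of z - frag_of (x \<triangleleft> a, ?one) \<in> K" using z(3) a(2) by (simp add: z(1))
    then show ?case using M.rsmult_closed[OF z(2) a(1)] by blast
  next
    case (diff c d)
    then obtain x y where xy: "x \<in> carrier M" "c - frag_of (x, ?one) \<in> K" "y \<in> carrier M" "d - frag_of (y, ?one) \<in> K"
      by blast
    have m: "x \<ominus> y \<in> carrier M" using xy by simp
    have "frag_of (x, ?one) - frag_of (x \<ominus> y, ?one) - frag_of (y, ?one) \<in> K"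
      using rel_add_left[OF m xy(3) one] M.minus_add_cancel[OF xy(1,3)] by simp
    from K_add[OF K_diff[OF xy(2,4)] this]
    have "(c - d) - frag_of (x \<ominus> y, ?one) \<in> K" by (simp add: algebra_simps)
    then show ?case using m by blast
  qed
  have surj: "\<gamma> ` carrier M = carrier ?E"
  proof (intro equalityI subsetI)
    fix X assume "X \<in> \<gamma> ` carrier M"
    then show "X \<in> carrier ?E" using frag_F one by (auto simp: E(1) \<gamma>_def RCOSETS_def)
  next
    fix X assume "X \<in> carrier ?E"
    then obtain c where c: "c \<in> carrier F" "X = K #>\<^bsub>F\<^esub> c" by (auto simp: E(1) RCOSETS_def)
    then obtain x where x: "x \<in> carrier M" "c - frag_of (x, ?one) \<in> K" using rep[of c] by (auto simp: F_def)
    then have "X = \<gamma> x" unfolding c(2) \<gamma>_def using frag_F one c(1) by (intro coset_eq) auto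
    then show "X \<in> \<gamma> ` carrier M" using x(1) by blast
  qed
  have mod_E: "right_module S ?E"
    by (rule right_module_image[OF ring_S mod_M hom_h surj_h surj \<gamma>_zero \<gamma>_add \<gamma>_smult])
  have "\<gamma> \<in> rmod_hom R M (restrict_scalars h ?E)"
    by (rule rmod_homI) (use surj \<gamma>_add \<gamma>_smult in auto)
  then obtain g where g: "g \<in> rmod_hom S L ?E" "\<And>x. x \<in> carrier M \<Longrightarrow> g (\<pi> x) = \<gamma> x"
    using reduction_factor[OF assms mod_E] by blast
  have "(\<lambda>(x, s). \<pi> x \<triangleleft>\<^bsub>L\<^esub> s) ` (carrier M \<times> carrier S) \<subseteq> carrier (add_monoid L)"
    using reduction_closed[OF assms] by (auto intro!: L.rsmult_closed)
  from comm_group.free_Abelian_group_universal[OF L.M.a_comm_group this] obtain B where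
    B: "B \<in> hom F (add_monoid L)" "\<And>z. z \<in> carrier M \<times> carrier S \<Longrightarrow> B (frag_of z) = (case z of (x, s) \<Rightarrow> \<pi> x \<triangleleft>\<^bsub>L\<^esub> s)"
    unfolding F_def by blast
  interpret B: group_hom F "add_monoid L" B
    by (rule group_hom.intro[OF F.is_group L.M.a_group]) (unfold_locales, rule B(1))
  have B_add: "B (u + v) = B u \<oplus>\<^bsub>L\<^esub> B v" if "u \<in> carrier F" "v \<in> carrier F" for u v
    using B.hom_mult[OF that] by (simp add: F_simps)
  have B_frag: "B (frag_of (x, s)) = \<pi> x \<triangleleft>\<^bsub>L\<^esub> s" "B (frag_of (x, s)) \<in> carrier L"
    if "x \<in> carrier M" "s \<in> carrier S" for x s
    using B(2)[of "(x, s)"] that reduction_closed[OF assms] L.rsmult_closed by auto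
  have B_diff: "B (u - v) = B u \<ominus>\<^bsub>L\<^esub> B v" if "u \<in> carrier F" "v \<in> carrier F" for u v
    using B_add[OF that(1) F.inv_closed[OF that(2)]] B.hom_inv[OF that(2)]
    by (simp add: inv_F[OF that(2)] a_minus_def a_inv_def)
  have cancel: "(u \<oplus>\<^bsub>L\<^esub> v) \<ominus>\<^bsub>L\<^esub> u \<ominus>\<^bsub>L\<^esub> v = \<zero>\<^bsub>L\<^esub>" if "u \<in> carrier L" "v \<in> carrier L" for u v
    using that by (simp add: a_minus_def L.M.a_comm[of u v] L.M.a_assoc L.M.r_neg)
  have B_rel: "B u = \<zero>\<^bsub>L\<^esub>" if u: "u \<in> tensor_relators R S h M" for u
  proof -
    note cl = reduction_closed[OF assms] L.rsmult_closed
    from u show ?thesis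
    proof (cases rule: tensor_relatorsE)
      case (add_left x y s)
      then show ?thesis
        by (simp add: B_diff frag_F F_diff B_frag(1) reduction_add[OF assms] L.rsmult_l_distr cl cancel)
    next
      case (add_right x s s')
      then show ?thesis
        by (simp add: B_diff frag_F F_diff B_frag(1) L.rsmult_r_distr cl cancel)
    next
      case (balanced x a s)
      have ha: "h a \<in> carrier S" by (rule ring_hom_closed[OF hom_h balanced(3)])
      have "B u = \<pi> x \<triangleleft>\<^bsub>L\<^esub> h a \<triangleleft>\<^bsub>L\<^esub> s \<ominus>\<^bsub>L\<^esub> \<pi> x \<triangleleft>\<^bsub>L\<^esub> h a \<triangleleft>\<^bsub>L\<^esub> s"
        using balanced ha
        by (simp add: B_diff frag_F M.rsmult_closed B_frag(1) reduction_smult[OF assms] L.rsmult_assoc cl)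
      then show ?thesis using balanced ha by (simp add: a_minus_def L.M.r_neg cl)
    qed
  qed
  have B_K: "B u = \<zero>\<^bsub>L\<^esub>" if "u \<in> K" for u
    using that unfolding K_def
  proof (induction rule: generate.induct)
    case one
    then show ?case using B.hom_one by simp
  next
    case (incl u)
    then show ?case by (rule B_rel)
  next
    case (inv u)
    then have "u \<in> carrier F" using rel_F by blast
    from B.hom_inv[OF this] show ?case using B_rel[OF inv] by (simp add: a_inv_def[symmetric])
  next
    case (eng u v)
    then have "u \<in> carrier F" "v \<in> carrier F" using K_F by (auto simp: K_def)
    then show ?case using B.hom_mult[of u v] eng by simp
  qed
  have "inj_on g (carrier L)"
  proof (rule rmod_hom_inj_on[OF mod_L mod_E g(1)])
    fix l assume l: "l \<in> carrier L" "g l = \<zero>\<^bsub>?E\<^esub>"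
    obtain x where x: "x \<in> carrier M" "l = \<pi> x" using l(1) reductionD(4)[OF assms] by auto
    have "K #>\<^bsub>F\<^esub> frag_of (x, ?one) = K" using l(2) g(2)[OF x(1)] x(2) by (simp add: \<gamma>_def E(2))
    then have "frag_of (x, ?one) \<in> K" using F.rcos_self[OF frag_F[OF x(1) one] K] by simp
    from B_K[OF this] have "\<pi> x \<triangleleft>\<^bsub>L\<^esub> ?one = \<zero>\<^bsub>L\<^esub>" using B_frag(1)[OF x(1) one] by simp
    then show "l = \<zero>\<^bsub>L\<^esub>" using l(1) x(2) by (simp add: L.rsmult_one)
  qed
  moreover have "g ` carrier L = carrier ?E"
    unfolding reductionD(4)[OF assms, symmetric] surj[symmetric] using g(2) by (auto simp: image_image)
  ultimately show ?thesis using g(1) by (auto simp: rmod_isomorphic_def bij_betw_def)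
qed

end

section \<open>The monoids of isomorphism classes\<close>

lemma iso_class_eq:
  assumes "right_module R M" "rmod_isomorphic R M M'" shows "iso_class R M = iso_class R M'"
  using rmod_isomorphic_trans[OF _ assms(2)] rmod_isomorphic_trans[OF _ rmod_isomorphic_sym[OF assms]]
  unfolding iso_class_def by blast

lemma rmod_isomorphic_sum:
  assumes "rmod_isomorphic R M M'" "rmod_isomorphic R L L'"
  shows "rmod_isomorphic R (rmod_sum M L) (rmod_sum M' L')"
proof -
  obtain f where f: "f \<in> rmod_hom R M M'" "bij_betw f (carrier M) (carrier M')"
    using assms(1) by (auto simp: rmod_isomorphic_def)
  obtain g where g: "g \<in> rmod_hom R L L'" "bij_betw g (carrier L) (carrier L')"
    using assms(2) by (auto simp: rmod_isomorphic_def)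
  have "map_prod f g \<in> rmod_hom R (rmod_sum M L) (rmod_sum M' L')"
    by (rule rmod_homI)
       (auto simp: rmod_hom_closed[OF f(1)] rmod_hom_closed[OF g(1)] rmod_hom_add[OF f(1)]
          rmod_hom_add[OF g(1)] rmod_hom_smult[OF f(1)] rmod_hom_smult[OF g(1)])
  moreover have "bij_betw (map_prod f g) (carrier (rmod_sum M L)) (carrier (rmod_sum M' L'))"
    using bij_betw_map_prod[OF f(2) g(2)] by simp
  ultimately show ?thesis by (auto simp: rmod_isomorphic_def)
qed

lemma Vstar_monoid_mult:
  fixes P Q :: "'a seq_module"
  assumes "right_module R P" "right_module R Q"
  shows "iso_class R P \<otimes>\<^bsub>Vstar_monoid R\<^esub> iso_class R Q = iso_class R (rmod_sum P Q)"
proof -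
  have self: "P \<in> iso_class R P" "Q \<in> iso_class R Q"
    using assms rmod_isomorphic_refl by (auto simp: iso_class_def)
  have const: "iso_class R (rmod_sum P' Q') = iso_class R (rmod_sum P Q)"
    if "P' \<in> iso_class R P" "Q' \<in> iso_class R Q" for P' Q'
    using that by (intro iso_class_eq right_module_sum rmod_isomorphic_sum) (auto simp: iso_class_def)
  have "(\<Union>Q'\<in>iso_class R Q. iso_class R (rmod_sum P' Q')) = iso_class R (rmod_sum P Q)"
    if "P' \<in> iso_class R P" for P'
    using const[OF that] by (intro UN_constant_eq[OF self(2)] ballI)
  then have "(\<Union>P'\<in>iso_class R P. \<Union>Q'\<in>iso_class R Q. iso_class R (rmod_sum P' Q')) =
      iso_class R (rmod_sum P Q)"
    by (intro UN_constant_eq[OF self(1)] ballI)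
  then show ?thesis by (simp add: Vstar_monoid_def)
qed

lemma countably_generated_if_finitely_generated:
  "finitely_generated R M \<Longrightarrow> countably_generated R M"
  unfolding finitely_generated_def countably_generated_def by (meson countable_finite)

lemma carrier_Vstar_monoid:
  "carrier (Vstar_monoid R) =
    {iso_class R P | P :: 'a seq_module. countably_projective R P \<and> True}"
  for R :: "('a, 'r) ring_scheme"
  by (simp add: Vstar_monoid_def projective_countably_generated_iff)

lemma fg_projective_classes_eq:
  "fg_projective_classes R =
    {iso_class R P | P :: 'a seq_module. countably_projective R P \<and> finitely_generated R P}"
  for R :: "('a, 'r) ring_scheme"
  unfolding fg_projective_classes_def projective_countably_generated_iff[symmetric]
  using countably_generated_if_finitely_generated by (metis (no_types, lifting))

lemma big_projective_classes_eq:
  "big_projective_classes R = {iso_class R P | P :: 'a seq_module.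
    countably_projective R P \<and> relatively_big R P \<and> \<not> finitely_generated R P}"
  for R :: "('a, 'r) ring_scheme"
  unfolding big_projective_classes_def projective_countably_generated_iff[symmetric] relatively_big_def
  by blast

text \<open>The submonoids inherit their operations from the ambient monoid, so only the carriers have to be
  matched.\<close>

lemma monoid_iso_restrict:
  assumes "f \<in> monoid_iso G H" "A \<subseteq> carrier G" "f ` A = B"
  shows "f \<in> monoid_iso (G\<lparr>carrier := A\<rparr>) (H\<lparr>carrier := B\<rparr>)"
proof -
  have "f \<in> hom G H" "inj_on f (carrier G)" "f \<one>\<^bsub>G\<^esub> = \<one>\<^bsub>H\<^esub>"
    using assms(1) by (auto simp: monoid_iso_def iso_def bij_betw_def)
  then show ?thesis
    using assms(2,3) inj_on_subset[of f "carrier G" A]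
    by (auto simp: monoid_iso_def iso_def bij_betw_def hom_def subset_iff)
qed

text \<open>Isomorphic modules have isomorphic reductions, so the union over the class of \<open>P\<close> is the single
  class of \<open>P/PN\<close>.\<close>

definition reduction_class ::
    "('a, 'r) ring_scheme \<Rightarrow> 'a set \<Rightarrow> 'a rmod_class \<Rightarrow> 'a set rmod_class"
  where "reduction_class R N X = (\<Union>P\<in>X. iso_class (R Quot N) (rmod_reduction P N))"

context
  fixes R :: "('a, 'r) ring_scheme" and N :: "'a set"
  assumes ring: "ring R" and ideal: "ideal N R" and T_nilpotent: "right_T_nilpotent R N"
begin

interpretation surjective_ring_hom R "R Quot N" "(+>\<^bsub>R\<^esub>) N" N
  by (rule surjective_ring_hom_quotient[OF ring ideal])

lemma reduction_class_eq:
  assumes "countably_projective R M" "reduction M L \<pi>"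
  shows "reduction_class R N (iso_class R M) = iso_class (R Quot N) L"
proof -
  obtain P :: "'a seq_module" where P: "countably_projective R P" "rmod_isomorphic R M P"
    using countably_projective_copy[OF assms(1)] by blast
  have "P \<in> iso_class R M"
    using P rmod_isomorphic_sym[OF countably_projective_module[OF assms(1)] P(2)]
      countably_projective_module by (auto simp: iso_class_def)
  moreover have "iso_class (R Quot N) (rmod_reduction P' N) = iso_class (R Quot N) L"
    if "P' \<in> iso_class R M" for P'
  proof -
    have P': "right_module R P'" "rmod_isomorphic R P' M" using that by (auto simp: iso_class_def)
    note red = reduction_rmod_reduction[OF P'(1) ideal]
    show ?thesis
      by (rule iso_class_eq[OF reductionD(2)[OF red] reduction_isomorphic[OF red assms(2) P'(2)]])
  qed
  ultimately show ?thesis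
    unfolding reduction_class_def by (intro UN_constant_eq ballI)
qed

text \<open>One surjectivity argument serves all three monoids: \<open>A\<close> and \<open>B\<close> are any properties that
  correspond to each other under reduction.\<close>

lemma reduction_class_image:
  assumes "\<And>(P :: 'a seq_module) (L :: 'a set seq_module) \<pi>.
    \<lbrakk>countably_projective R P; reduction P L \<pi>\<rbrakk> \<Longrightarrow> A P \<longleftrightarrow> B L"
  shows "reduction_class R N ` {iso_class R P | P :: 'a seq_module.
      countably_projective R P \<and> A P} =
    {iso_class (R Quot N) L | L :: 'a set seq_module.
      countably_projective (R Quot N) L \<and> B L}" (is "_ ` ?A = ?B")
proof (intro equalityI subsetI)
  fix X assume "X \<in> reduction_class R N ` ?A"
  then obtain P :: "'a seq_module" where
    P: "X = reduction_class R N (iso_class R P)" "countably_projective R P" "A P" by blast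
  obtain L :: "'a set seq_module" and \<pi> where L: "reduction P L \<pi>"
    using reduction_exists[OF P(2)] by blast
  have "X = iso_class (R Quot N) L" using P(1) reduction_class_eq[OF P(2) L] by simp
  moreover have "countably_projective (R Quot N) L" by (rule countably_projective_reduction[OF P(2) L])
  moreover have "B L" using assms[OF P(2) L] P(3) by simp
  ultimately show "X \<in> ?B" by blast
next
  fix X assume "X \<in> ?B"
  then obtain L :: "'a set seq_module" where
    L: "X = iso_class (R Quot N) L" "countably_projective (R Quot N) L" "B L" by blast
  obtain P :: "'a seq_module" and \<pi> where P: "countably_projective R P" "reduction P L \<pi>"
    using lift_countably_projective[OF T_nilpotent L(2)] by blast
  have "A P" using assms[OF P] L(3) by simp
  moreover have "X = reduction_class R N (iso_class R P)" using L(1) reduction_class_eq[OF P] by simp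
  ultimately show "X \<in> reduction_class R N ` ?A" using P(1) by blast
qed

lemma reduction_class_iso:
  "reduction_class R N \<in> monoid_iso (Vstar_monoid R) (Vstar_monoid (R Quot N))"
proof -
  let ?\<phi> = "reduction_class R N"
  have image: "?\<phi> ` carrier (Vstar_monoid R) = carrier (Vstar_monoid (R Quot N))"
    unfolding carrier_Vstar_monoid by (rule reduction_class_image) simp
  have inj: "inj_on ?\<phi> (carrier (Vstar_monoid R))"
  proof
    fix X Y assume "X \<in> carrier (Vstar_monoid R)" "Y \<in> carrier (Vstar_monoid R)" and eq: "?\<phi> X = ?\<phi> Y"
    then obtain P Q :: "'a seq_module" where
      P: "X = iso_class R P" "countably_projective R P" and Q: "Y = iso_class R Q" "countably_projective R Q"
      unfolding carrier_Vstar_monoid by blast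
    obtain L :: "'a set seq_module" and \<pi> where L: "reduction P L \<pi>"
      using reduction_exists[OF P(2)] by blast
    obtain L' :: "'a set seq_module" and \<pi>' where L': "reduction Q L' \<pi>'"
      using reduction_exists[OF Q(2)] by blast
    have "iso_class (R Quot N) L = iso_class (R Quot N) L'"
      using eq reduction_class_eq[OF P(2) L] reduction_class_eq[OF Q(2) L'] by (simp add: P(1) Q(1))
    moreover have "L \<in> iso_class (R Quot N) L"
      using reductionD(2)[OF L] rmod_isomorphic_refl by (auto simp: iso_class_def)
    ultimately have "rmod_isomorphic (R Quot N) L L'" by (auto simp: iso_class_def)
    then have "rmod_isomorphic R P Q"
      by (rule isomorphic_if_reductions_isomorphic[OF T_nilpotent P(2) Q(2) L L'])
    then show "X = Y"
      unfolding P(1) Q(1) by (rule iso_class_eq[OF countably_projective_module[OF P(2)]])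
  qed
  have mult: "?\<phi> (X \<otimes>\<^bsub>Vstar_monoid R\<^esub> Y) = ?\<phi> X \<otimes>\<^bsub>Vstar_monoid (R Quot N)\<^esub> ?\<phi> Y"
    if XY: "X \<in> carrier (Vstar_monoid R)" "Y \<in> carrier (Vstar_monoid R)" for X Y
  proof -
    obtain P Q :: "'a seq_module" where
      P: "X = iso_class R P" "countably_projective R P" and Q: "Y = iso_class R Q" "countably_projective R Q"
      using XY unfolding carrier_Vstar_monoid by blast
    obtain L :: "'a set seq_module" and \<pi> where L: "reduction P L \<pi>"
      using reduction_exists[OF P(2)] by blast
    obtain L' :: "'a set seq_module" and \<pi>' where L': "reduction Q L' \<pi>'"
      using reduction_exists[OF Q(2)] by blast
    show ?thesis
      unfolding P(1) Q(1) reduction_class_eq[OF P(2) L] reduction_class_eq[OF Q(2) L']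
        Vstar_monoid_mult[OF reductionD(1)[OF L] reductionD(1)[OF L']]
        Vstar_monoid_mult[OF reductionD(2)[OF L] reductionD(2)[OF L']]
      by (rule reduction_class_eq[OF countably_projective_sum[OF P(2) Q(2)] reduction_sum[OF L L']])
  qed
  have "?\<phi> \<one>\<^bsub>Vstar_monoid R\<^esub> = \<one>\<^bsub>Vstar_monoid (R Quot N)\<^esub>"
    using reduction_class_eq[OF countably_projective_zero[OF ring] reduction_zero_module]
    by (simp add: Vstar_monoid_def)
  then show ?thesis
    using image inj mult by (auto simp: monoid_iso_def iso_def hom_def bij_betw_def)
qed

lemma reduction_class_fg:
  "reduction_class R N ` fg_projective_classes R = fg_projective_classes (R Quot N)"
  unfolding fg_projective_classes_eq
  by (rule reduction_class_image) (rule finitely_generated_reduction[OF T_nilpotent])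

lemma reduction_class_big:
  "reduction_class R N ` big_projective_classes R = big_projective_classes (R Quot N)"
  unfolding big_projective_classes_eq
  by (rule reduction_class_image)
     (simp only: finitely_generated_reduction[OF T_nilpotent] relatively_big_reduction[OF T_nilpotent])

lemma reduction_class_reduction:
  assumes "countably_projective R P"
  shows "reduction_class R N (iso_class R P) = iso_class (R Quot N) (rmod_reduction P N)"
    and "reduction_class R N (iso_class R P) =
      iso_class (R Quot N) (extend_scalars R (R Quot N) ((+>\<^bsub>R\<^esub>) N) P)"
proof -
  note red = reduction_rmod_reduction[OF countably_projective_module[OF assms] ideal]
  show eq: "reduction_class R N (iso_class R P) = iso_class (R Quot N) (rmod_reduction P N)"
    by (rule reduction_class_eq[OF assms red])
  show "reduction_class R N (iso_class R P) =
      iso_class (R Quot N) (extend_scalars R (R Quot N) ((+>\<^bsub>R\<^esub>) N) P)"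
    unfolding eq
    by (rule iso_class_eq[OF reductionD(2)[OF red] reduction_isomorphic_extend_scalars[OF red]])
qed

end

theorem corollary3p3:
  fixes R :: "('a, 'r) ring_scheme" and N :: "'a set"
  assumes "ring R" and "ideal N R" and "right_T_nilpotent R N"
  shows "\<exists>\<phi> :: 'a rmod_class \<Rightarrow> 'a set rmod_class.
    (\<forall>P :: ('a, nat \<Rightarrow> 'a) right_module. projective R P \<and> countably_generated R P \<longrightarrow>
       \<phi> (iso_class R P) = iso_class (R Quot N) (extend_scalars R (R Quot N) ((+>\<^bsub>R\<^esub>) N) P) \<and>
       \<phi> (iso_class R P) = iso_class (R Quot N) (rmod_reduction P N)) \<and>
    \<phi> \<in> monoid_iso (Vstar_monoid R) (Vstar_monoid (R Quot N)) \<and>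
    \<phi> \<in> monoid_iso (V_monoid R) (V_monoid (R Quot N)) \<and>
    \<phi> \<in> monoid_iso (VB_monoid R) (VB_monoid (R Quot N))"
proof (intro exI[of _ "reduction_class R N"] conjI allI impI)
  fix P :: "('a, nat \<Rightarrow> 'a) right_module"
  assume "projective R P \<and> countably_generated R P"
  then have P: "countably_projective R P" by (simp add: projective_countably_generated_iff)
  show "reduction_class R N (iso_class R P) =
      iso_class (R Quot N) (extend_scalars R (R Quot N) ((+>\<^bsub>R\<^esub>) N) P)"
    by (rule reduction_class_reduction(2)[OF assms P])
  show "reduction_class R N (iso_class R P) = iso_class (R Quot N) (rmod_reduction P N)"
    by (rule reduction_class_reduction(1)[OF assms P])
next
  have fg: "fg_projective_classes R \<subseteq> carrier (Vstar_monoid R)"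
    unfolding fg_projective_classes_eq carrier_Vstar_monoid by blast
  have big: "big_projective_classes R \<subseteq> carrier (Vstar_monoid R)"
    unfolding big_projective_classes_eq carrier_Vstar_monoid by blast
  show iso: "reduction_class R N \<in> monoid_iso (Vstar_monoid R) (Vstar_monoid (R Quot N))"
    by (rule reduction_class_iso[OF assms])
  show "reduction_class R N \<in> monoid_iso (V_monoid R) (V_monoid (R Quot N))"
    unfolding V_monoid_def
    by (rule monoid_iso_restrict[OF iso fg reduction_class_fg[OF assms]])
  show "reduction_class R N \<in> monoid_iso (VB_monoid R) (VB_monoid (R Quot N))"
    unfolding VB_monoid_def
    by (rule monoid_iso_restrict[OF iso])
       (use fg big in \<open>simp_all add: image_Un reduction_class_fg[OF assms] reduction_class_big[OF assms]\<close>)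
qed

end
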